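(* Let $N\geq 5$ be an integer and $-2<\gamma\leq 0$. For all $u\in\mathcal{D}^{2,2}_{0,\gamma}(\mathbb{R}^N)$, $$\int_{\mathbb{R}^N}\frac{|\Delta u|^2}{|x|^{\gamma}}\,dx+\left(\frac{N-4-\gamma}{2}\right)^4\int_{\mathbb{R}^N}\frac{|u|^2}{|x|^{\gamma+4}}\,dx\geq\frac{N^2-4N+8+\gamma^2+4\gamma}{2}\int_{\mathbb{R}^N}\frac{|\nabla u|^2}{|x|^{\gamma+2}}\,dx.$$ The constant $\frac{N^2-4N+8+\gamma^2+4\gamma}{2}$ is sharp (i.e. it cannot be replaced by a larger one), and the inequality is strict for any nonzero $u$.
   Context: $\mathcal{D}^{2,2}_{0,\gamma}(\mathbb{R}^N)$ denotes the completion of $C^\infty_0(\mathbb{R}^N)$ with respect to the norm $\left(\int_{\mathbb{R}^N}|x|^{-\gamma}|\Delta u|^2\,dx\right)^{1/2}$. *)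

theory Defs
  imports "HOL-Analysis.Analysis"
begin

definition partial_deriv :: "'a::euclidean_space \<Rightarrow> ('a \<Rightarrow> real) \<Rightarrow> 'a \<Rightarrow> real" where
  "partial_deriv b f x = frechet_derivative f (at x) b"

primrec Ck :: "nat \<Rightarrow> ('a::euclidean_space \<Rightarrow> real) \<Rightarrow> bool" where
  "Ck 0 f \<longleftrightarrow> continuous_on UNIV f"
| "Ck (Suc k) f \<longleftrightarrow> f differentiable_on UNIV \<and> (\<forall>b\<in>Basis. Ck k (partial_deriv b f))"

text \<open>The space of compactly supported smooth functions on the whole space
  (the support may contain the origin).\<close>

definition test_function :: "('a::euclidean_space \<Rightarrow> real) \<Rightarrow> bool" where
  "test_function f \<longleftrightarrow> (\<forall>k. Ck k f) \<and> compact (closure {x. f x \<noteq> 0})"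

definition laplacian :: "('a::euclidean_space \<Rightarrow> real) \<Rightarrow> 'a \<Rightarrow> real" where
  "laplacian f x = (\<Sum>b\<in>Basis. partial_deriv b (partial_deriv b f) x)"

definition locally_integrable :: "('a::euclidean_space \<Rightarrow> 'b::euclidean_space) \<Rightarrow> bool" where
  "locally_integrable f \<longleftrightarrow> (\<forall>K. compact K \<longrightarrow> set_integrable lborel K f)"

definition has_weak_gradient :: "('a::euclidean_space \<Rightarrow> real) \<Rightarrow> ('a \<Rightarrow> 'a) \<Rightarrow> bool" where
  "has_weak_gradient u g \<longleftrightarrow> locally_integrable u \<and> locally_integrable g \<and>
     (\<forall>\<phi>. test_function \<phi> \<longrightarrow> (\<forall>b\<in>Basis.
        (\<integral>x. u x * partial_deriv b \<phi> x \<partial>lborel) = - (\<integral>x. (g x \<bullet> b) * \<phi> x \<partial>lborel)))"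

definition has_weak_laplacian :: "('a::euclidean_space \<Rightarrow> real) \<Rightarrow> ('a \<Rightarrow> real) \<Rightarrow> bool" where
  "has_weak_laplacian u h \<longleftrightarrow> locally_integrable u \<and> locally_integrable h \<and>
     (\<forall>\<phi>. test_function \<phi> \<longrightarrow>
        (\<integral>x. u x * laplacian \<phi> x \<partial>lborel) = (\<integral>x. h x * \<phi> x \<partial>lborel))"

text \<open>Weak derivatives are unique only almost everywhere; they are used below only under
  integrals, where the choice of representative does not matter.\<close>

definition weak_gradient :: "('a::euclidean_space \<Rightarrow> real) \<Rightarrow> 'a \<Rightarrow> 'a" where
  "weak_gradient u = (SOME g. has_weak_gradient u g)"

definition weak_laplacian :: "('a::euclidean_space \<Rightarrow> real) \<Rightarrow> 'a \<Rightarrow> real" where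
  "weak_laplacian u = (SOME h. has_weak_laplacian u h)"

definition D22_norm :: "real \<Rightarrow> ('a::euclidean_space \<Rightarrow> real) \<Rightarrow> real" where
  "D22_norm \<gamma> \<phi> = sqrt (\<integral>x. norm x powr (- \<gamma>) * \<bar>laplacian \<phi> x\<bar>\<^sup>2 \<partial>lborel)"

text \<open>The completion of the test functions under \<^const>\<open>D22_norm\<close>, realised as a space of
  functions: a Cauchy sequence of test functions is represented by its limit in
  \<open>L\<^sup>1\<^sub>l\<^sub>o\<^sub>c\<close>.  For dimension at least 5 and \<open>-2 < \<gamma> \<le> 0\<close> the weighted Rellich inequality makes
  every Cauchy sequence converge in \<open>L\<^sup>1\<^sub>l\<^sub>o\<^sub>c\<close>, and two Cauchy sequences have almost everywhere
  equal limits iff their difference tends to 0 in the norm, so this is the completion up to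
  almost everywhere equality.  Outside that range of parameters the set need not be the
  completion.\<close>

definition D22 :: "real \<Rightarrow> ('a::euclidean_space \<Rightarrow> real) set" where
  "D22 \<gamma> = {u. locally_integrable u \<and>
     (\<exists>\<phi> :: nat \<Rightarrow> 'a \<Rightarrow> real.
        (\<forall>n. test_function (\<phi> n)) \<and>
        (\<forall>e>0. \<exists>M. \<forall>m\<ge>M. \<forall>n\<ge>M. D22_norm \<gamma> (\<lambda>x. \<phi> m x - \<phi> n x) < e) \<and>
        (\<forall>K. compact K \<longrightarrow> (\<lambda>n. LINT x:K|lborel. \<bar>\<phi> n x - u x\<bar>) \<longlonglongrightarrow> 0))}"

text \<open>The integral of \<open>|f|\<^sup>2 / |x|\<^sup>s\<close> over the whole space, with values in \<open>[0,\<infinity>]\<close>, so that a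
  divergent integral is \<open>\<infinity>\<close> and not 0.\<close>

definition weighted_int :: "real \<Rightarrow> ('a::euclidean_space \<Rightarrow> 'b::real_normed_vector) \<Rightarrow> ennreal" where
  "weighted_int s f = (\<integral>\<^sup>+x. ennreal ((norm (f x))\<^sup>2 / norm x powr s) \<partial>lborel)"

end

theory Submission
  imports Defs
begin

text \<open>Put \<open>s = \<gamma> + 4\<close>, \<open>a = (N - s) / 2\<close>, \<open>b = (N + \<gamma>) / 2\<close>, so that the sharp constant is
  \<open>a\<^sup>2 + b\<^sup>2\<close>.  For the weight \<open>|x|\<^sup>-\<^sup>s\<close> the operator \<open>D = x \<cdot> \<nabla> + a\<close> and the rotation fields
  \<open>X\<^sub>i\<^sub>j = x\<^sub>i \<partial>\<^sub>j - x\<^sub>j \<partial>\<^sub>i\<close> are antisymmetric, they commute, and with the spherical Laplacian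
  \<open>L = \<Sum>\<^sub>i\<^sub><\<^sub>j X\<^sub>i\<^sub>j\<^sup>2\<close> one has \<open>|x|\<^sup>2 \<Delta> = D\<^sup>2 + (b - a) D - a b + L\<close>.  Expanding the squares, the difference
  of the two sides of the inequality becomes
  \<open>\<parallel>D\<^sup>2 u\<parallel>\<^sup>2 + 2 \<parallel>X D u\<parallel>\<^sup>2 + \<parallel>L u\<parallel>\<^sup>2 - (b - a)\<^sup>2 \<parallel>X u\<parallel>\<^sup>2\<close>, and
  \<open>\<parallel>L u\<parallel>\<^sup>2 \<ge> (N - 1) \<parallel>X u\<parallel>\<^sup>2\<close> by a Bochner argument, while \<open>(b - a)\<^sup>2 = (\<gamma> + 2)\<^sup>2 \<le> 4 \<le> N - 1\<close>.  So the
  difference is at least \<open>\<parallel>D\<^sup>2 u\<parallel>\<^sup>2\<close>.  If it vanishes then, since \<open>\<parallel>D u\<parallel>\<^sup>2 \<le> \<parallel>u\<parallel> \<parallel>D\<^sup>2 u\<parallel>\<close>, also \<open>D u = 0\<close>,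
  and \<open>u = 0\<close> because \<open>u\<close> has finite weighted norm.  For sharpness take \<open>u = |x|\<^sup>-\<^sup>a v\<close> with \<open>v\<close> a radial
  plateau between radii \<open>2\<close> and \<open>2\<^sup>K\<close>: the difference stays bounded while \<open>\<parallel>u\<parallel>\<^sup>2\<close> grows like \<open>K\<close>.\<close>

subsection \<open>Smooth functions\<close>

text \<open>The shift \<open>a\<close> is half of \<open>N - s\<close>, the divergence factor of the
  field \<open>x\<close> against the weight \<open>|x|^-s\<close>. This makes \<open>D\<close>
  antisymmetric, so all terms odd in \<open>D\<close> drop out, and the zero order terms balance
  because \<open>a^2 b^2 + a^4 = a^2 (a^2 + b^2)\<close>, where \<open>a^4\<close> is the given
  constant. Three obstacles shape the proof. Test functions need not vanish at the singularity of
  the weight, so integration by parts is done with \<open>(|x|^2 + e)^(-s/2)\<close> and passed to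
  the limit, which works because \<open>s < N\<close>. Spherical harmonics are avoided: the
  eigenvalue \<open>N - 1\<close> comes from a pointwise inequality between second derivatives in
  Cartesian coordinates. Finally, \<open>D\<close> is never extended to the completion:
  \<open>u\<close> is reached through one sequence of test functions whose energies converge by
  Rellich estimates, and strictness rests on quantitative bounds for this sequence. The profile
  \<open>|x|^-a\<close> of the sharpness part solves \<open>D u = 0\<close> and misses the space
  only logarithmically, which is why dyadic shells, all of equal mass, measure it.\<close>

abbreviation pd :: "'a::euclidean_space \<Rightarrow> ('a \<Rightarrow> real) \<Rightarrow> 'a \<Rightarrow> real" where
  "pd \<equiv> partial_deriv"

definition smooth :: "('a::euclidean_space \<Rightarrow> real) \<Rightarrow> bool" where
  "smooth f \<longleftrightarrow> (\<forall>k. Ck k f)"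

lemma pd_has_derivative: "(f has_derivative f') (at x) \<Longrightarrow> pd b f x = f' b"
  by (simp add: partial_deriv_def frechet_derivative_at[symmetric])

lemma has_derivative_frechet:
  assumes "f differentiable (at x)"
  shows "(f has_derivative (\<lambda>h. \<Sum>b\<in>Basis. (h \<bullet> b) * pd b f x)) (at x)"
proof -
  have 1: "(f has_derivative frechet_derivative f (at x)) (at x)"
    using assms frechet_derivative_works by blast
  then interpret linear "frechet_derivative f (at x)"
    by (simp add: has_derivative_linear)
  have "frechet_derivative f (at x) h = (\<Sum>b\<in>Basis. (h \<bullet> b) * pd b f x)" for h
  proof -
    have "frechet_derivative f (at x) h = frechet_derivative f (at x) (\<Sum>b\<in>Basis. (h \<bullet> b) *\<^sub>R b)"
      by (simp add: euclidean_representation)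
    also have "\<dots> = (\<Sum>b\<in>Basis. (h \<bullet> b) * pd b f x)"
      by (simp add: sum scale partial_deriv_def)
    finally show ?thesis .
  qed
  then show ?thesis using 1 by presburger
qed

lemma pd_add:
  assumes "f differentiable (at x)" "g differentiable (at x)"
  shows "pd b (\<lambda>x. f x + g x) x = pd b f x + pd b g x"
proof -
  have "(f has_derivative frechet_derivative f (at x)) (at x)"
       "(g has_derivative frechet_derivative g (at x)) (at x)"
    using assms frechet_derivative_works by blast+
  then have "((\<lambda>x. f x + g x) has_derivative
     (\<lambda>h. frechet_derivative f (at x) h + frechet_derivative g (at x) h)) (at x)"
    by (rule has_derivative_add)
  from pd_has_derivative[OF this] show ?thesis
    by (simp add: partial_deriv_def)
qed

lemma pd_mult:
  fixes f g :: "'a::euclidean_space \<Rightarrow> real"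
  assumes "f differentiable (at x)" "g differentiable (at x)"
  shows "pd b (\<lambda>x. f x * g x) x = f x * pd b g x + pd b f x * g x"
proof -
  have "(f has_derivative frechet_derivative f (at x)) (at x)"
       "(g has_derivative frechet_derivative g (at x)) (at x)"
    using assms frechet_derivative_works by blast+
  then have "((\<lambda>x. f x * g x) has_derivative
     (\<lambda>h. f x * frechet_derivative g (at x) h + frechet_derivative f (at x) h * g x)) (at x)"
    by (rule has_derivative_mult)
  from pd_has_derivative[OF this] show ?thesis
    by (simp add: partial_deriv_def)
qed

lemma pd_const [simp]: "pd b (\<lambda>x. c) = (\<lambda>x. 0)"
  by (rule ext) (rule pd_has_derivative[OF has_derivative_const])

lemma pd_inner [simp]: "pd b (\<lambda>x. x \<bullet> c) = (\<lambda>x. b \<bullet> c)"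
  by (rule ext, rule pd_has_derivative[where f'="\<lambda>h. h \<bullet> c"]) (auto intro!: derivative_eq_intros)

lemma pd_compose:
  fixes F :: "real \<Rightarrow> real"
  assumes "f differentiable (at x)" "F differentiable (at (f x))"
  shows "pd b (\<lambda>x. F (f x)) x = pd 1 F (f x) * pd b f x"
proof -
  have 1: "(f has_derivative frechet_derivative f (at x)) (at x)"
    using assms frechet_derivative_works by blast
  have 2: "(F has_derivative (\<lambda>h. h * pd 1 F (f x))) (at (f x))"
    using has_derivative_frechet[OF assms(2)] by simp
  from pd_has_derivative[OF has_derivative_compose[OF 1 2]] show ?thesis
    by (simp add: partial_deriv_def)
qed

lemma Ck_Suc_imp: "Ck (Suc k) f \<Longrightarrow> Ck k f"
proof (induction k arbitrary: f)
  case 0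
  then show ?case by (simp add: differentiable_imp_continuous_on)
next
  case (Suc k)
  then show ?case by (metis Ck.simps(2))
qed

lemma Ck_differentiable: "Ck (Suc k) f \<Longrightarrow> f differentiable (at x)"
  by (simp add: differentiable_on_def)

lemma Ck_const [simp]: "Ck k (\<lambda>x. c)"
  by (induction k arbitrary: c) auto

lemma Ck_add: "Ck k f \<Longrightarrow> Ck k g \<Longrightarrow> Ck k (\<lambda>x. f x + g x)"
proof (induction k arbitrary: f g)
  case 0
  then show ?case by (simp add: continuous_on_add)
next
  case (Suc k)
  have "pd b (\<lambda>x. f x + g x) = (\<lambda>x. pd b f x + pd b g x)" for b
    by (rule ext) (rule pd_add; rule Ck_differentiable; fact Suc)
  with Suc show ?case by (auto simp: differentiable_on_add)
qed

lemma Ck_mult: "Ck k f \<Longrightarrow> Ck k g \<Longrightarrow> Ck k (\<lambda>x. f x * g x)"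
proof (induction k arbitrary: f g)
  case 0
  then show ?case by (simp add: continuous_on_mult)
next
  case (Suc k)
  have "pd b (\<lambda>x. f x * g x) = (\<lambda>x. f x * pd b g x + pd b f x * g x)" for b
    by (rule ext) (rule pd_mult; rule Ck_differentiable; fact Suc)
  moreover have "Ck k f" "Ck k g" using Suc.prems Ck_Suc_imp by blast+
  ultimately show ?case using Suc by (auto intro!: Ck_add differentiable_on_mult)
qed

lemma Ck_compose:
  fixes F :: "real \<Rightarrow> real"
  shows "Ck k F \<Longrightarrow> Ck k f \<Longrightarrow> Ck k (\<lambda>x. F (f x))"
proof (induction k arbitrary: F f)
  case 0
  then show ?case using continuous_on_compose2[of UNIV F UNIV f] by auto
next
  case (Suc k)
  have "pd b (\<lambda>x. F (f x)) = (\<lambda>x. pd 1 F (f x) * pd b f x)" for b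
    by (rule ext) (rule pd_compose; rule Ck_differentiable; fact Suc)
  moreover have "Ck k f" using Suc.prems Ck_Suc_imp by blast
  moreover have "(\<lambda>x. F (f x)) differentiable_on UNIV"
    using Suc.prems differentiable_chain_at[of f _ F]
    by (auto simp: differentiable_on_def o_def)
  ultimately show ?case using Suc by (auto intro!: Ck_mult)
qed

lemma Ck_inner [simp]: "Ck k (\<lambda>x. x \<bullet> c)"
  by (induction k) (auto intro!: continuous_intros derivative_intros simp: differentiable_on_def)

lemma smooth_differentiable: "smooth f \<Longrightarrow> f differentiable (at x)"
  by (meson Ck_differentiable smooth_def)

lemma smooth_pd: "smooth f \<Longrightarrow> b \<in> Basis \<Longrightarrow> smooth (pd b f)"
  by (metis Ck.simps(2) smooth_def)

lemma smooth_continuous: "smooth f \<Longrightarrow> continuous_on A f"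
  by (metis Ck.simps(1) smooth_def continuous_on_subset subset_UNIV)

named_theorems smooth_intros

lemma smooth_const [smooth_intros]: "smooth (\<lambda>x. c)"
  and smooth_inner [smooth_intros]: "smooth (\<lambda>x. x \<bullet> b)"
  and smooth_add [smooth_intros]: "smooth f \<Longrightarrow> smooth g \<Longrightarrow> smooth (\<lambda>x. f x + g x)"
  and smooth_mult [smooth_intros]: "smooth f \<Longrightarrow> smooth g \<Longrightarrow> smooth (\<lambda>x. f x * g x)"
  and smooth_compose: "smooth F \<Longrightarrow> smooth f \<Longrightarrow> smooth (\<lambda>x. F (f x))"
  by (auto simp: smooth_def Ck_add Ck_mult Ck_compose)

lemma smooth_minus [smooth_intros]: "smooth f \<Longrightarrow> smooth (\<lambda>x. - f x)"
  using smooth_mult[OF smooth_const[of "-1"]] by simp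

lemma smooth_diff [smooth_intros]: "smooth f \<Longrightarrow> smooth g \<Longrightarrow> smooth (\<lambda>x. f x - g x)"
  using smooth_add[OF _ smooth_minus] by simp

lemma smooth_sum [smooth_intros]: "(\<And>i. i \<in> A \<Longrightarrow> smooth (f i)) \<Longrightarrow> smooth (\<lambda>x. \<Sum>i\<in>A. f i x)"
  by (induction A rule: infinite_finite_induct) (auto intro!: smooth_intros)

lemma smooth_prod: "(\<And>i. i \<in> A \<Longrightarrow> smooth (f i)) \<Longrightarrow> smooth (\<lambda>x. \<Prod>i\<in>A. f i x)"
  by (induction A rule: infinite_finite_induct) (auto intro!: smooth_intros)

declare smooth_pd [smooth_intros]

lemma smooth_pd_add: "smooth f \<Longrightarrow> smooth g \<Longrightarrow> pd b (\<lambda>x. f x + g x) = (\<lambda>x. pd b f x + pd b g x)"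
  by (rule ext) (simp add: pd_add smooth_differentiable)

lemma smooth_pd_mult: "smooth f \<Longrightarrow> smooth g \<Longrightarrow>
    pd b (\<lambda>x. f x * g x) = (\<lambda>x. f x * pd b g x + pd b f x * g x)"
  by (rule ext) (simp add: pd_mult smooth_differentiable)

lemma smooth_pd_cmult: "smooth f \<Longrightarrow> pd b (\<lambda>x. c * f x) = (\<lambda>x. c * pd b f x)"
  by (simp add: smooth_pd_mult smooth_intros)

lemma smooth_pd_minus: "smooth f \<Longrightarrow> pd b (\<lambda>x. - f x) = (\<lambda>x. - pd b f x)"
  using smooth_pd_cmult[of f b "-1"] by simp

lemma smooth_pd_diff: "smooth f \<Longrightarrow> smooth g \<Longrightarrow> pd b (\<lambda>x. f x - g x) = (\<lambda>x. pd b f x - pd b g x)"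
  using smooth_pd_add[of f "\<lambda>x. - g x" b] by (simp add: smooth_pd_minus smooth_intros)

lemma smooth_pd_sum: "(\<And>i. i \<in> A \<Longrightarrow> smooth (f i)) \<Longrightarrow>
    pd b (\<lambda>x. \<Sum>i\<in>A. f i x) = (\<lambda>x. \<Sum>i\<in>A. pd b (f i) x)"
  by (induction A rule: infinite_finite_induct) (auto simp: smooth_pd_add smooth_intros)

lemma smooth_pd_compose:
  fixes F :: "real \<Rightarrow> real"
  shows "smooth F \<Longrightarrow> smooth f \<Longrightarrow> pd b (\<lambda>x. F (f x)) = (\<lambda>x. pd 1 F (f x) * pd b f x)"
  by (rule ext) (simp add: pd_compose smooth_differentiable)

lemma smooth_line_deriv:
  assumes "smooth f" "b \<in> Basis"
  shows "((\<lambda>t. f (y + t *\<^sub>R b)) has_real_derivative pd b f (y + t *\<^sub>R b)) (at t)"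
proof -
  have 1: "((\<lambda>t. y + t *\<^sub>R b) has_derivative (\<lambda>h. h *\<^sub>R b)) (at t)"
    by (auto intro!: derivative_eq_intros)
  have 2: "(f has_derivative (\<lambda>h. \<Sum>c\<in>Basis. (h \<bullet> c) * pd c f (y + t *\<^sub>R b))) (at (y + t *\<^sub>R b))"
    by (rule has_derivative_frechet[OF smooth_differentiable[OF assms(1)]])
  have "((\<lambda>t. f (y + t *\<^sub>R b)) has_derivative
        (\<lambda>h. \<Sum>c\<in>Basis. ((h *\<^sub>R b) \<bullet> c) * pd c f (y + t *\<^sub>R b))) (at t)"
    using has_derivative_compose[OF 1 2] .
  moreover have "(\<Sum>c\<in>Basis. ((h *\<^sub>R b) \<bullet> c) * pd c f (y + t *\<^sub>R b)) = pd b f (y + t *\<^sub>R b) * h" for h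
  proof -
    have "(\<Sum>c\<in>Basis. ((h *\<^sub>R b) \<bullet> c) * pd c f (y + t *\<^sub>R b)) =
          (\<Sum>c\<in>Basis. if c = b then h * pd b f (y + t *\<^sub>R b) else 0)"
      using assms(2) by (intro sum.cong) (auto simp: inner_Basis)
    then show ?thesis using assms(2) by simp
  qed
  ultimately show ?thesis by (simp only: has_field_derivative_def)
qed

text \<open>The mean value theorem is used twice: for the increment in direction \<open>c\<close> as
  a function of the shift along \<open>b\<close>, then for \<open>pd b f\<close> along
  \<open>c\<close>. The left side is symmetric in \<open>b\<close> and \<open>c\<close>, and the
  symmetry of second derivatives rests on this.\<close>

lemma second_difference:
  assumes f: "smooth f" and b: "b \<in> Basis" and c: "c \<in> Basis" and s: "s > 0"
  shows "\<exists>\<sigma> \<tau>. 0 \<le> \<sigma> \<and> \<sigma> \<le> s \<and> 0 \<le> \<tau> \<and> \<tau> \<le> s \<and>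
     f (x + s *\<^sub>R b + s *\<^sub>R c) - f (x + s *\<^sub>R b) - f (x + s *\<^sub>R c) + f x
       = s * s * pd c (pd b f) (x + \<sigma> *\<^sub>R b + \<tau> *\<^sub>R c)"
proof -
  define g where "g t = f ((x + s *\<^sub>R c) + t *\<^sub>R b) - f (x + t *\<^sub>R b)" for t
  have g: "(g has_real_derivative pd b f ((x + s *\<^sub>R c) + t *\<^sub>R b) - pd b f (x + t *\<^sub>R b)) (at t)" for t
    unfolding g_def by (intro derivative_intros smooth_line_deriv f b)
  obtain \<sigma> where \<sigma>: "0 < \<sigma>" "\<sigma> < s" and
    1: "g s - g 0 = (s - 0) * (pd b f ((x + s *\<^sub>R c) + \<sigma> *\<^sub>R b) - pd b f (x + \<sigma> *\<^sub>R b))"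
    using MVT2[of 0 s g, OF s g] by blast
  have h: "((\<lambda>t. pd b f (x + \<sigma> *\<^sub>R b + t *\<^sub>R c)) has_real_derivative
      pd c (pd b f) (x + \<sigma> *\<^sub>R b + t *\<^sub>R c)) (at t)" for t
    by (intro smooth_line_deriv smooth_pd f b c)
  obtain \<tau> where \<tau>: "0 < \<tau>" "\<tau> < s" and
    2: "pd b f (x + \<sigma> *\<^sub>R b + s *\<^sub>R c) - pd b f (x + \<sigma> *\<^sub>R b + 0 *\<^sub>R c) = (s - 0) * pd c (pd b f) (x + \<sigma> *\<^sub>R b + \<tau> *\<^sub>R c)"
    using MVT2[OF s h] by blast
  have "g s - g 0 = s * (s * pd c (pd b f) (x + \<sigma> *\<^sub>R b + \<tau> *\<^sub>R c))"
    using 1 2 by (simp add: algebra_simps)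
  then show ?thesis using \<sigma> \<tau>
    by (intro exI[of _ \<sigma>] exI[of _ \<tau>]) (simp add: g_def algebra_simps)
qed

lemma pd_commute:
  fixes f :: "'a::euclidean_space \<Rightarrow> real"
  assumes f: "smooth f" and b: "b \<in> Basis" and c: "c \<in> Basis"
  shows "pd b (pd c f) = pd c (pd b f)"
proof
  fix x :: 'a
  let ?s = "\<lambda>n::nat. 1 / real (Suc n)"
  have s0: "?s \<longlonglongrightarrow> 0" by (rule LIMSEQ_Suc[OF lim_inverse_n'[unfolded inverse_eq_divide]])
  have lim: "(\<lambda>n. g (x + \<sigma> n *\<^sub>R b + \<tau> n *\<^sub>R c)) \<longlonglongrightarrow> g x"
    if "smooth g" "\<And>n. 0 \<le> \<sigma> n \<and> \<sigma> n \<le> ?s n" "\<And>n. 0 \<le> \<tau> n \<and> \<tau> n \<le> ?s n" for g b c \<sigma> \<tau>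
  proof -
    have "\<rho> \<longlonglongrightarrow> 0" if "\<And>n. 0 \<le> \<rho> n \<and> \<rho> n \<le> ?s n" for \<rho>
      by (rule tendsto_sandwich[OF _ _ tendsto_const s0]; rule always_eventually)
        (use that in blast)+
    then have "\<sigma> \<longlonglongrightarrow> 0" "\<tau> \<longlonglongrightarrow> 0" using that by blast+
    then have "(\<lambda>n. x + \<sigma> n *\<^sub>R b + \<tau> n *\<^sub>R c) \<longlonglongrightarrow> x + 0 *\<^sub>R b + 0 *\<^sub>R c"
      by (intro tendsto_intros)
    moreover have "isCont g x" using smooth_continuous[OF that(1), of UNIV]
      by (simp add: continuous_on_eq_continuous_at)
    ultimately show ?thesis using isCont_tendsto_compose by fastforce
  qed
  have pos: "0 < ?s n" for n by simp
  obtain \<sigma> \<tau> where 1: "\<And>n. 0 \<le> \<sigma> n \<and> \<sigma> n \<le> ?s n \<and> 0 \<le> \<tau> n \<and> \<tau> n \<le> ?s n \<and>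
     f (x + ?s n *\<^sub>R b + ?s n *\<^sub>R c) - f (x + ?s n *\<^sub>R b) - f (x + ?s n *\<^sub>R c) + f x
       = ?s n * ?s n * pd c (pd b f) (x + \<sigma> n *\<^sub>R b + \<tau> n *\<^sub>R c)"
    using second_difference[OF f b c pos, where x=x] by metis
  obtain \<sigma>' \<tau>' where 2: "\<And>n. 0 \<le> \<sigma>' n \<and> \<sigma>' n \<le> ?s n \<and> 0 \<le> \<tau>' n \<and> \<tau>' n \<le> ?s n \<and>
     f (x + ?s n *\<^sub>R c + ?s n *\<^sub>R b) - f (x + ?s n *\<^sub>R c) - f (x + ?s n *\<^sub>R b) + f x
       = ?s n * ?s n * pd b (pd c f) (x + \<sigma>' n *\<^sub>R c + \<tau>' n *\<^sub>R b)"
    using second_difference[OF f c b pos, where x=x] by metis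
  \<comment> \<open>Both mixed derivatives, taken at different intermediate points, equal the same
    second difference divided by \<open>?s n * ?s n\<close>; the points converge to
    \<open>x\<close>.\<close>
  have eq: "pd c (pd b f) (x + \<sigma> n *\<^sub>R b + \<tau> n *\<^sub>R c) = pd b (pd c f) (x + \<sigma>' n *\<^sub>R c + \<tau>' n *\<^sub>R b)" for n
  proof -
    have e: "x + ?s n *\<^sub>R c + ?s n *\<^sub>R b = x + ?s n *\<^sub>R b + ?s n *\<^sub>R c" by simp
    then have "?s n * ?s n * pd c (pd b f) (x + \<sigma> n *\<^sub>R b + \<tau> n *\<^sub>R c) =
      ?s n * ?s n * pd b (pd c f) (x + \<sigma>' n *\<^sub>R c + \<tau>' n *\<^sub>R b)"
      using 1[of n] 2[of n] unfolding e by linarith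
    then show ?thesis using pos[of n] by simp
  qed
  have "(\<lambda>n. pd c (pd b f) (x + \<sigma> n *\<^sub>R b + \<tau> n *\<^sub>R c)) \<longlonglongrightarrow> pd c (pd b f) x"
    using 1 by (intro lim smooth_pd f b c) auto
  moreover have "(\<lambda>n. pd b (pd c f) (x + \<sigma>' n *\<^sub>R c + \<tau>' n *\<^sub>R b)) \<longlonglongrightarrow> pd b (pd c f) x"
    using 2 by (intro lim smooth_pd f b c) auto
  ultimately show "pd b (pd c f) x = pd c (pd b f) x"
    unfolding eq using LIMSEQ_unique by blast
qed

subsection \<open>Radial and angular derivatives\<close>

definition euler :: "('a::euclidean_space \<Rightarrow> real) \<Rightarrow> 'a \<Rightarrow> real" where
  "euler f x = (\<Sum>b\<in>Basis. (x \<bullet> b) * pd b f x)"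

definition rot :: "'a::euclidean_space \<Rightarrow> 'a \<Rightarrow> ('a \<Rightarrow> real) \<Rightarrow> 'a \<Rightarrow> real" where
  "rot b c f x = (x \<bullet> b) * pd c f x - (x \<bullet> c) * pd b f x"

text \<open>The Laplace-Beltrami operator of the unit sphere, acting in the angular variable. The
  sum runs over ordered pairs, so each rotation plane is met twice; hence the factor one half, here
  and in \<open>sphgrad2\<close>.\<close>

definition sphlap :: "('a::euclidean_space \<Rightarrow> real) \<Rightarrow> 'a \<Rightarrow> real" where
  "sphlap f x = (\<Sum>b\<in>Basis. \<Sum>c\<in>Basis. rot b c (rot b c f) x) / 2"

definition sphgrad2 :: "('a::euclidean_space \<Rightarrow> real) \<Rightarrow> 'a \<Rightarrow> real" where
  "sphgrad2 f x = (\<Sum>b\<in>Basis. \<Sum>c\<in>Basis. (rot b c f x)\<^sup>2) / 2"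

definition grad :: "('a::euclidean_space \<Rightarrow> real) \<Rightarrow> 'a \<Rightarrow> 'a" where
  "grad f x = (\<Sum>b\<in>Basis. pd b f x *\<^sub>R b)"

lemma sum_inner_Basis:
  assumes "b \<in> Basis"
  shows "(\<Sum>m\<in>Basis. (m \<bullet> b) * g m) = (g b :: real)" "(\<Sum>m\<in>Basis. (b \<bullet> m) * g m) = g b"
        "(\<Sum>m\<in>Basis. g m * (m \<bullet> b)) = (g b :: real)" "(\<Sum>m\<in>Basis. g m * (b \<bullet> m)) = g b"
proof -
  have "(\<Sum>m\<in>Basis. (m \<bullet> b) * g m) = (\<Sum>m\<in>Basis. if m = b then g b else 0)"
    by (rule sum.cong) (use assms in \<open>auto simp: inner_Basis\<close>)
  also have "\<dots> = g b" using assms by simp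
  finally show "(\<Sum>m\<in>Basis. (m \<bullet> b) * g m) = g b" .
  then show "(\<Sum>m\<in>Basis. (b \<bullet> m) * g m) = g b" "(\<Sum>m\<in>Basis. g m * (m \<bullet> b)) = (g b :: real)"
     "(\<Sum>m\<in>Basis. g m * (b \<bullet> m)) = g b" by (simp_all add: inner_commute mult.commute)
qed

lemma smooth_euler [smooth_intros]: "smooth f \<Longrightarrow> smooth (euler f)"
  unfolding euler_def[abs_def] by (intro smooth_intros) auto

lemma smooth_rot [smooth_intros]: "smooth f \<Longrightarrow> b \<in> Basis \<Longrightarrow> c \<in> Basis \<Longrightarrow> smooth (rot b c f)"
  unfolding rot_def[abs_def] by (intro smooth_intros) auto

lemma smooth_laplacian [smooth_intros]: "smooth f \<Longrightarrow> smooth (laplacian f)"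
  unfolding laplacian_def[abs_def] by (intro smooth_intros) auto

lemma smooth_sphlap [smooth_intros]: "smooth f \<Longrightarrow> smooth (sphlap f)"
  unfolding sphlap_def[abs_def] divide_inverse by (intro smooth_intros) auto

lemma smooth_norm2 [smooth_intros]: "smooth (\<lambda>x. (norm x)\<^sup>2)"
proof -
  have "(\<lambda>x::'a. (norm x)\<^sup>2) = (\<lambda>x. \<Sum>b\<in>Basis. (x \<bullet> b) * (x \<bullet> b))"
    by (rule ext) (metis power2_norm_eq_inner euclidean_inner)
  then show ?thesis by (simp only:) (intro smooth_intros)
qed

lemma pd_norm2:
  assumes "b \<in> Basis"
  shows "pd b (\<lambda>x. (norm x)\<^sup>2) = (\<lambda>x. 2 * (x \<bullet> b))"
proof -
  have 1: "(\<lambda>x::'a. (norm x)\<^sup>2) = (\<lambda>x. \<Sum>b\<in>Basis. (x \<bullet> b) * (x \<bullet> b))"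
    by (rule ext) (metis power2_norm_eq_inner euclidean_inner)
  show ?thesis unfolding 1
    by (rule ext) (simp add: smooth_pd_sum smooth_pd_mult smooth_intros sum.distrib sum_inner_Basis assms
      sum_distrib_left[symmetric] mult_2[symmetric])
qed

lemma euler_add: "smooth f \<Longrightarrow> smooth g \<Longrightarrow> euler (\<lambda>x. f x + g x) = (\<lambda>x. euler f x + euler g x)"
  by (rule ext) (simp add: euler_def smooth_pd_add distrib_left sum.distrib)

lemma euler_cmult: "smooth f \<Longrightarrow> euler (\<lambda>x. c * f x) = (\<lambda>x. c * euler f x)"
  by (rule ext) (simp add: euler_def smooth_pd_cmult sum_distrib_left algebra_simps)

lemma euler_diff: "smooth f \<Longrightarrow> smooth g \<Longrightarrow> euler (\<lambda>x. f x - g x) = (\<lambda>x. euler f x - euler g x)"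
  by (rule ext) (simp add: euler_def smooth_pd_diff right_diff_distrib sum_subtractf)

lemma euler_mult: "smooth f \<Longrightarrow> smooth g \<Longrightarrow>
    euler (\<lambda>x. f x * g x) = (\<lambda>x. f x * euler g x + euler f x * g x)"
  by (rule ext) (simp add: euler_def smooth_pd_mult sum_distrib_left sum_distrib_right sum.distrib algebra_simps)

lemma rot_add: "smooth f \<Longrightarrow> smooth g \<Longrightarrow> rot b c (\<lambda>x. f x + g x) = (\<lambda>x. rot b c f x + rot b c g x)"
  by (rule ext) (simp add: rot_def smooth_pd_add algebra_simps)

lemma rot_cmult: "smooth f \<Longrightarrow> rot b c (\<lambda>x. k * f x) = (\<lambda>x. k * rot b c f x)"
  by (rule ext) (simp add: rot_def smooth_pd_cmult algebra_simps)

lemma rot_mult: "smooth f \<Longrightarrow> smooth g \<Longrightarrow>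
    rot b c (\<lambda>x. f x * g x) = (\<lambda>x. f x * rot b c g x + rot b c f x * g x)"
  by (rule ext) (simp add: rot_def smooth_pd_mult algebra_simps)

lemma pd_euler:
  assumes f: "smooth f" and b: "b \<in> Basis"
  shows "pd b (euler f) = (\<lambda>x. pd b f x + euler (pd b f) x)"
proof
  fix x
  have "pd b (euler f) x = (\<Sum>c\<in>Basis. (x \<bullet> c) * pd b (pd c f) x + (b \<bullet> c) * pd c f x)"
    unfolding euler_def[abs_def]
    by (simp add: smooth_pd_sum smooth_pd_mult smooth_intros f)
  also have "\<dots> = pd b f x + euler (pd b f) x"
    by (simp add: sum.distrib sum_inner_Basis b euler_def pd_commute[OF f b])
  finally show "pd b (euler f) x = pd b f x + euler (pd b f) x" .
qed

lemma euler_inner: "b \<in> Basis \<Longrightarrow> euler (\<lambda>x. x \<bullet> b) = (\<lambda>x. x \<bullet> b)"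
  by (rule ext) (simp add: euler_def sum_inner_Basis)

text \<open>Dilations commute with rotations, and so do their generators.\<close>

lemma euler_rot:
  assumes f: "smooth f" and b: "b \<in> Basis" and c: "c \<in> Basis"
  shows "euler (rot b c f) = rot b c (euler f)"
proof
  fix x
  have "euler (rot b c f) x = (x \<bullet> b) * euler (pd c f) x + (x \<bullet> b) * pd c f x
     - ((x \<bullet> c) * euler (pd b f) x + (x \<bullet> c) * pd b f x)"
    unfolding rot_def[abs_def] using f b c
    by (simp add: euler_diff euler_mult euler_inner smooth_intros)
  then show "euler (rot b c f) x = rot b c (euler f) x"
    by (simp add: rot_def pd_euler f b c algebra_simps)
qed

lemma norm2_Basis: "(norm x)\<^sup>2 = (\<Sum>b\<in>Basis. (x \<bullet> b) * (x \<bullet> b))"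
  by (metis power2_norm_eq_inner euclidean_inner)

lemma euler_euler:
  assumes f: "smooth f"
  shows "euler (euler f) x = euler f x + (\<Sum>b\<in>Basis. \<Sum>c\<in>Basis. (x \<bullet> b) * (x \<bullet> c) * pd c (pd b f) x)"
proof -
  have "euler (euler f) x = (\<Sum>b\<in>Basis. (x \<bullet> b) * (pd b f x + euler (pd b f) x))"
    unfolding euler_def[of "euler f"] by (rule sum.cong) (simp_all add: pd_euler f)
  then show ?thesis
    by (simp add: distrib_left sum.distrib euler_def[of f] euler_def[of "pd _ f"] sum_distrib_left mult.assoc)
qed

lemma pd_rot:
  assumes f: "smooth f" and b: "b \<in> Basis" and c: "c \<in> Basis"
  shows "pd m (rot b c f) = (\<lambda>x. (m \<bullet> b) * pd c f x + (x \<bullet> b) * pd m (pd c f) x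
     - (m \<bullet> c) * pd b f x - (x \<bullet> c) * pd m (pd b f) x)"
  unfolding rot_def[abs_def]
  by (rule ext) (simp add: smooth_pd_diff smooth_pd_mult smooth_intros f b c)

text \<open>The Laplacian in polar coordinates, kept in Cartesian form. Applying
  \<open>rot b c\<close> twice and summing over all pairs gives \<open>|x|^2\<close> times the
  Laplacian, up to the second order radial part \<open>?q\<close> and first order terms;
  \<open>euler_euler\<close> absorbs \<open>?q\<close>.\<close>

lemma sphlap_laplacian:
  fixes f :: "'a::euclidean_space \<Rightarrow> real"
  assumes f: "smooth f"
  shows "(norm x)\<^sup>2 * laplacian f x = euler (euler f) x + (real DIM('a) - 2) * euler f x + sphlap f x"
proof -
  let ?q = "\<Sum>b\<in>Basis. \<Sum>c\<in>Basis. (x \<bullet> b) * (x \<bullet> c) * pd c (pd b f) x"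
  have "rot b c (rot b c f) x =
     ((x \<bullet> b) * ((c \<bullet> b) * pd c f x)) + ((x \<bullet> b) * (x \<bullet> b)) * pd c (pd c f) x
     - (x \<bullet> b) * pd b f x - (x \<bullet> b) * (x \<bullet> c) * pd c (pd b f) x
     - (x \<bullet> c) * pd c f x - (x \<bullet> b) * (x \<bullet> c) * pd c (pd b f) x
     + ((x \<bullet> c) * ((b \<bullet> c) * pd b f x)) + ((x \<bullet> c) * (x \<bullet> c)) * pd b (pd b f) x"
    if b: "b \<in> Basis" and c: "c \<in> Basis" for b c
    using b c by (simp add: rot_def[of b c "rot b c f"] pd_rot f pd_commute[OF f b c] algebra_simps)
  then have "2 * sphlap f x = (\<Sum>b\<in>Basis. \<Sum>c\<in>Basis.
     ((x \<bullet> b) * ((c \<bullet> b) * pd c f x)) + ((x \<bullet> b) * (x \<bullet> b)) * pd c (pd c f) x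
     - (x \<bullet> b) * pd b f x - (x \<bullet> b) * (x \<bullet> c) * pd c (pd b f) x
     - (x \<bullet> c) * pd c f x - (x \<bullet> b) * (x \<bullet> c) * pd c (pd b f) x
     + ((x \<bullet> c) * ((b \<bullet> c) * pd b f x)) + ((x \<bullet> c) * (x \<bullet> c)) * pd b (pd b f) x)"
    unfolding sphlap_def by simp
  also have "\<dots> = 2 * (euler f x + (norm x)\<^sup>2 * laplacian f x - real DIM('a) * euler f x - ?q)"
  proof -
    have 1: "(\<Sum>b\<in>Basis. \<Sum>c\<in>Basis. (x \<bullet> b) * ((c \<bullet> b) * pd c f x)) = euler f x"
      "(\<Sum>b\<in>Basis. \<Sum>c\<in>Basis. (x \<bullet> c) * ((b \<bullet> c) * pd b f x)) = euler f x"
      by (simp_all add: euler_def sum_distrib_left[symmetric] sum_inner_Basis)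
         (subst sum.swap, simp add: sum_distrib_left[symmetric] sum_inner_Basis)
    have 2: "(\<Sum>b\<in>Basis. \<Sum>c\<in>Basis. ((x \<bullet> b) * (x \<bullet> b)) * pd c (pd c f) x) = (norm x)\<^sup>2 * laplacian f x"
      by (simp add: norm2_Basis laplacian_def sum_product)
    have 3: "(\<Sum>b\<in>Basis. \<Sum>c\<in>Basis. ((x \<bullet> c) * (x \<bullet> c)) * pd b (pd b f) x) = (norm x)\<^sup>2 * laplacian f x"
      using 2 by (subst sum.swap)
    have 4: "(\<Sum>b\<in>Basis. \<Sum>c\<in>(Basis::'a set). (x \<bullet> b) * pd b f x) = real DIM('a) * euler f x"
      by (simp add: euler_def sum_distrib_left)
    have 5: "(\<Sum>b\<in>(Basis::'a set). \<Sum>c\<in>Basis. (x \<bullet> c) * pd c f x) = real DIM('a) * euler f x"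
      by (simp add: euler_def)
    show ?thesis
      by (simp only: sum.distrib sum_subtractf 1 2 3 4 5) (simp add: algebra_simps)
  qed
  finally show ?thesis using euler_euler[OF f, of x] by (simp add: algebra_simps)
qed

section \<open>The Bochner inequality on spheres\<close>

text \<open>The Cauchy-Binet (Lagrange) identity for two wedge products; summing over ordered pairs
  produces the factor 2. It turns sums over rotation fields into plain inner products.\<close>

lemma sum_wedge:
  fixes a b c d :: "'i \<Rightarrow> real"
  shows "(\<Sum>k\<in>S. \<Sum>l\<in>S. (a k * b l - a l * b k) * (c k * d l - c l * d k))
     = 2 * ((\<Sum>k\<in>S. a k * c k) * (\<Sum>k\<in>S. b k * d k) - (\<Sum>k\<in>S. a k * d k) * (\<Sum>k\<in>S. b k * c k))"
proof -
  have s: "(\<Sum>k\<in>S. \<Sum>l\<in>S. p l * q k) = (\<Sum>k\<in>S. p k) * (\<Sum>k\<in>S. q k)" for p q :: "'i \<Rightarrow> real"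
    by (subst sum.swap) (simp add: sum_product)
  have "(a k * b l - a l * b k) * (c k * d l - c l * d k) =
      (a k * c k) * (b l * d l) - (a k * d k) * (b l * c l) + ((a l * c l) * (b k * d k) - (a l * d l) * (b k * c k))"
    for k l by (simp add: algebra_simps)
  then have "(\<Sum>k\<in>S. \<Sum>l\<in>S. (a k * b l - a l * b k) * (c k * d l - c l * d k)) =
     (\<Sum>k\<in>S. \<Sum>l\<in>S. (a k * c k) * (b l * d l)) - (\<Sum>k\<in>S. \<Sum>l\<in>S. (a k * d k) * (b l * c l))
     + ((\<Sum>k\<in>S. \<Sum>l\<in>S. (a l * c l) * (b k * d k)) - (\<Sum>k\<in>S. \<Sum>l\<in>S. (a l * d l) * (b k * c k)))"
    by (simp only: sum.distrib sum_subtractf)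
  then show ?thesis by (simp only: s sum_product[symmetric]) simp
qed

lemma sphgrad2_norm: "sphgrad2 f x = (norm x)\<^sup>2 * (\<Sum>b\<in>Basis. (pd b f x)\<^sup>2) - (euler f x)\<^sup>2"
proof -
  have "(\<Sum>b\<in>Basis. pd b f x * (x \<bullet> b)) = euler f x"
    by (simp add: euler_def mult.commute)
  then show ?thesis
    using sum_wedge[of "\<lambda>b. x \<bullet> b" "\<lambda>b. pd b f x" "\<lambda>b. x \<bullet> b" "\<lambda>b. pd b f x" Basis]
    by (simp add: sphgrad2_def rot_def norm2_Basis euler_def[symmetric] power2_eq_square[of "pd _ f x"]
        power2_eq_square[of "euler f x"] power2_eq_square[of "_ - _ * _"])
qed

lemma norm_grad: "(norm (grad f x))\<^sup>2 = (\<Sum>b\<in>Basis. (pd b f x)\<^sup>2)"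
  unfolding grad_def norm2_Basis
  by (intro sum.cong refl) (simp add: inner_sum_left sum_inner_Basis power2_eq_square)

lemma norm_grad_polar: "(norm x)\<^sup>2 * (norm (grad f x))\<^sup>2 = (euler f x)\<^sup>2 + sphgrad2 f x"
  by (simp add: sphgrad2_norm norm_grad)

lemma rot_norm2_mult:
  assumes f: "smooth f" and b: "b \<in> Basis" and c: "c \<in> Basis"
  shows "rot b c (\<lambda>x. (norm x)\<^sup>2 * f x) = (\<lambda>x. (norm x)\<^sup>2 * rot b c f x)"
proof -
  have "rot b c (\<lambda>x. (norm x)\<^sup>2) = (\<lambda>x. 0)"
    by (rule ext) (simp add: rot_def pd_norm2 b c)
  then show ?thesis by (simp add: rot_mult smooth_intros f)
qed

lemma laplacian_pd:
  assumes f: "smooth f" and b: "b \<in> Basis"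
  shows "pd b (laplacian f) = laplacian (pd b f)"
proof
  fix x
  have "pd b (laplacian f) x = (\<Sum>c\<in>Basis. pd b (pd c (pd c f)) x)"
    unfolding laplacian_def[abs_def] by (simp add: smooth_pd_sum smooth_intros f)
  also have "\<dots> = laplacian (pd b f) x"
    unfolding laplacian_def
    by (rule sum.cong) (simp_all add: pd_commute[OF smooth_pd[OF f] b] pd_commute[OF f b])
  finally show "pd b (laplacian f) x = laplacian (pd b f) x" .
qed

lemma laplacian_rot:
  assumes f: "smooth f" and b: "b \<in> Basis" and c: "c \<in> Basis"
  shows "laplacian (rot b c f) = rot b c (laplacian f)"
proof
  fix x
  have "pd m (pd m (rot b c f)) x = 2 * ((m \<bullet> b) * pd m (pd c f) x) + (x \<bullet> b) * pd m (pd m (pd c f)) x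
     - 2 * ((m \<bullet> c) * pd m (pd b f) x) - (x \<bullet> c) * pd m (pd m (pd b f)) x"
    if m: "m \<in> Basis" for m
    by (simp add: pd_rot f b c m smooth_pd_diff smooth_pd_add smooth_pd_mult smooth_intros)
  then have "laplacian (rot b c f) x = (\<Sum>m\<in>Basis. 2 * ((m \<bullet> b) * pd m (pd c f) x) + (x \<bullet> b) * pd m (pd m (pd c f)) x
     - 2 * ((m \<bullet> c) * pd m (pd b f) x) - (x \<bullet> c) * pd m (pd m (pd b f)) x)"
    unfolding laplacian_def by simp
  also have "\<dots> = 2 * pd b (pd c f) x + (x \<bullet> b) * laplacian (pd c f) x - 2 * pd c (pd b f) x
     - (x \<bullet> c) * laplacian (pd b f) x"
    by (simp add: sum.distrib sum_subtractf sum_distrib_left[symmetric] sum_inner_Basis b c laplacian_def)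
  also have "\<dots> = rot b c (laplacian f) x"
    by (simp add: rot_def laplacian_pd f b c pd_commute[OF f b c])
  finally show "laplacian (rot b c f) x = rot b c (laplacian f) x" .
qed

text \<open>By the polar formula \<open>sphlap\<close> is built from the Laplacian,
  \<open>|x|^2\<close> and \<open>euler\<close>, each of which commutes with \<open>rot b c\<close>.
  This avoids the commutators of the rotation fields among themselves.\<close>

lemma sphlap_rot:
  fixes f :: "'a::euclidean_space \<Rightarrow> real"
  assumes f: "smooth f" and b: "b \<in> Basis" and c: "c \<in> Basis"
  shows "sphlap (rot b c f) = rot b c (sphlap f)"
proof -
  let ?N = "real DIM('a)"
  have e: "sphlap g = (\<lambda>x. (norm x)\<^sup>2 * laplacian g x + ((-1) * euler (euler g) x + (2 - ?N) * euler g x))"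
    if "smooth g" for g :: "'a \<Rightarrow> real"
    by (rule ext) (use sphlap_laplacian[OF that] in \<open>simp add: algebra_simps\<close>)
  have "rot b c (sphlap f) = (\<lambda>x. rot b c (\<lambda>x. (norm x)\<^sup>2 * laplacian f x) x +
      rot b c (\<lambda>x. (-1) * euler (euler f) x + (2 - ?N) * euler f x) x)"
    unfolding e[OF f] by (rule rot_add; intro smooth_intros f)
  also have "rot b c (\<lambda>x. (-1) * euler (euler f) x + (2 - ?N) * euler f x) =
     (\<lambda>x. rot b c (\<lambda>x. (-1) * euler (euler f) x) x + rot b c (\<lambda>x. (2 - ?N) * euler f x) x)"
    by (rule rot_add; intro smooth_intros f)
  also have "rot b c (\<lambda>x. (-1) * euler (euler f) x) = (\<lambda>x. (-1) * rot b c (euler (euler f)) x)"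
    by (rule rot_cmult; intro smooth_intros f)
  also have "rot b c (\<lambda>x. (2 - ?N) * euler f x) = (\<lambda>x. (2 - ?N) * rot b c (euler f) x)"
    by (rule rot_cmult; intro smooth_intros f)
  finally show ?thesis
    by (simp add: e smooth_intros f b c euler_rot laplacian_rot rot_norm2_mult)
qed

text \<open>For \<open>R\<close> nonzero let \<open>P = I - x x^T / R\<close> be the projection off
  \<open>x\<close>. The bracket is \<open>R^2\<close> times the squared Hilbert-Schmidt norm of
  \<open>P H P\<close>, and \<open>R * tr - q\<close> is \<open>R\<close> times its trace. The claim
  is the trace inequality \<open>trace^2 <= dimension * norm^2\<close> on the complement of
  \<open>x\<close>, of dimension \<open>card S - 1\<close>.\<close>

lemma trace_square_ineq:
  fixes H :: "'i \<Rightarrow> 'i \<Rightarrow> real" and x :: "'i \<Rightarrow> real"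
  assumes fin: "finite S" and sym: "\<And>i j. i \<in> S \<Longrightarrow> j \<in> S \<Longrightarrow> H i j = H j i"
    and N: "card S \<ge> 2"
  defines "R \<equiv> \<Sum>i\<in>S. x i * x i" and "y \<equiv> \<lambda>i. \<Sum>j\<in>S. H i j * x j"
  defines "q \<equiv> \<Sum>i\<in>S. x i * y i" and "tr \<equiv> \<Sum>i\<in>S. H i i"
  shows "(R * tr - q)\<^sup>2 \<le> (real (card S) - 1) * (R\<^sup>2 * (\<Sum>i\<in>S. \<Sum>j\<in>S. H i j * H i j) - 2 * R * (\<Sum>i\<in>S. y i * y i) + q\<^sup>2)"
proof (cases "R = 0")
  case True
  then have "\<And>i. i \<in> S \<Longrightarrow> x i = 0"
    using fin by (simp add: R_def sum_nonneg_eq_0_iff)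
  then have "q = 0" by (simp add: q_def)
  then show ?thesis using True by simp
next
  case False
  define N where "N = real (card S)"
  define h where "h = (\<Sum>i\<in>S. \<Sum>j\<in>S. H i j * H i j)"
  define Y where "Y = (\<Sum>i\<in>S. y i * y i)"
  define t where "t = R * tr - q"
  define D where "D i j = (if i = j then 1 else 0 :: real)" for i j :: 'i
  have yt: "y j = (\<Sum>i\<in>S. H i j * x i)" if "j \<in> S" for j
    unfolding y_def by (rule sum.cong) (auto simp: sym that)
  have cHH: "(\<Sum>i\<in>S. \<Sum>j\<in>S. H i j * H i j) = h" by (simp add: h_def)
  have cH2: "(\<Sum>i\<in>S. \<Sum>j\<in>S. H i j * (x j * y i)) = Y"
    by (simp add: Y_def y_def sum_distrib_left sum_distrib_right algebra_simps)
  have cH1: "(\<Sum>i\<in>S. \<Sum>j\<in>S. H i j * (x i * y j)) = Y"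
    by (subst sum.swap, subst cH2[symmetric]) (intro sum.cong; simp add: sym)
  have cH3: "(\<Sum>i\<in>S. \<Sum>j\<in>S. H i j * (x i * x j)) = q"
    by (simp add: q_def y_def sum_distrib_left algebra_simps)
  have dl: "(\<Sum>i\<in>S. \<Sum>j\<in>S. g i j * D i j) = (\<Sum>i\<in>S. g i i)" for g
    using fin by (simp add: D_def if_distrib[of "\<lambda>z. _ * z"] cong: if_cong)
  have pr: "(\<Sum>i\<in>S. \<Sum>j\<in>S. a i * b i * (c j * d j)) = (\<Sum>i\<in>S. a i * b i) * (\<Sum>i\<in>S. c i * d i)"
    for a b c d :: "'i \<Rightarrow> real" by (simp add: sum_product)
  have q': "(\<Sum>i\<in>S. y i * x i) = q" by (simp add: q_def mult.commute)
  have c1: "(\<Sum>i\<in>S. \<Sum>j\<in>S. x i * y j * (x i * y j)) = R * Y"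
    using pr[of x x y y] by (simp add: R_def Y_def algebra_simps)
  have c2: "(\<Sum>i\<in>S. \<Sum>j\<in>S. x i * y j * (x j * y i)) = q * q"
    using pr[of x y x y] by (simp add: q_def algebra_simps)
  have c3: "(\<Sum>i\<in>S. \<Sum>j\<in>S. x j * y i * (x j * y i)) = R * Y"
    using pr[of y y x x] by (simp add: R_def Y_def algebra_simps)
  have c4: "(\<Sum>i\<in>S. \<Sum>j\<in>S. x i * y j * (x i * x j)) = R * q"
    using pr[of x x x y] by (simp add: R_def q_def algebra_simps)
  have c5: "(\<Sum>i\<in>S. \<Sum>j\<in>S. x j * y i * (x i * x j)) = R * q"
    using pr[of x y x x] by (simp add: R_def q_def algebra_simps)
  have c6: "(\<Sum>i\<in>S. \<Sum>j\<in>S. x i * x j * (x i * x j)) = R * R"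
    using pr[of x x x x] by (simp add: R_def algebra_simps)
  have d0: "(\<Sum>i\<in>S. \<Sum>j\<in>S. H i j * D i j) = tr" by (simp add: dl tr_def)
  have d1: "(\<Sum>i\<in>S. \<Sum>j\<in>S. x i * y j * D i j) = q" by (simp add: dl q_def)
  have d2: "(\<Sum>i\<in>S. \<Sum>j\<in>S. x j * y i * D i j) = q" by (simp add: dl q_def)
  have d3: "(\<Sum>i\<in>S. \<Sum>j\<in>S. x i * x j * D i j) = R" by (simp add: dl R_def)
  have d4: "(\<Sum>i\<in>S. \<Sum>j\<in>S. D i j * D i j) = N" by (simp add: dl N_def) (simp add: D_def)
  \<comment> \<open>Free coefficients, so that only the pairwise inner products of \<open>H\<close>,
    \<open>x y^T\<close>, \<open>y x^T\<close>, \<open>x x^T\<close> and the identity enter, all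
    evaluated above.\<close>
  have sq: "(\<Sum>i\<in>S. \<Sum>j\<in>S. (a * H i j + b * (x i * y j) + b * (x j * y i) + c * (x i * x j) + d * D i j)\<^sup>2) =
     a * a * h + 4 * a * b * Y + 2 * a * c * q + 2 * a * d * tr + 2 * b * b * (R * Y) + 2 * b * b * (q * q)
     + 4 * b * c * (R * q) + 4 * b * d * q + c * c * (R * R) + 2 * c * d * R + d * d * N" for a b c d
  proof -
    have "(a * H i j + b * (x i * y j) + b * (x j * y i) + c * (x i * x j) + d * D i j)\<^sup>2 =
      (a * a) * (H i j * H i j) + (2 * a * b) * (H i j * (x i * y j)) + (2 * a * b) * (H i j * (x j * y i))
      + (2 * a * c) * (H i j * (x i * x j)) + (2 * a * d) * (H i j * D i j)
      + (b * b) * (x i * y j * (x i * y j)) + (2 * b * b) * (x i * y j * (x j * y i))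
      + (b * b) * (x j * y i * (x j * y i)) + (2 * b * c) * (x i * y j * (x i * x j))
      + (2 * b * c) * (x j * y i * (x i * x j)) + (2 * b * d) * (x i * y j * D i j) + (2 * b * d) * (x j * y i * D i j)
      + (c * c) * (x i * x j * (x i * x j)) + (2 * c * d) * (x i * x j * D i j) + (d * d) * (D i j * D i j)"
      for i j unfolding power2_eq_square by algebra
    then show ?thesis
      by (simp only: sum.distrib sum_distrib_left[symmetric] cHH cH1 cH2 cH3 c1 c2 c3 c4 c5 c6 d0 d1 d2 d3 d4)
  qed
  \<comment> \<open>The squared matrix is the trace-free part
    \<open>P H P - (t / (R * (N - 1))) P\<close>, multiplied by \<open>(N - 1) * R^2\<close> to
    clear the denominators.\<close>
  have "0 \<le> (\<Sum>i\<in>S. \<Sum>j\<in>S. (((N - 1) * R\<^sup>2) * H i j + (- (N - 1) * R) * (x i * y j) + (- (N - 1) * R) * (x j * y i)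
     + ((N - 1) * q + t) * (x i * x j) + (- t * R) * D i j)\<^sup>2)"
    by (intro sum_nonneg) simp
  also have "\<dots> = R\<^sup>2 * ((N - 1) * ((N - 1) * (R\<^sup>2 * h - 2 * R * Y + q\<^sup>2) - t\<^sup>2))"
    unfolding sq unfolding t_def power2_eq_square by algebra
  finally have "0 \<le> (N - 1) * ((N - 1) * (R\<^sup>2 * h - 2 * R * Y + q\<^sup>2) - t\<^sup>2)"
    using False by (simp add: zero_le_mult_iff)
  moreover have "N - 1 > 0" using N by (simp add: N_def)
  ultimately have "0 \<le> (N - 1) * (R\<^sup>2 * h - 2 * R * Y + q\<^sup>2) - t\<^sup>2"
    by (simp add: zero_le_mult_iff)
  then show ?thesis by (simp add: N_def h_def Y_def t_def)
qed

text \<open>The bracket is the squared norm of the Hessian on the sphere: the gradients of the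
  rotated functions \<open>rot k l f\<close> contain this Hessian and, in addition,
  \<open>N - 2\<close> copies of the gradient of \<open>f\<close>, the Ricci term.
  \<open>sphlap\<close> is the trace of that Hessian in dimension \<open>N - 1\<close>.\<close>

lemma bochner_pointwise:
  fixes f :: "'a::euclidean_space \<Rightarrow> real"
  assumes f: "smooth f" and N: "DIM('a) \<ge> 2"
  shows "(sphlap f x)\<^sup>2 \<le> (real DIM('a) - 1) *
    ((\<Sum>k\<in>Basis. \<Sum>l\<in>Basis. sphgrad2 (rot k l f) x) / 2 - (real DIM('a) - 2) * sphgrad2 f x)"
proof -
  define N where "N = real DIM('a)"
  define p where "p b = pd b f x" for b
  define H where "H b c = pd b (pd c f) x" for b c
  define R where "R = (\<Sum>i\<in>Basis. (x \<bullet> i) * (x \<bullet> i))"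
  define y where "y i = (\<Sum>j\<in>Basis. H i j * (x \<bullet> j))" for i
  define q where "q = (\<Sum>i\<in>Basis. (x \<bullet> i) * y i)"
  define tr where "tr = (\<Sum>i\<in>Basis. H i i)"
  define h where "h = (\<Sum>i\<in>Basis. \<Sum>j\<in>Basis. H i j * H i j)"
  define Y where "Y = (\<Sum>i\<in>Basis. y i * y i)"
  define P where "P = (\<Sum>i\<in>Basis. p i * p i)"
  define e where "e = (\<Sum>i\<in>Basis. (x \<bullet> i) * p i)"
  define py where "py = (\<Sum>i\<in>Basis. p i * y i)"
  have Rn: "(norm x)\<^sup>2 = R" by (simp add: norm2_Basis R_def)
  have sym: "H i j = H j i" if "i \<in> Basis" "j \<in> Basis" for i j
    unfolding H_def by (simp add: pd_commute[OF f that])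
  have ef: "euler f x = e" by (simp add: euler_def e_def p_def)
  have grad2: "(\<Sum>b\<in>Basis. (pd b f x)\<^sup>2) = P" by (simp add: P_def p_def power2_eq_square)
  have G: "sphgrad2 f x = R * P - e\<^sup>2"
    by (simp add: sphgrad2_norm Rn ef grad2)
  have lap: "laplacian f x = tr" by (simp add: laplacian_def tr_def H_def)
  have ee: "euler (euler f) x = e + q"
  proof -
    have "(\<Sum>b\<in>Basis. \<Sum>c\<in>Basis. (x \<bullet> b) * (x \<bullet> c) * pd c (pd b f) x) =
        (\<Sum>b\<in>Basis. \<Sum>c\<in>Basis. (x \<bullet> b) * (H b c * (x \<bullet> c)))"
      by (intro sum.cong refl) (simp add: sym[unfolded H_def] H_def)
    also have "\<dots> = q"
      by (simp add: q_def y_def sum_distrib_left)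
    finally show ?thesis by (simp add: euler_euler f ef)
  qed
  have L: "sphlap f x = R * tr - q - (N - 1) * e"
    using sphlap_laplacian[OF f, of x] by (simp add: lap ee ef Rn N_def algebra_simps)
  \<comment> \<open>A derivative of \<open>rot k l f\<close> falls either on the coefficients,
    giving the wedge of \<open>m\<close> with the gradient, or on the derivatives, giving the wedge
    of \<open>x\<close> with a row of the Hessian. Both have the shape that \<open>sum_wedge\<close>
    evaluates.\<close>
  define V where "V m k l = ((m \<bullet> k) * p l - (m \<bullet> l) * p k) + ((x \<bullet> k) * H m l - (x \<bullet> l) * H m k)" for m k l
  have pdV: "pd m (rot k l f) x = V m k l" if "m \<in> Basis" "k \<in> Basis" "l \<in> Basis" for m k l
    using that by (simp add: pd_rot f V_def p_def H_def)
  have eV: "euler (rot k l f) x = (x \<bullet> k) * (p l + y l) - (x \<bullet> l) * (p k + y k)"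
    if "k \<in> Basis" "l \<in> Basis" for k l
  proof -
    have "y k = (\<Sum>m\<in>Basis. (x \<bullet> m) * H m k)" "y l = (\<Sum>m\<in>Basis. (x \<bullet> m) * H m l)"
      unfolding y_def using that by (auto intro!: sum.cong simp: sym)
    moreover have "euler (rot k l f) x = (\<Sum>m\<in>Basis. p l * ((x \<bullet> m) * (m \<bullet> k)) - p k * ((x \<bullet> m) * (m \<bullet> l))
       + ((x \<bullet> k) * ((x \<bullet> m) * H m l) - (x \<bullet> l) * ((x \<bullet> m) * H m k)))"
      unfolding euler_def by (rule sum.cong) (simp_all add: pdV that V_def algebra_simps)
    ultimately show ?thesis
      using that by (simp add: sum.distrib sum_subtractf sum_distrib_left[symmetric] sum_inner_Basis)
        (simp add: algebra_simps)
  qed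
  have V2: "(\<Sum>k\<in>Basis. \<Sum>l\<in>Basis. (V m k l)\<^sup>2) =
      2 * ((P - p m * p m) + (R * (\<Sum>j\<in>Basis. H m j * H m j) - y m * y m)
        + 2 * ((x \<bullet> m) * (\<Sum>j\<in>Basis. p j * H m j) - H m m * e))"
    if m: "m \<in> Basis" for m
  proof -
    have mm: "(\<Sum>k\<in>Basis. (m \<bullet> k) * (m \<bullet> k)) = 1" using m by (simp add: sum_inner_Basis)
    have s: "(\<Sum>k\<in>Basis. (m \<bullet> k) * g k) = g m" "(\<Sum>k\<in>Basis. g k * (m \<bullet> k)) = g m" for g
      using m by (simp_all add: sum_inner_Basis)
    have xy: "(\<Sum>k\<in>Basis. (x \<bullet> k) * H m k) = y m" "(\<Sum>k\<in>Basis. H m k * (x \<bullet> k)) = y m"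
      by (simp_all add: y_def mult.commute)
    have ex: "(\<Sum>k\<in>Basis. p k * (x \<bullet> k)) = e" by (simp add: e_def mult.commute)
    have "(\<Sum>k\<in>Basis. \<Sum>l\<in>Basis. (V m k l)\<^sup>2) =
      (\<Sum>k\<in>Basis. \<Sum>l\<in>Basis. ((m \<bullet> k) * p l - (m \<bullet> l) * p k) * ((m \<bullet> k) * p l - (m \<bullet> l) * p k))
      + (\<Sum>k\<in>Basis. \<Sum>l\<in>Basis. ((x \<bullet> k) * H m l - (x \<bullet> l) * H m k) * ((x \<bullet> k) * H m l - (x \<bullet> l) * H m k))
      + 2 * (\<Sum>k\<in>Basis. \<Sum>l\<in>Basis. ((m \<bullet> k) * p l - (m \<bullet> l) * p k) * ((x \<bullet> k) * H m l - (x \<bullet> l) * H m k))"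
      unfolding V_def power2_eq_square
      by (simp only: sum.distrib[symmetric] sum_distrib_left) (intro sum.cong refl, algebra)
    then show ?thesis
      by (simp only: sum_wedge s mm xy ex P_def[symmetric] R_def[symmetric])
         (simp add: s R_def P_def m)
  qed
  have A: "(\<Sum>k\<in>Basis. \<Sum>l\<in>Basis. \<Sum>b\<in>Basis. (pd b (rot k l f) x)\<^sup>2) =
     2 * ((N * P - P) + (R * h - Y) + 2 * (py - tr * e))"
  proof -
    have "(\<Sum>k\<in>Basis. \<Sum>l\<in>Basis. \<Sum>b\<in>Basis. (pd b (rot k l f) x)\<^sup>2) =
       (\<Sum>k\<in>Basis. \<Sum>l\<in>Basis. \<Sum>b\<in>Basis. (V b k l)\<^sup>2)"
      by (intro sum.cong refl) (simp add: pdV)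
    also have "\<dots> = (\<Sum>k\<in>Basis. \<Sum>b\<in>Basis. \<Sum>l\<in>Basis. (V b k l)\<^sup>2)"
      by (rule sum.cong[OF refl]) (rule sum.swap)
    also have "\<dots> = (\<Sum>b\<in>Basis. \<Sum>k\<in>Basis. \<Sum>l\<in>Basis. (V b k l)\<^sup>2)"
      by (rule sum.swap)
    also have "\<dots> = (\<Sum>m\<in>Basis. 2 * ((P - p m * p m) + (R * (\<Sum>j\<in>Basis. H m j * H m j) - y m * y m)
        + 2 * ((x \<bullet> m) * (\<Sum>j\<in>Basis. p j * H m j) - H m m * e)))"
      by (intro sum.cong refl V2)
    also have "\<dots> = 2 * ((N * P - P) + (R * h - Y)
       + 2 * ((\<Sum>m\<in>Basis. (x \<bullet> m) * (\<Sum>j\<in>Basis. p j * H m j)) - tr * e))"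
      by (simp add: sum.distrib sum_subtractf sum_distrib_left[symmetric] sum_distrib_right[symmetric]
         N_def P_def[symmetric] h_def[symmetric] Y_def[symmetric] tr_def[symmetric])
    also have "(\<Sum>m\<in>Basis. (x \<bullet> m) * (\<Sum>j\<in>Basis. p j * H m j)) = py"
      unfolding py_def y_def sum_distrib_left
      by (subst sum.swap) (intro sum.cong refl, simp add: sym)
    finally show ?thesis .
  qed
  have B: "(\<Sum>k\<in>Basis. \<Sum>l\<in>Basis. (euler (rot k l f) x)\<^sup>2) = 2 * (R * (P + 2 * py + Y) - (e + q)\<^sup>2)"
  proof -
    have 1: "(\<Sum>k\<in>Basis. (x \<bullet> k) * (p k + y k)) = e + q" "(\<Sum>k\<in>Basis. (p k + y k) * (x \<bullet> k)) = e + q"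
      by (simp_all add: e_def q_def algebra_simps sum.distrib)
    have 2: "(\<Sum>k\<in>Basis. (p k + y k) * (p k + y k)) = P + 2 * py + Y"
      by (simp add: P_def py_def Y_def algebra_simps sum.distrib sum_distrib_left)
    have "(\<Sum>k\<in>Basis. \<Sum>l\<in>Basis. (euler (rot k l f) x)\<^sup>2) =
      (\<Sum>k\<in>Basis. \<Sum>l\<in>Basis. ((x \<bullet> k) * (p l + y l) - (x \<bullet> l) * (p k + y k)) * ((x \<bullet> k) * (p l + y l) - (x \<bullet> l) * (p k + y k)))"
      by (intro sum.cong refl) (simp only: eV power2_eq_square)
    also have "\<dots> = 2 * (R * (P + 2 * py + Y) - (e + q) * (e + q))"
      by (simp only: sum_wedge 1 2 R_def)
    finally show ?thesis by (simp add: power2_eq_square)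
  qed
  have T: "(\<Sum>k\<in>Basis. \<Sum>l\<in>Basis. sphgrad2 (rot k l f) x) =
      R * (2 * ((N * P - P) + (R * h - Y) + 2 * (py - tr * e))) - 2 * (R * (P + 2 * py + Y) - (e + q)\<^sup>2)"
    by (simp only: sphgrad2_norm Rn sum_subtractf sum_distrib_left[symmetric] A B)
  have K: "(R * tr - q)\<^sup>2 \<le> (N - 1) * (R\<^sup>2 * h - 2 * R * Y + q\<^sup>2)"
    using trace_square_ineq[of "Basis :: 'a set" H "\<lambda>i. x \<bullet> i"] N sym
    by (simp add: N_def R_def y_def[abs_def] q_def tr_def h_def Y_def)
  \<comment> \<open>The spherical Hessian is the tangential part of \<open>R * H\<close> minus
    \<open>e\<close> times the projection, with trace \<open>R * tr - q - (N - 1) * e\<close>. Such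
    a shift does not change \<open>(N - 1) * norm^2 - trace^2\<close>, so the inequality
    \<open>K\<close> for the unshifted matrix is enough.\<close>
  have "(N - 1) * ((\<Sum>k\<in>Basis. \<Sum>l\<in>Basis. sphgrad2 (rot k l f) x) / 2 - (N - 2) * sphgrad2 f x) - (sphlap f x)\<^sup>2
     = (N - 1) * (R\<^sup>2 * h - 2 * R * Y + q\<^sup>2) - (R * tr - q)\<^sup>2"
    unfolding T G L by (simp add: power2_eq_square field_simps)
  then show ?thesis using K by (simp add: N_def)
qed

subsection \<open>Test functions and singular weights\<close>

text \<open>The exponent varies in the induction because each derivative lowers it by one.\<close>

lemma Ck_powr:
  fixes f :: "'a::euclidean_space \<Rightarrow> real"
  assumes "\<And>x. f x > 0"
  shows "Ck k f \<Longrightarrow> Ck k (\<lambda>x. f x powr a)"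
proof (induction k arbitrary: a)
  case 0
  then show ?case using assms by (auto intro!: continuous_intros simp: less_imp_neq[symmetric])
next
  case (Suc k)
  have d: "((\<lambda>x. f x powr a) has_derivative (\<lambda>h. a * f x powr (a - 1) * (\<Sum>b\<in>Basis. (h \<bullet> b) * pd b f x))) (at x)" for x
  proof -
    have "((\<lambda>y. y powr a) has_derivative (\<lambda>h. a * f x powr (a - 1) * h)) (at (f x))"
      using has_real_derivative_powr[of "f x" a] assms[of x] by (simp add: has_field_derivative_def)
    from has_derivative_compose[OF has_derivative_frechet[OF Ck_differentiable[OF Suc.prems]] this]
    show ?thesis .
  qed
  have "pd b (\<lambda>x. f x powr a) = (\<lambda>x. a * f x powr (a - 1) * pd b f x)" if "b \<in> Basis" for b
  proof
    fix x
    have "pd b (\<lambda>x. f x powr a) x = a * f x powr (a - 1) * (\<Sum>c\<in>Basis. (b \<bullet> c) * pd c f x)"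
      by (rule pd_has_derivative[OF d])
    then show "pd b (\<lambda>x. f x powr a) x = a * f x powr (a - 1) * pd b f x"
      by (simp add: sum_inner_Basis that)
  qed
  moreover have "(\<lambda>x. f x powr a) differentiable_on UNIV"
    using d by (auto simp: differentiable_on_def differentiable_def)
  moreover have "Ck k f" using Suc.prems Ck_Suc_imp by blast
  ultimately show ?case using Suc by (auto intro!: Ck_mult)
qed

lemma smooth_powr: "(\<And>x. f x > 0) \<Longrightarrow> smooth f \<Longrightarrow> smooth (\<lambda>x. f x powr a)"
  by (auto simp: smooth_def intro: Ck_powr)

lemma smooth_pd_powr:
  fixes f :: "'a::euclidean_space \<Rightarrow> real"
  assumes pos: "\<And>x. f x > 0" and f: "smooth f" and b: "b \<in> Basis"
  shows "pd b (\<lambda>x. f x powr a) = (\<lambda>x. a * f x powr (a - 1) * pd b f x)"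
proof
  fix x
  have "((\<lambda>y. y powr a) has_derivative (\<lambda>h. a * f x powr (a - 1) * h)) (at (f x))"
    using has_real_derivative_powr[of "f x" a] pos[of x] by (simp add: has_field_derivative_def)
  from pd_has_derivative[OF has_derivative_compose[OF has_derivative_frechet[OF smooth_differentiable[OF f]] this]]
  show "pd b (\<lambda>x. f x powr a) x = a * f x powr (a - 1) * pd b f x"
    by (simp add: sum_inner_Basis b)
qed

section \<open>A smooth cutoff\<close>

text \<open>\<open>flat 0\<close> is the classical \<open>exp (- 1 / t)\<close>. The powers of
  \<open>1 / t\<close> are carried along because the linear span of the family is closed under
  differentiation, which makes smoothness an induction over all \<open>n\<close> at once.\<close>

definition flat :: "nat \<Rightarrow> real \<Rightarrow> real" where
  "flat n t = (if t > 0 then (1 / t) ^ n * exp (- (1 / t)) else 0)"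

lemma flat_right_limit: "(flat n \<longlongrightarrow> 0) (at_right 0)"
proof -
  have "((\<lambda>y. y ^ n / exp y) \<longlongrightarrow> (0::real)) at_top"
    by (rule tendsto_power_div_exp_0)
  then have "((\<lambda>t. inverse t ^ n / exp (inverse t)) \<longlongrightarrow> (0::real)) (at_right 0)"
    by (rule filterlim_compose[OF _ filterlim_inverse_at_top_right])
  then show ?thesis
    by (rule Lim_transform_eventually)
      (auto simp: flat_def exp_minus field_simps eventually_at_filter)
qed

lemma flat_limit: "(flat n \<longlongrightarrow> 0) (at 0)"
proof -
  have "(flat n \<longlongrightarrow> 0) (at_left 0)"
    by (rule Lim_transform_eventually[OF tendsto_const])
       (auto simp: flat_def eventually_at_filter)
  then show ?thesis using flat_right_limit filterlim_split_at_real by blast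
qed

lemma flat_deriv: "(flat n has_real_derivative flat (n + 2) t - real n * flat (n + 1) t) (at t)"
proof (cases "t = 0")
  case True
  \<comment> \<open>At the origin the difference quotient of \<open>flat n\<close> is
    \<open>flat (n + 1)\<close> itself, which tends to 0.\<close>
  have "(\<lambda>h. (flat n (0 + h) - flat n 0) / h) = flat (n + 1)"
    by (rule ext) (auto simp: flat_def)
  then have "(flat n has_real_derivative 0) (at 0)"
    unfolding DERIV_def using flat_limit[of "n + 1"] by simp
  then show ?thesis using True by (simp add: flat_def)
next
  case False
  show ?thesis
  proof (cases "t > 0")
    case True
    have 1: "((\<lambda>t. 1 / t) has_real_derivative - ((1 / t) ^ 2)) (at t)"
      using True by (auto intro!: derivative_eq_intros simp: power2_eq_square)
    have 2: "((\<lambda>t. exp (- (1 / t))) has_real_derivative exp (- (1 / t)) * (1 / t) ^ 2) (at t)"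
      using DERIV_fun_exp[OF DERIV_minus[OF 1]] by simp
    have "real n * (- ((1 / t) ^ 2) * (1 / t) ^ (n - Suc 0)) = - real n * (1 / t) ^ (n + 1)"
      by (cases n) (simp_all add: power2_eq_square algebra_simps diff_divide_distrib add_divide_distrib)
    then have "((\<lambda>t. (1 / t) ^ n * exp (- (1 / t))) has_real_derivative
       flat (n + 2) t - real n * flat (n + 1) t) (at t)"
      using DERIV_mult[OF DERIV_power[OF 1, of n] 2] True
      by (simp add: flat_def power_add power2_eq_square algebra_simps)
    then show ?thesis
      by (rule has_field_derivative_transform_within_open[of _ _ _ "{0<..}"]) (use True in \<open>auto simp: flat_def\<close>)
  next
    case neg: False
    have "((\<lambda>t. 0::real) has_real_derivative 0) (at t)" by simp
    then have "(flat n has_real_derivative 0) (at t)"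
      by (rule has_field_derivative_transform_within_open[of _ _ _ "{..<0}"])
        (use neg False in \<open>auto simp: flat_def\<close>)
    then show ?thesis using neg False by (simp add: flat_def)
  qed
qed

lemma pd_real: "(F has_real_derivative D) (at t) \<Longrightarrow> pd 1 F t = D"
  using pd_has_derivative[of F "\<lambda>h. D * h" t 1] by (simp add: has_field_derivative_def)

lemma smooth_flat: "smooth (flat n)"
proof -
  have "Ck k (flat n)" for k
  proof (induction k arbitrary: n)
    case 0
    show ?case by (simp add: continuous_at_imp_continuous_on DERIV_isCont[OF flat_deriv])
  next
    case (Suc k)
    have "pd 1 (flat n) = (\<lambda>t. flat (n + 2) t + (- real n) * flat (n + 1) t)"
      by (rule ext) (subst pd_real[OF flat_deriv], simp)
    moreover have "Ck k (\<lambda>t. flat (n + 2) t + (- real n) * flat (n + 1) t)"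
      by (intro Ck_add Ck_mult Ck_const Suc)
    ultimately show ?case
      using differentiableI[OF flat_deriv[unfolded has_field_derivative_def]] by (auto simp: differentiable_on_def)
  qed
  then show ?thesis by (simp add: smooth_def)
qed

lemma flat_pos: "t > 0 \<Longrightarrow> flat 0 t > 0" and flat_zero: "t \<le> 0 \<Longrightarrow> flat 0 t = 0" and flat_nonneg: "flat 0 t \<ge> 0"
  by (auto simp: flat_def)

text \<open>Applied to \<open>|x|^2\<close>, the thresholds 1 and 4 become the radii 1 and 2. The
  quotient is written with \<open>powr (-1)\<close> so that smoothness of powers of positive
  functions applies.\<close>

definition cut :: "real \<Rightarrow> real" where
  "cut t = flat 0 (4 - t) * (flat 0 (4 - t) + flat 0 (t - 1)) powr (-1)"

lemma cut_den: "flat 0 (4 - t) + flat 0 (t - 1) > 0"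
  using flat_pos[of "4 - t"] flat_pos[of "t - 1"] flat_nonneg[of "4 - t"] flat_nonneg[of "t - 1"]
  by (cases "t < 4") auto

lemma smooth_shift: "smooth F \<Longrightarrow> smooth (\<lambda>t::real. F (a * t + b))"
proof -
  assume F: "smooth F"
  have "smooth (\<lambda>t::real. a * (t \<bullet> 1) + b)" by (intro smooth_intros)
  then have "smooth (\<lambda>t. a * t + b)" by simp
  then show "smooth (\<lambda>t. F (a * t + b))" by (rule smooth_compose[OF F])
qed

lemma smooth_cut: "smooth cut"
proof -
  have "smooth (\<lambda>t. flat 0 (4 - t))" "smooth (\<lambda>t. flat 0 (t - 1))"
    using smooth_shift[OF smooth_flat[of 0], of "-1" 4] smooth_shift[OF smooth_flat[of 0], of 1 "-1"]
    by simp_all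
  then show ?thesis
    unfolding cut_def[abs_def] by (intro smooth_mult smooth_powr smooth_add cut_den)
qed

lemma cut_one: "t \<le> 1 \<Longrightarrow> cut t = 1" and cut_zero: "t \<ge> 4 \<Longrightarrow> cut t = 0" and cut_nonneg: "cut t \<ge> 0"
  and cut_le: "cut t \<le> 1"
  using cut_den[of t] flat_pos[of "4 - t"] flat_nonneg[of "t - 1"] flat_nonneg[of "4 - t"]
  by (auto simp: cut_def flat_zero powr_minus divide_simps)

definition tf :: "('a::euclidean_space \<Rightarrow> real) \<Rightarrow> bool" where
  "tf f \<longleftrightarrow> smooth f \<and> (\<exists>R. \<forall>x. f x \<noteq> 0 \<longrightarrow> norm x \<le> R)"

text \<open>Heine-Borel: the closure of the support is compact exactly when the support is
  bounded.\<close>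

lemma test_function_tf: "test_function f \<longleftrightarrow> tf f"
proof -
  have "bounded {x. f x \<noteq> 0} \<longleftrightarrow> (\<exists>R. \<forall>x. f x \<noteq> 0 \<longrightarrow> norm x \<le> R)"
    by (auto simp: bounded_iff)
  then show ?thesis by (simp add: test_function_def tf_def smooth_def)
qed

lemma tf_smooth: "tf f \<Longrightarrow> smooth f" by (simp add: tf_def)

lemma tf_bound: "tf f \<Longrightarrow> \<exists>R>0. \<forall>x. norm x \<ge> R \<longrightarrow> f x = 0"
proof -
  assume "tf f"
  then obtain R where "\<And>x. f x \<noteq> 0 \<Longrightarrow> norm x \<le> R" unfolding tf_def by blast
  then show ?thesis by (intro exI[of _ "\<bar>R\<bar> + 1"]) force
qed

lemma tf_mult: "tf f \<Longrightarrow> smooth g \<Longrightarrow> tf (\<lambda>x. f x * g x)"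
  and tf_mult': "tf f \<Longrightarrow> smooth g \<Longrightarrow> tf (\<lambda>x. g x * f x)"
  unfolding tf_def by (auto intro!: smooth_intros) 

lemma tf_add: "tf f \<Longrightarrow> tf g \<Longrightarrow> tf (\<lambda>x. f x + g x)"
proof -
  assume f: "tf f" and g: "tf g"
  then obtain R S where R: "\<And>x. f x \<noteq> 0 \<Longrightarrow> norm x \<le> R" and S: "\<And>x. g x \<noteq> 0 \<Longrightarrow> norm x \<le> S"
    unfolding tf_def by blast
  have "\<forall>x. f x + g x \<noteq> 0 \<longrightarrow> norm x \<le> max R S"
    by (metis R S add_0 le_max_iff_disj)
  moreover have "smooth (\<lambda>x. f x + g x)" using f g by (auto simp: tf_def intro: smooth_add)
  ultimately show "tf (\<lambda>x. f x + g x)" unfolding tf_def by blast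
qed

lemma tf_cmult: "tf f \<Longrightarrow> tf (\<lambda>x. c * f x)"
  by (rule tf_mult') (auto intro: smooth_intros)

lemma tf_diff: "tf f \<Longrightarrow> tf g \<Longrightarrow> tf (\<lambda>x. f x - g x)"
  using tf_add[of f "\<lambda>x. (-1) * g x"] tf_cmult[of g "-1"] by simp

lemma tf_zero: "tf (\<lambda>x. 0)" by (simp add: tf_def smooth_intros)

lemma tf_sum: "(\<And>i. i \<in> A \<Longrightarrow> tf (f i)) \<Longrightarrow> tf (\<lambda>x. \<Sum>i\<in>A. f i x)"
  by (induction A rule: infinite_finite_induct) (auto intro!: tf_add tf_zero)

lemma pd_eq_open:
  assumes "open U" "x \<in> U" "\<And>y. y \<in> U \<Longrightarrow> f y = g y" "smooth f"
  shows "pd b f x = pd b g x"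
proof -
  have "(f has_derivative (\<lambda>h. \<Sum>c\<in>Basis. (h \<bullet> c) * pd c f x)) (at x)" (is "(f has_derivative ?D) _")
    by (rule has_derivative_frechet[OF smooth_differentiable[OF assms(4)]])
  moreover from this have "(g has_derivative ?D) (at x)"
    by (rule has_derivative_transform_within_open[of _ _ _ _ U]) (use assms in auto)
  ultimately show ?thesis
    using pd_has_derivative[of f ?D x b] pd_has_derivative[of g ?D x b] by simp
qed

lemma tf_pd: "tf f \<Longrightarrow> b \<in> Basis \<Longrightarrow> tf (pd b f)"
proof -
  assume f: "tf f" and b: "b \<in> Basis"
  then obtain R where R: "\<And>x. f x \<noteq> 0 \<Longrightarrow> norm x \<le> R" unfolding tf_def by blast
  have "pd b f x = 0" if "norm x > R" for x
  proof -
    have "pd b f x = pd b (\<lambda>x. 0) x"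
    proof (rule pd_eq_open[of "{x. norm x > R}"])
      show "open {x::'a. norm x > R}"
        by (intro open_Collect_less continuous_intros)
    qed (use that R tf_smooth[OF f] in force)+
    then show ?thesis by simp
  qed
  then have "\<forall>x. pd b f x \<noteq> 0 \<longrightarrow> norm x \<le> R" using not_le by blast
  then show "tf (pd b f)" using f b unfolding tf_def by (auto intro!: smooth_intros)
qed

lemma tf_euler: "tf f \<Longrightarrow> tf (euler f)"
  unfolding euler_def[abs_def] by (intro tf_sum tf_mult' tf_pd smooth_intros)

lemma tf_rot: "tf f \<Longrightarrow> b \<in> Basis \<Longrightarrow> c \<in> Basis \<Longrightarrow> tf (rot b c f)"
  unfolding rot_def[abs_def] by (intro tf_diff tf_mult' tf_pd smooth_intros)

lemma tf_laplacian: "tf f \<Longrightarrow> tf (laplacian f)"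
  unfolding laplacian_def[abs_def] by (intro tf_sum tf_pd)

lemma tf_sphlap: "tf f \<Longrightarrow> tf (sphlap f)"
  unfolding sphlap_def[abs_def] divide_inverse by (intro tf_sum tf_mult tf_rot smooth_intros)

lemma tf_cut: "a > 0 \<Longrightarrow> tf (\<lambda>x. cut (a * (norm x)\<^sup>2))"
proof -
  assume a: "a > 0"
  have "norm x \<le> 4 / a + 1" if "cut (a * (norm x)\<^sup>2) \<noteq> 0" for x :: 'a
  proof -
    have "a * (norm x)\<^sup>2 < 4" using that cut_zero by (meson linorder_not_le)
    then have "(norm x)\<^sup>2 < 4 / a" using a by (simp add: field_simps)
    moreover have "norm x \<le> (norm x)\<^sup>2 + 1"
      using zero_le_power2[of "norm x - 1/2"] by (simp add: power2_eq_square algebra_simps)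
    ultimately show ?thesis by linarith
  qed
  moreover have "smooth (\<lambda>x::'a. cut (a * (norm x)\<^sup>2))"
    by (rule smooth_compose[OF smooth_cut]) (intro smooth_intros)
  ultimately show ?thesis unfolding tf_def by blast
qed

lemma tf_bounded:
  assumes "tf f"
  obtains C R where "C \<ge> 0" "R > 0" "\<And>x. \<bar>f x\<bar> \<le> C * indicator (cball 0 R) x"
proof -
  obtain R where R: "R > 0" "\<And>x. norm x \<ge> R \<Longrightarrow> f x = 0" using tf_bound[OF assms] by blast
  have "compact (f ` cball 0 R)"
    by (intro compact_continuous_image smooth_continuous tf_smooth assms) auto
  then obtain C where C: "\<And>x. x \<in> cball 0 R \<Longrightarrow> \<bar>f x\<bar> \<le> C"
    using compact_imp_bounded by (fastforce simp: bounded_iff)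
  have "\<bar>f 0\<bar> \<le> C" using C[of 0] R(1) by simp
  then have "C \<ge> 0" using abs_ge_zero[of "f 0"] by linarith
  moreover have "\<bar>f x\<bar> \<le> C * indicator (cball 0 R) x" for x
    using C[of x] R(2)[of x] by (auto simp: indicator_def)
  ultimately show ?thesis using that R(1) by blast
qed

lemma tf_measurable [measurable]: "tf f \<Longrightarrow> f \<in> borel_measurable borel"
  by (intro borel_measurable_continuous_onI smooth_continuous tf_smooth)

lemma smooth_measurable: "smooth f \<Longrightarrow> f \<in> borel_measurable borel"
  by (intro borel_measurable_continuous_onI smooth_continuous)

section \<open>Integrals of derivatives of test functions\<close>

lemma integrable_cball: "integrable lborel (\<lambda>x::'a::euclidean_space. C * indicator (cball 0 R) x :: real)"
  by (intro integrable_mult_right integrable_real_indicator) (use emeasure_lborel_cball_finite[of 0 R] in simp_all)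

lemma tf_integrable:
  assumes "tf f" shows "integrable lborel f"
proof -
  obtain C R where "\<And>x. \<bar>f x\<bar> \<le> C * indicator (cball 0 R) x" using tf_bounded[OF assms] by metis
  then show ?thesis
    by (intro Bochner_Integration.integrable_bound[OF integrable_cball[of C R]])
       (use assms in \<open>auto intro!: always_eventually order_trans[OF _ abs_ge_self]\<close>)
qed

lemma lborel_integral_translate:
  fixes f :: "'a::euclidean_space \<Rightarrow> real"
  assumes "f \<in> borel_measurable borel"
  shows "(\<integral>x. f (x + a) \<partial>lborel) = (\<integral>x. f x \<partial>lborel)"
proof -
  have "(\<integral>x. f x \<partial>lborel) = (\<integral>x. f x \<partial>distr lborel borel ((+) a))"
    by (simp add: lborel_distr_plus)
  also have "\<dots> = (\<integral>x. f (a + x) \<partial>lborel)"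
    using assms by (subst integral_distr) auto
  finally show ?thesis by (simp add: add.commute)
qed

text \<open>By translation invariance of Lebesgue measure every difference quotient has integral 0;
  dominated convergence carries this over to the derivative.\<close>

lemma integral_pd:
  assumes f: "tf f" and b: "b \<in> Basis"
  shows "(\<integral>x. pd b f x \<partial>lborel) = 0"
proof -
  let ?t = "\<lambda>n::nat. 1 / real (Suc n)"
  obtain C R where C: "C \<ge> 0" "R > 0" "\<And>x. \<bar>pd b f x\<bar> \<le> C * indicator (cball 0 R) x"
    using tf_bounded[OF tf_pd[OF f b]] by metis
  define q where "q n x = (f (x + ?t n *\<^sub>R b) - f x) / ?t n" for n x
  have t0: "?t \<longlonglongrightarrow> 0" by (rule LIMSEQ_Suc[OF lim_inverse_n'[unfolded inverse_eq_divide]])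
  have lim: "(\<lambda>n. q n x) \<longlonglongrightarrow> pd b f x" for x
  proof -
    have "((\<lambda>t. f (x + t *\<^sub>R b)) has_real_derivative pd b f x) (at 0)"
      using smooth_line_deriv[OF tf_smooth[OF f] b, of x 0] by simp
    then have "((\<lambda>h. (f (x + h *\<^sub>R b) - f x) / h) \<longlongrightarrow> pd b f x) (at 0)"
      by (simp add: DERIV_def)
    moreover have "filterlim ?t (at 0) sequentially"
      using t0 by (auto simp: filterlim_at)
    ultimately show ?thesis unfolding q_def by (rule filterlim_compose)
  qed
  \<comment> \<open>The mean value theorem bounds the quotient by a value of the derivative at
    distance at most 1, so the ball supporting the bound grows by 1.\<close>
  have bd: "\<bar>q n x\<bar> \<le> C * indicator (cball 0 (R + 1)) x" for n x
  proof -
    have tp: "?t n > 0" "?t n \<le> 1" by auto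
    obtain \<xi> where \<xi>: "0 < \<xi>" "\<xi> < ?t n" "f (x + ?t n *\<^sub>R b) - f (x + 0 *\<^sub>R b) = (?t n - 0) * pd b f (x + \<xi> *\<^sub>R b)"
      using MVT2[OF tp(1) smooth_line_deriv[OF tf_smooth[OF f] b]] by blast
    then have "q n x = pd b f (x + \<xi> *\<^sub>R b)" using tp(1) by (simp add: q_def)
    moreover have "indicator (cball 0 R) (x + \<xi> *\<^sub>R b) \<le> (indicator (cball 0 (R + 1)) x :: real)"
    proof -
      have "norm x \<le> norm (x + \<xi> *\<^sub>R b) + norm (\<xi> *\<^sub>R b)"
        by (metis add_diff_cancel_right' norm_triangle_ineq4)
      also have "norm (\<xi> *\<^sub>R b) \<le> 1"
        using \<xi>(1) less_le_trans[OF \<xi>(2) tp(2)] b by simp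
      finally show ?thesis by (auto simp: indicator_def)
    qed
    ultimately show ?thesis using C(3)[of "x + \<xi> *\<^sub>R b"] mult_left_mono[OF _ C(1)] by fastforce
  qed
  have fm: "f \<in> borel_measurable borel" using f by simp
  have "integrable lborel (\<lambda>x. f (x + a))" for a
  proof -
    have "integrable (distr lborel borel ((+) a)) f"
      using tf_integrable[OF f] by (simp add: lborel_distr_plus)
    then have "integrable lborel (\<lambda>x. f (a + x))"
      using fm by (subst (asm) integrable_distr_eq) auto
    then show ?thesis by (simp add: add.commute)
  qed
  then have "(\<integral>x. q n x \<partial>lborel) = 0" for n
    unfolding q_def using tf_integrable[OF f] by (simp add: lborel_integral_translate[OF fm])
  moreover have "(\<lambda>n. \<integral>x. q n x \<partial>lborel) \<longlonglongrightarrow> (\<integral>x. pd b f x \<partial>lborel)"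
  proof (rule integral_dominated_convergence[OF _ _ integrable_cball[of C "R + 1"]])
    show "pd b f \<in> borel_measurable lborel" using tf_pd[OF f b] by simp
    show "q n \<in> borel_measurable lborel" for n unfolding q_def using fm by simp
  qed (use lim bd in auto)
  ultimately show ?thesis by (simp add: LIMSEQ_const_iff)
qed

section \<open>Regularised weights and integrability of powers of the norm\<close>

text \<open>A smooth substitute for \<open>|x|^-s\<close>: for positive \<open>\<epsilon>\<close>
  the product with a test function is again a test function, even if the origin lies in its
  support.\<close>

definition wreg :: "real \<Rightarrow> real \<Rightarrow> 'a::euclidean_space \<Rightarrow> real" where
  "wreg s \<epsilon> x = ((norm x)\<^sup>2 + \<epsilon>) powr (- (s / 2))"

lemma norm2_add_pos: "\<epsilon> > 0 \<Longrightarrow> (norm x)\<^sup>2 + \<epsilon> > 0"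
  by (simp add: add_nonneg_pos)

lemma smooth_wreg: "\<epsilon> > 0 \<Longrightarrow> smooth (wreg s \<epsilon>)"
  unfolding wreg_def[abs_def]
  by (rule smooth_powr[OF norm2_add_pos]) (auto intro!: smooth_add smooth_norm2 smooth_const)

lemma pd_wreg:
  assumes "\<epsilon> > 0" "b \<in> Basis"
  shows "pd b (wreg s \<epsilon>) = (\<lambda>x. - s * (x \<bullet> b) * wreg s \<epsilon> x / ((norm x)\<^sup>2 + \<epsilon>))"
proof
  fix x :: 'a
  have "pd b (\<lambda>x. (norm x)\<^sup>2 + \<epsilon>) = (\<lambda>x. 2 * (x \<bullet> b))"
    using assms by (simp add: smooth_pd_add smooth_intros pd_norm2)
  moreover have "pd b (wreg s \<epsilon>) x =
      - (s / 2) * ((norm x)\<^sup>2 + \<epsilon>) powr (- (s / 2) - 1) * pd b (\<lambda>x. (norm x)\<^sup>2 + \<epsilon>) x"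
    unfolding wreg_def[abs_def]
    by (subst smooth_pd_powr[OF norm2_add_pos[OF assms(1)] _ assms(2)])
       (auto intro!: smooth_add smooth_norm2 smooth_const)
  moreover have "((norm x)\<^sup>2 + \<epsilon>) powr (- (s / 2) - 1) = wreg s \<epsilon> x / ((norm x)\<^sup>2 + \<epsilon>)"
    using norm2_add_pos[OF assms(1), of x] by (simp add: powr_diff wreg_def)
  ultimately show "pd b (wreg s \<epsilon>) x = - s * (x \<bullet> b) * wreg s \<epsilon> x / ((norm x)\<^sup>2 + \<epsilon>)"
    using norm2_add_pos[OF assms(1), of x] by (simp only:) (simp add: divide_simps)
qed

text \<open>The divergence of \<open>x * wreg s \<epsilon> x * f x\<close> has integral 0. The field
  contributes \<open>N\<close>, and the derivative of the weight contributes \<open>- s\<close>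
  damped by a factor that tends to 1 off the origin as \<open>\<epsilon>\<close> tends to 0.\<close>

lemma wreg_integral_euler:
  fixes f :: "'a::euclidean_space \<Rightarrow> real"
  assumes f: "tf f" and e: "\<epsilon> > 0"
  shows "(\<integral>x. wreg s \<epsilon> x * euler f x \<partial>lborel) =
    - (\<integral>x. (real DIM('a) - s * ((norm x)\<^sup>2 / ((norm x)\<^sup>2 + \<epsilon>))) * (wreg s \<epsilon> x * f x) \<partial>lborel)"
proof -
  have sw: "smooth (wreg s \<epsilon> :: 'a \<Rightarrow> real)" by (rule smooth_wreg[OF e])
  have sf: "smooth f" by (rule tf_smooth[OF f])
  have t: "tf (\<lambda>x. (x \<bullet> b) * (wreg s \<epsilon> x * f x))" for b
    by (intro tf_mult' f sw smooth_intros)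
  have "0 = (\<Sum>b\<in>Basis. \<integral>x. pd b (\<lambda>x. (x \<bullet> b) * (wreg s \<epsilon> x * f x)) x \<partial>lborel)"
    by (simp add: integral_pd[OF t])
  also have "\<dots> = (\<integral>x. (\<Sum>b\<in>Basis. pd b (\<lambda>x. (x \<bullet> b) * (wreg s \<epsilon> x * f x)) x) \<partial>lborel)"
    by (rule Bochner_Integration.integral_sum[symmetric]) (intro tf_integrable tf_pd t)
  also have "(\<lambda>x. \<Sum>b\<in>Basis. pd b (\<lambda>x. (x \<bullet> b) * (wreg s \<epsilon> x * f x)) x) =
     (\<lambda>x. wreg s \<epsilon> x * euler f x + (real DIM('a) - s * ((norm x)\<^sup>2 / ((norm x)\<^sup>2 + \<epsilon>))) * (wreg s \<epsilon> x * f x))"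
  proof
    fix x :: 'a
    let ?c = "- s * wreg s \<epsilon> x * f x / ((norm x)\<^sup>2 + \<epsilon>)"
    have "(\<Sum>b\<in>Basis. pd b (\<lambda>x. (x \<bullet> b) * (wreg s \<epsilon> x * f x)) x) =
      (\<Sum>b\<in>Basis. wreg s \<epsilon> x * ((x \<bullet> b) * pd b f x) + ?c * ((x \<bullet> b) * (x \<bullet> b)) + wreg s \<epsilon> x * f x)"
    proof (intro sum.cong refl)
      fix b :: 'a assume b: "b \<in> Basis"
      have "pd b (\<lambda>x. (x \<bullet> b) * (wreg s \<epsilon> x * f x)) x =
        (x \<bullet> b) * (wreg s \<epsilon> x * pd b f x + pd b (wreg s \<epsilon>) x * f x) + wreg s \<epsilon> x * f x"
        using b by (simp add: smooth_pd_mult sw sf smooth_intros inner_Basis)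
      then show "pd b (\<lambda>x. (x \<bullet> b) * (wreg s \<epsilon> x * f x)) x =
        wreg s \<epsilon> x * ((x \<bullet> b) * pd b f x) + ?c * ((x \<bullet> b) * (x \<bullet> b)) + wreg s \<epsilon> x * f x"
        by (simp add: pd_wreg[OF e b] algebra_simps)
    qed
    also have "\<dots> = wreg s \<epsilon> x * euler f x + ?c * (norm x)\<^sup>2 + real DIM('a) * (wreg s \<epsilon> x * f x)"
      by (simp only: sum.distrib sum_distrib_left[symmetric] euler_def norm2_Basis[symmetric] sum_constant) simp
    finally show "(\<Sum>b\<in>Basis. pd b (\<lambda>x. (x \<bullet> b) * (wreg s \<epsilon> x * f x)) x) =
       wreg s \<epsilon> x * euler f x + (real DIM('a) - s * ((norm x)\<^sup>2 / ((norm x)\<^sup>2 + \<epsilon>))) * (wreg s \<epsilon> x * f x)"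
      by (simp add: algebra_simps)
  qed
  also have "(\<integral>x. wreg s \<epsilon> x * euler f x + (real DIM('a) - s * ((norm x)\<^sup>2 / ((norm x)\<^sup>2 + \<epsilon>))) * (wreg s \<epsilon> x * f x) \<partial>lborel)
    = (\<integral>x. wreg s \<epsilon> x * euler f x \<partial>lborel) +
      (\<integral>x. (real DIM('a) - s * ((norm x)\<^sup>2 / ((norm x)\<^sup>2 + \<epsilon>))) * (wreg s \<epsilon> x * f x) \<partial>lborel)"
  proof (rule Bochner_Integration.integral_add)
    show "integrable lborel (\<lambda>x. wreg s \<epsilon> x * euler f x)"
      by (intro tf_integrable tf_mult' tf_euler f sw)
    have "smooth (\<lambda>x::'a. ((norm x)\<^sup>2 + \<epsilon>) powr (-1))"
      by (rule smooth_powr[OF norm2_add_pos[OF e]]) (auto intro!: smooth_add smooth_norm2 smooth_const)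
    then have "smooth (\<lambda>x::'a. real DIM('a) - s * ((norm x)\<^sup>2 * ((norm x)\<^sup>2 + \<epsilon>) powr (-1)))"
      by (intro smooth_intros)
    moreover have "(\<lambda>x::'a. ((norm x)\<^sup>2 + \<epsilon>) powr (-1)) = (\<lambda>x. inverse ((norm x)\<^sup>2 + \<epsilon>))"
      by (rule ext) (simp add: powr_minus abs_of_pos[OF norm2_add_pos[OF e]])
    ultimately have "smooth (\<lambda>x::'a. real DIM('a) - s * ((norm x)\<^sup>2 / ((norm x)\<^sup>2 + \<epsilon>)))"
      by (simp add: divide_inverse fun_eq_iff)
    then show "integrable lborel (\<lambda>x. (real DIM('a) - s * ((norm x)\<^sup>2 / ((norm x)\<^sup>2 + \<epsilon>))) * (wreg s \<epsilon> x * f x))"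
      by (intro tf_integrable tf_mult' f sw)
  qed
  finally show ?thesis by simp
qed

text \<open>The weight is radial, hence killed by \<open>rot b c\<close>, and rotation fields are
  divergence free.\<close>

lemma wreg_integral_rot:
  fixes f :: "'a::euclidean_space \<Rightarrow> real"
  assumes f: "tf f" and e: "\<epsilon> > 0" and b: "b \<in> Basis" and c: "c \<in> Basis"
  shows "(\<integral>x. wreg s \<epsilon> x * rot b c f x \<partial>lborel) = 0"
proof -
  have sw: "smooth (wreg s \<epsilon> :: 'a \<Rightarrow> real)" by (rule smooth_wreg[OF e])
  have sf: "smooth f" by (rule tf_smooth[OF f])
  have t: "tf (\<lambda>x. (x \<bullet> b) * (wreg s \<epsilon> x * f x))" for b
    by (intro tf_mult' f sw smooth_intros)
  have "(\<lambda>x. wreg s \<epsilon> x * rot b c f x) =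
    (\<lambda>x. pd c (\<lambda>x. (x \<bullet> b) * (wreg s \<epsilon> x * f x)) x - pd b (\<lambda>x. (x \<bullet> c) * (wreg s \<epsilon> x * f x)) x)"
    by (rule ext) (simp add: rot_def smooth_pd_mult sw sf smooth_intros pd_wreg e b c inner_commute[of c b] algebra_simps)
  moreover have "(\<integral>x. pd c (\<lambda>x. (x \<bullet> b) * (wreg s \<epsilon> x * f x)) x - pd b (\<lambda>x. (x \<bullet> c) * (wreg s \<epsilon> x * f x)) x \<partial>lborel) = 0"
    by (subst Bochner_Integration.integral_diff) (auto intro!: tf_integrable tf_pd t b c simp: integral_pd[OF t] b c)
  ultimately show ?thesis by simp
qed

lemma wreg_nonneg: "wreg s \<epsilon> x \<ge> 0" by (simp add: wreg_def)

lemma norm2_powr: "x \<noteq> 0 \<Longrightarrow> ((norm x)\<^sup>2) powr (- (s / 2)) = norm x powr (- s)"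
  using powr_powr[of "norm x" 2 "- (s / 2)"] by (simp add: powr_numeral)

lemma wreg_le:
  assumes "s \<ge> 0" "\<epsilon> \<ge> 0" "x \<noteq> 0"
  shows "wreg s \<epsilon> x \<le> norm x powr (- s)"
proof -
  have "wreg s \<epsilon> x \<le> ((norm x)\<^sup>2) powr (- (s / 2))"
    unfolding wreg_def by (rule powr_mono2') (use assms in auto)
  then show ?thesis by (simp only: norm2_powr[OF assms(3)])
qed

lemma wreg_lim:
  assumes "x \<noteq> 0" "e \<longlonglongrightarrow> 0"
  shows "(\<lambda>n. wreg s (e n) x) \<longlonglongrightarrow> norm x powr (- s)"
proof -
  have "(\<lambda>n. wreg s (e n) x) \<longlonglongrightarrow> ((norm x)\<^sup>2 + 0) powr (- (s / 2))"
    unfolding wreg_def using assms by (intro tendsto_intros) auto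
  then show ?thesis using norm2_powr[OF assms(1), of s] by simp
qed

lemma measurable_norm_powr [measurable]: "(\<lambda>x::'a::euclidean_space. norm x powr a) \<in> borel_measurable borel"
  by measurable

text \<open>Polar coordinates are replaced by the divergence identity for the cutoff: it bounds
  \<open>N - s\<close> times the regularised integral by the integral of
  \<open>\<bar>euler ch x\<bar>\<close>, uniformly in the regularisation. Fatou's lemma then removes
  the regularisation.\<close>

lemma nn_integral_powr_cut:
  fixes s :: real
  assumes s: "0 \<le> s" "s < real DIM('a)"
  shows "(\<integral>\<^sup>+(x::'a::euclidean_space). ennreal (norm x powr (- s) * cut ((norm x)\<^sup>2)) \<partial>lborel) < \<infinity>"
proof -
  define ch where "ch x = cut ((norm x)\<^sup>2)" for x :: 'a
  have tc: "tf ch" unfolding ch_def[abs_def] using tf_cut[of 1] by simp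
  have chim: "ch \<in> borel_measurable borel" using tc by simp
  let ?e = "\<lambda>n::nat. 1 / real (Suc n)"
  have e0: "?e \<longlonglongrightarrow> 0" by (rule LIMSEQ_Suc[OF lim_inverse_n'[unfolded inverse_eq_divide]])
  define C where "C = (\<integral>x. \<bar>euler ch x\<bar> \<partial>lborel)"
  have bd: "(\<integral>x. wreg s (?e n) x * ch x \<partial>lborel) \<le> C / (real DIM('a) - s)" for n
  proof -
    let ?w = "wreg s (?e n) :: 'a \<Rightarrow> real"
    have ep: "?e n > 0" by simp
    have sw: "smooth ?w" by (rule smooth_wreg[OF ep])
    have i1: "integrable lborel (\<lambda>x. ?w x * ch x)" by (intro tf_integrable tf_mult' tc sw)
    have i2: "integrable lborel (\<lambda>x. ?w x * euler ch x)" by (intro tf_integrable tf_mult' tf_euler tc sw)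
    have "(real DIM('a) - s) * (\<integral>x. ?w x * ch x \<partial>lborel) = (\<integral>x. (real DIM('a) - s) * (?w x * ch x) \<partial>lborel)"
      by simp
    also have "\<dots> \<le> (\<integral>x. (real DIM('a) - s * ((norm x)\<^sup>2 / ((norm x)\<^sup>2 + ?e n))) * (?w x * ch x) \<partial>lborel)"
    proof (rule integral_mono_AE')
      have bnd: "0 \<le> (norm x)\<^sup>2 / ((norm x)\<^sup>2 + ?e n)" "(norm x)\<^sup>2 / ((norm x)\<^sup>2 + ?e n) \<le> 1" for x :: 'a
        using norm2_add_pos[OF ep, of x] by (auto simp: divide_le_eq)
      show "AE x in lborel. (real DIM('a) - s) * (?w x * ch x) \<le>
          (real DIM('a) - s * ((norm x)\<^sup>2 / ((norm x)\<^sup>2 + ?e n))) * (?w x * ch x)"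
        using mult_left_le[OF bnd(2) s(1)]
        by (intro AE_I2 mult_right_mono diff_left_mono mult_nonneg_nonneg wreg_nonneg)
           (auto simp: ch_def cut_nonneg)
      show "AE x in lborel. 0 \<le> (real DIM('a) - s * ((norm x)\<^sup>2 / ((norm x)\<^sup>2 + ?e n))) * (?w x * ch x)"
      proof (rule AE_I2)
        fix x :: 'a
        have "0 \<le> real DIM('a) - s * ((norm x)\<^sup>2 / ((norm x)\<^sup>2 + ?e n))"
          using mult_left_le[OF bnd(2)[of x] s(1)] s(2) by linarith
        then show "0 \<le> (real DIM('a) - s * ((norm x)\<^sup>2 / ((norm x)\<^sup>2 + ?e n))) * (?w x * ch x)"
          by (intro mult_nonneg_nonneg wreg_nonneg) (auto simp: ch_def cut_nonneg)
      qed
      show "integrable lborel (\<lambda>x. (real DIM('a) - s * ((norm x)\<^sup>2 / ((norm x)\<^sup>2 + ?e n))) * (?w x * ch x))"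
      proof (rule Bochner_Integration.integrable_bound[OF integrable_mult_right[OF i1, of "real DIM('a) + s"]])
        show "(\<lambda>x. (real DIM('a) - s * ((norm x)\<^sup>2 / ((norm x)\<^sup>2 + ?e n))) * (?w x * ch x)) \<in> borel_measurable lborel"
          using smooth_measurable[OF sw] chim by simp
        show "AE x in lborel. norm ((real DIM('a) - s * ((norm x)\<^sup>2 / ((norm x)\<^sup>2 + ?e n))) * (?w x * ch x)) \<le>
           norm ((real DIM('a) + s) * (?w x * ch x))"
        proof (rule AE_I2)
          fix x :: 'a
          have "\<bar>real DIM('a) - s * ((norm x)\<^sup>2 / ((norm x)\<^sup>2 + ?e n))\<bar> \<le> \<bar>real DIM('a) + s\<bar>"
            using mult_left_le[OF bnd(2)[of x] s(1)] mult_nonneg_nonneg[OF s(1) bnd(1)[of x]] by linarith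
          then show "norm ((real DIM('a) - s * ((norm x)\<^sup>2 / ((norm x)\<^sup>2 + ?e n))) * (?w x * ch x)) \<le>
             norm ((real DIM('a) + s) * (?w x * ch x))"
            unfolding real_norm_def abs_mult by (intro mult_right_mono) auto
        qed
      qed
    qed
    also have "\<dots> = (\<integral>x. - (?w x * euler ch x) \<partial>lborel)"
      using wreg_integral_euler[OF tc ep, of s] by simp
    also have "\<dots> \<le> C"
      unfolding C_def
    proof (rule integral_mono)
      show "integrable lborel (\<lambda>x. - (?w x * euler ch x))" using i2 by simp
      show "integrable lborel (\<lambda>x. \<bar>euler ch x\<bar>)" by (intro integrable_abs tf_integrable tf_euler tc)
      fix x :: 'a
      show "- (?w x * euler ch x) \<le> \<bar>euler ch x\<bar>"
      proof (cases "norm x < 1")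
        case True
        \<comment> \<open>The cutoff is constant on the unit ball, so \<open>euler ch\<close> never
          meets the singularity; outside that ball the weight is at most 1. This is why
          \<open>C\<close> does not depend on \<open>n\<close>.\<close>
        have "pd b ch x = pd b (\<lambda>x. 1) x" for b
        proof (rule pd_eq_open[of "ball 0 1"])
          fix y :: 'a assume "y \<in> ball 0 1"
          then have "(norm y)\<^sup>2 \<le> 1" by (simp add: abs_square_le_1)
          then show "ch y = 1" by (simp add: ch_def cut_one)
        qed (use True tf_smooth[OF tc] in auto)
        then show ?thesis by (simp add: euler_def)
      next
        case False
        have "?w x \<le> norm x powr (- s)" using False s by (intro wreg_le) auto
        also have "\<dots> \<le> 1 powr (- s)" using False s by (intro powr_mono2') auto
        finally have "?w x \<le> 1" by simp
        then have "\<bar>?w x * euler ch x\<bar> \<le> 1 * \<bar>euler ch x\<bar>"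
          unfolding abs_mult using wreg_nonneg[of s "?e n" x] by (intro mult_right_mono) auto
        then show ?thesis by linarith
      qed
    qed
    finally show ?thesis using s by (simp add: pos_le_divide_eq mult.commute)
  qed
  have "(\<integral>\<^sup>+(x::'a). ennreal (norm x powr (- s) * ch x) \<partial>lborel) \<le>
      (\<integral>\<^sup>+(x::'a). liminf (\<lambda>n. ennreal (wreg s (?e n) x * ch x)) \<partial>lborel)"
  proof (rule nn_integral_mono)
    fix x :: 'a
    show "ennreal (norm x powr (- s) * ch x) \<le> liminf (\<lambda>n. ennreal (wreg s (?e n) x * ch x))"
    proof (cases "x = 0")
      case False
      have "(\<lambda>n. ennreal (wreg s (?e n) x * ch x)) \<longlonglongrightarrow> ennreal (norm x powr (- s) * ch x)"
        by (intro tendsto_ennrealI tendsto_mult wreg_lim False e0 tendsto_const)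
      then show ?thesis by (simp add: lim_imp_Liminf)
    qed simp
  qed
  also have "\<dots> \<le> liminf (\<lambda>n. \<integral>\<^sup>+(x::'a). ennreal (wreg s (?e n) x * ch x) \<partial>lborel)"
  proof (rule nn_integral_liminf)
    fix n
    have "wreg s (?e n) \<in> borel_measurable (borel :: 'a measure)"
      by (rule smooth_measurable[OF smooth_wreg]) simp
    then show "(\<lambda>x. ennreal (wreg s (?e n) x * ch x)) \<in> borel_measurable lborel"
      using chim by simp
  qed
  also have "\<dots> \<le> limsup (\<lambda>n. \<integral>\<^sup>+(x::'a). ennreal (wreg s (?e n) x * ch x) \<partial>lborel)"
    by (rule Liminf_le_Limsup) simp
  also have "\<dots> \<le> ennreal (C / (real DIM('a) - s))"
  proof (rule Limsup_bounded, rule always_eventually, rule allI)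
    fix n
    have sw: "smooth (wreg s (?e n) :: 'a \<Rightarrow> real)" by (rule smooth_wreg) simp
    have "(\<integral>\<^sup>+(x::'a). ennreal (wreg s (?e n) x * ch x) \<partial>lborel) = ennreal (\<integral>x. wreg s (?e n) x * ch x \<partial>lborel)"
      by (rule nn_integral_eq_integral)
        (use tf_integrable[OF tf_mult'[OF tc sw]] in \<open>auto simp: ch_def cut_nonneg wreg_nonneg\<close>)
    then show "(\<integral>\<^sup>+(x::'a). ennreal (wreg s (?e n) x * ch x) \<partial>lborel) \<le> ennreal (C / (real DIM('a) - s))"
      using bd[of n] by (simp add: ennreal_leI)
  qed
  finally show ?thesis unfolding ch_def by (rule le_less_trans) simp
qed

lemma integrable_powr_cball:
  fixes s :: real
  assumes s: "s < real DIM('a)"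
  shows "integrable lborel (\<lambda>x::'a::euclidean_space. norm x powr (- s) * indicator (cball 0 R) x)"
proof -
  \<comment> \<open>For negative \<open>s\<close> the power is bounded on the ball; the preceding
    estimate covers only nonnegative exponents.\<close>
  define s' where "s' = max s 0"
  have s': "0 \<le> s'" "s' < real DIM('a)" using s by (auto simp: s'_def)
  have 1: "integrable lborel (\<lambda>x::'a. norm x powr (- s') * cut ((norm x)\<^sup>2))"
  proof (rule integrableI_nonneg)
    have "(\<lambda>x::'a. cut ((norm x)\<^sup>2)) \<in> borel_measurable borel"
      using tf_cut[of 1, where 'a='a] by simp
    then show "(\<lambda>x::'a. norm x powr (- s') * cut ((norm x)\<^sup>2)) \<in> borel_measurable lborel" by simp
  qed (use nn_integral_powr_cut[OF s'] in \<open>auto simp: cut_nonneg\<close>)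
  define C where "C = \<bar>R\<bar> powr (- s) + 1"
  show ?thesis
  proof (rule Bochner_Integration.integrable_bound[OF Bochner_Integration.integrable_add[OF 1 integrable_cball[of C R]]])
    show "AE x::'a in lborel. norm (norm x powr (- s) * indicator (cball 0 R) x) \<le>
       norm (norm x powr (- s') * cut ((norm x)\<^sup>2) + C * indicator (cball 0 R) x)"
    proof (rule AE_I2)
      fix x :: 'a
      have C: "C \<ge> 0" by (simp add: C_def)
      have nn: "0 \<le> norm x powr (- s') * cut ((norm x)\<^sup>2)" by (simp add: cut_nonneg)
      have "norm x powr (- s) * indicator (cball 0 R) x \<le>
         norm x powr (- s') * cut ((norm x)\<^sup>2) + C * indicator (cball 0 R) x"
      proof (cases "norm x \<le> R")
        case True
        have "norm x powr (- s) \<le> norm x powr (- s') * cut ((norm x)\<^sup>2) + C"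
        proof (cases "norm x \<le> 1 \<and> s \<ge> 0")
          case True
          then have "(norm x)\<^sup>2 \<le> 1" by (simp add: abs_square_le_1)
          then show ?thesis using True C by (simp add: cut_one s'_def)
        next
          case False
          have "norm x powr (- s) \<le> C"
          proof (cases "s \<ge> 0")
            case True
            with False have "norm x powr (- s) \<le> 1 powr (- s)" by (intro powr_mono2') auto
            then have "norm x powr (- s) \<le> 1" by simp
            then show ?thesis unfolding C_def using powr_ge_zero[of "\<bar>R\<bar>" "- s"] by linarith
          next
            case neg: False
            have "norm x powr (- s) \<le> \<bar>R\<bar> powr (- s)"
              using neg \<open>norm x \<le> R\<close> by (intro powr_mono2) auto
            then show ?thesis by (simp add: C_def)
          qed
          then show ?thesis using nn by linarith
        qed
        then show ?thesis using True by simp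
      next
        case False then show ?thesis using nn by simp
      qed
      then show "norm (norm x powr (- s) * indicator (cball 0 R) x) \<le>
       norm (norm x powr (- s') * cut ((norm x)\<^sup>2) + C * indicator (cball 0 R) x)" by simp
    qed
  qed (intro borel_measurable_times borel_measurable_indicator, auto)
qed

lemma tf_integrable_powr:
  fixes f :: "'a::euclidean_space \<Rightarrow> real"
  assumes "tf f" "s < real DIM('a)"
  shows "integrable lborel (\<lambda>x. norm x powr (- s) * f x)"
proof -
  obtain C R where C: "\<And>x. \<bar>f x\<bar> \<le> C * indicator (cball 0 R) x" using tf_bounded[OF assms(1)] by metis
  show ?thesis
  proof (rule Bochner_Integration.integrable_bound[OF integrable_mult_right[OF integrable_powr_cball[OF assms(2), of R], of C]])
    show "AE x in lborel. norm (norm x powr (- s) * f x) \<le> norm (C * (norm x powr (- s) * indicator (cball 0 R) x))"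
    proof (rule AE_I2)
      fix x :: 'a
      have "\<bar>f x\<bar> \<le> \<bar>C * indicator (cball 0 R) x\<bar>" using C[of x] by linarith
      then show "norm (norm x powr (- s) * f x) \<le> norm (C * (norm x powr (- s) * indicator (cball 0 R) x))"
        using mult_left_mono[of "\<bar>f x\<bar>" "\<bar>C * indicator (cball 0 R) x\<bar>" "norm x powr (- s)"]
        by (simp add: abs_mult mult.left_commute)
    qed
  qed (use assms in simp)
qed

definition wI :: "real \<Rightarrow> ('a::euclidean_space \<Rightarrow> real) \<Rightarrow> real" where
  "wI s f = (\<integral>x. norm x powr (- s) * f x \<partial>lborel)"

text \<open>Removal of the regularisation, dominated by \<open>|x|^-s\<close> times
  \<open>f\<close>. The factor \<open>\<theta>\<close> is later either 1 or
  \<open>|x|^2 / (|x|^2 + e)\<close>, the damping factor from the derivative of the regularised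
  weight.\<close>

lemma wI_lim:
  fixes f :: "'a::euclidean_space \<Rightarrow> real"
  assumes f: "tf f" and s: "0 \<le> s" "s < real DIM('a)"
    and \<theta>: "\<And>n x. 0 \<le> \<theta> n x \<and> \<theta> n x \<le> (1::real)" "\<And>x. x \<noteq> 0 \<Longrightarrow> (\<lambda>n. \<theta> n x) \<longlonglongrightarrow> 1"
    and m: "\<And>n. \<theta> n \<in> borel_measurable borel"
  shows "(\<lambda>n. \<integral>x. \<theta> n x * (wreg s (1 / real (Suc n)) x * f x) \<partial>lborel) \<longlonglongrightarrow> wI s f"
proof -
  let ?e = "\<lambda>n::nat. 1 / real (Suc n)"
  have e0: "?e \<longlonglongrightarrow> 0" by (rule LIMSEQ_Suc[OF lim_inverse_n'[unfolded inverse_eq_divide]])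
  have ne: "AE x::'a in lborel. x \<noteq> 0" by (rule AE_lborel_singleton)
  have fm: "f \<in> borel_measurable borel" using f by simp
  show ?thesis unfolding wI_def
  proof (rule integral_dominated_convergence[OF _ _ integrable_abs[OF tf_integrable_powr[OF f s(2)]]])
    show "(\<lambda>x. norm x powr (- s) * f x) \<in> borel_measurable lborel" using fm by simp
    show "(\<lambda>x. \<theta> n x * (wreg s (?e n) x * f x)) \<in> borel_measurable lborel" for n
      using fm m[of n] smooth_measurable[OF smooth_wreg[of "?e n" s, where 'a='a]] by simp
    show "AE x in lborel. (\<lambda>n. \<theta> n x * (wreg s (?e n) x * f x)) \<longlonglongrightarrow> norm x powr (- s) * f x"
      using ne
    proof eventually_elim
      case (elim x)
      have "(\<lambda>n. \<theta> n x * (wreg s (?e n) x * f x)) \<longlonglongrightarrow> 1 * (norm x powr (- s) * f x)"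
        by (intro tendsto_mult \<theta>(2) elim wreg_lim e0 tendsto_const)
      then show ?case by simp
    qed
    show "AE x in lborel. norm (\<theta> n x * (wreg s (?e n) x * f x)) \<le> \<bar>norm x powr (- s) * f x\<bar>" for n
      using ne
    proof eventually_elim
      case (elim x)
      have "\<bar>\<theta> n x\<bar> * (\<bar>wreg s (?e n) x\<bar> * \<bar>f x\<bar>) \<le> 1 * (norm x powr (- s) * \<bar>f x\<bar>)"
        using \<theta>(1)[of n x] wreg_le[OF s(1) _ elim, of "?e n"] wreg_nonneg[of s "?e n" x]
        by (intro mult_mono) auto
      then show ?case by (simp add: abs_mult)
    qed
  qed
qed

text \<open>Since \<open>s < N\<close>, no contribution of the origin survives in the limit,
  although \<open>f\<close> need not vanish there.\<close>

lemma wI_euler: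
  fixes f :: "'a::euclidean_space \<Rightarrow> real"
  assumes f: "tf f" and s: "0 \<le> s" "s < real DIM('a)"
  shows "wI s (euler f) = - (real DIM('a) - s) * wI s f"
proof -
  let ?e = "\<lambda>n::nat. 1 / real (Suc n)"
  have e0: "?e \<longlonglongrightarrow> 0" by (rule LIMSEQ_Suc[OF lim_inverse_n'[unfolded inverse_eq_divide]])
  define \<theta> where "\<theta> n x = (norm x)\<^sup>2 / ((norm x)\<^sup>2 + ?e n)" for n and x :: 'a
  have lim: "(\<lambda>n. \<integral>x. \<theta> n x * (wreg s (?e n) x * f x) \<partial>lborel) \<longlonglongrightarrow> wI s f"
  proof (rule wI_lim[OF f s])
    show "0 \<le> \<theta> n x \<and> \<theta> n x \<le> 1" for n x
      using norm2_add_pos[of "?e n" x] by (auto simp: \<theta>_def divide_le_eq)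
    show "(\<lambda>n. \<theta> n x) \<longlonglongrightarrow> 1" if "x \<noteq> 0" for x
    proof -
      have "(\<lambda>n. \<theta> n x) \<longlonglongrightarrow> (norm x)\<^sup>2 / ((norm x)\<^sup>2 + 0)"
        unfolding \<theta>_def using that by (intro tendsto_intros e0) auto
      then show ?thesis using that by simp
    qed
  qed (simp add: \<theta>_def)
  have l1: "(\<lambda>n. \<integral>x. wreg s (?e n) x * g x \<partial>lborel) \<longlonglongrightarrow> wI s g" if "tf g" for g :: "'a \<Rightarrow> real"
    using wI_lim[OF that s, of "\<lambda>_ _. 1"] by simp
  have eq: "(\<integral>x. wreg s (?e n) x * euler f x \<partial>lborel) =
     - (real DIM('a) * (\<integral>x. wreg s (?e n) x * f x \<partial>lborel) - s * (\<integral>x. \<theta> n x * (wreg s (?e n) x * f x) \<partial>lborel))" for n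
  proof -
    have i: "integrable lborel (\<lambda>x. wreg s (?e n) x * f x)"
      by (intro tf_integrable tf_mult' f smooth_wreg) simp
    have j: "integrable lborel (\<lambda>x. \<theta> n x * (wreg s (?e n) x * f x))"
    proof (rule Bochner_Integration.integrable_bound[OF i])
      show "(\<lambda>x. \<theta> n x * (wreg s (?e n) x * f x)) \<in> borel_measurable lborel"
        using smooth_measurable[OF smooth_wreg[of "?e n" s, where 'a='a]] f by (simp add: \<theta>_def[abs_def])
      show "AE x in lborel. norm (\<theta> n x * (wreg s (?e n) x * f x)) \<le> norm (wreg s (?e n) x * f x)"
      proof (rule AE_I2)
        fix x :: 'a
        have "\<bar>\<theta> n x\<bar> \<le> 1" using norm2_add_pos[of "?e n" x] by (auto simp: \<theta>_def divide_le_eq)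
        then show "norm (\<theta> n x * (wreg s (?e n) x * f x)) \<le> norm (wreg s (?e n) x * f x)"
          using mult_right_mono[of "\<bar>\<theta> n x\<bar>" 1 "\<bar>wreg s (?e n) x * f x\<bar>"]
          by (simp add: abs_mult)
      qed
    qed
    have "(\<integral>x. (real DIM('a) - s * \<theta> n x) * (wreg s (?e n) x * f x) \<partial>lborel) =
      (\<integral>x. real DIM('a) * (wreg s (?e n) x * f x) - s * (\<theta> n x * (wreg s (?e n) x * f x)) \<partial>lborel)"
      by (intro Bochner_Integration.integral_cong refl) (simp add: algebra_simps)
    also have "\<dots> = real DIM('a) * (\<integral>x. wreg s (?e n) x * f x \<partial>lborel) - s * (\<integral>x. \<theta> n x * (wreg s (?e n) x * f x) \<partial>lborel)"
      using i j by (subst Bochner_Integration.integral_diff) (auto intro!: integrable_mult_right)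
    finally show ?thesis using wreg_integral_euler[OF f, of "?e n" s] by (simp add: \<theta>_def)
  qed
  have "(\<lambda>n. \<integral>x. wreg s (?e n) x * euler f x \<partial>lborel) \<longlonglongrightarrow> - (real DIM('a) * wI s f - s * wI s f)"
    unfolding eq by (intro tendsto_intros l1 f lim)
  from LIMSEQ_unique[OF l1[OF tf_euler[OF f]] this] show ?thesis by (simp add: algebra_simps)
qed

lemma wI_rot:
  fixes f :: "'a::euclidean_space \<Rightarrow> real"
  assumes f: "tf f" and s: "0 \<le> s" "s < real DIM('a)" and bc: "b \<in> Basis" "c \<in> Basis"
  shows "wI s (rot b c f) = 0"
proof -
  have "(\<lambda>n::nat. \<integral>x. 1 * (wreg s (1 / real (Suc n)) x * rot b c f x) \<partial>lborel) \<longlonglongrightarrow> wI s (rot b c f)"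
    using wI_lim[OF tf_rot[OF f bc] s, of "\<lambda>_ _. 1"] by simp
  then show ?thesis by (simp add: wreg_integral_rot[OF f _ bc] LIMSEQ_const_iff)
qed

subsection \<open>The inequality for test functions\<close>

text \<open>The operator \<open>D\<close> of the overview, with the shift left free.\<close>

definition drv :: "real \<Rightarrow> ('a::euclidean_space \<Rightarrow> real) \<Rightarrow> 'a \<Rightarrow> real" where
  "drv a f x = euler f x + a * f x"

lemma tf_drv: "tf f \<Longrightarrow> tf (drv a f)"
  unfolding drv_def[abs_def] by (intro tf_add tf_cmult tf_euler)

lemma tf_prod: "tf f \<Longrightarrow> tf g \<Longrightarrow> tf (\<lambda>x. f x * g x)"
  by (rule tf_mult[OF _ tf_smooth])

lemma wI_cmult: "wI s (\<lambda>x. c * f x) = c * wI s f"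
  by (simp add: wI_def mult.left_commute)

lemma drv_rot:
  assumes "smooth f" "b \<in> Basis" "c \<in> Basis"
  shows "rot b c (drv a f) = drv a (rot b c f)"
  unfolding drv_def[abs_def]
  using assms by (simp add: rot_add rot_cmult smooth_intros euler_rot)

context
  fixes s a :: real
  assumes s0: "0 \<le> s" and sN: "s < real DIM('a::euclidean_space)" and a_def: "a = (real DIM('a) - s) / 2"
begin

lemma dim_eq: "real DIM('a) = 2 * a + s"
  by (simp add: a_def field_simps)

lemma wI_add:
  fixes f g :: "'a \<Rightarrow> real"
  shows "tf f \<Longrightarrow> tf g \<Longrightarrow> wI s (\<lambda>x. f x + g x) = wI s f + wI s g"
  unfolding wI_def distrib_left
  by (intro Bochner_Integration.integral_add tf_integrable_powr sN)

lemma wI_sum: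
  fixes f :: "'i \<Rightarrow> 'a \<Rightarrow> real"
  shows "(\<And>i. i \<in> A \<Longrightarrow> tf (f i)) \<Longrightarrow> wI s (\<lambda>x. \<Sum>i\<in>A. f i x) = (\<Sum>i\<in>A. wI s (f i))"
  unfolding wI_def sum_distrib_left
  by (intro Bochner_Integration.integral_sum tf_integrable_powr sN)

lemma wI_mono:
  fixes f g :: "'a \<Rightarrow> real"
  assumes "tf f" "tf g" "\<And>x. f x \<le> g x"
  shows "wI s f \<le> wI s g"
  unfolding wI_def
  by (intro integral_mono tf_integrable_powr sN assms mult_left_mono) auto

lemma wI_nonneg: "(\<And>x. 0 \<le> f x) \<Longrightarrow> 0 \<le> wI s (f :: 'a \<Rightarrow> real)"
  unfolding wI_def by (intro integral_nonneg_AE AE_I2 mult_nonneg_nonneg) auto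

definition ip :: "('a \<Rightarrow> real) \<Rightarrow> ('a \<Rightarrow> real) \<Rightarrow> real" where
  "ip f g = wI s (\<lambda>x. f x * g x)"

lemma ip_commute: "ip f g = ip g f"
  by (simp add: ip_def mult.commute)

lemma ip_nonneg: "0 \<le> ip f f"
  unfolding ip_def by (rule wI_nonneg) simp

lemma ip_cauchy_schwarz:
  assumes f: "tf f" and g: "tf g"
  shows "(ip f g)\<^sup>2 \<le> ip f f * ip g g"
proof -
  have q: "0 \<le> ip f f + 2 * t * ip f g + t * t * ip g g" for t
  proof -
    have "0 \<le> wI s (\<lambda>x. (f x + t * g x) * (f x + t * g x))" by (rule wI_nonneg) simp
    also have "(\<lambda>x. (f x + t * g x) * (f x + t * g x)) =
        (\<lambda>x. f x * f x + (2 * t * (f x * g x) + t * t * (g x * g x)))"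
      by (auto simp: algebra_simps)
    also have "wI s \<dots> = ip f f + 2 * t * ip f g + t * t * ip g g"
      by (simp add: wI_add wI_cmult tf_add tf_cmult tf_prod f g ip_def)
    finally show ?thesis .
  qed
  show ?thesis
  proof (cases "ip g g = 0")
    case True
    have "ip f g = 0"
    proof (rule ccontr)
      assume "ip f g \<noteq> 0"
      \<comment> \<open>This choice of \<open>t\<close> would make the quadratic equal to
        -1.\<close>
      then show False using q[of "- (ip f f + 1) / (2 * ip f g)"] True by (simp add: field_simps)
    qed
    then show ?thesis using True by simp
  next
    case False
    then have pos: "ip g g > 0" using ip_nonneg[of g] by simp
    have "0 \<le> ip f f + 2 * (- ip f g / ip g g) * ip f g + (- ip f g / ip g g) * (- ip f g / ip g g) * ip g g"
      by (rule q)
    also have "\<dots> = ip f f - (ip f g)\<^sup>2 / ip g g"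
      using pos by (simp add: field_simps power2_eq_square)
    finally show ?thesis using pos by (simp add: field_simps)
  qed
qed

text \<open>The adjoint of \<open>euler\<close> for the weight \<open>|x|^-s\<close> is
  \<open>- euler - (N - s)\<close>. The shift \<open>a\<close> is half of \<open>N - s\<close>, so
  it splits the zero order term evenly.\<close>

lemma ip_drv:
  assumes f: "tf f" and g: "tf g"
  shows "ip (drv a f) g = - ip f (drv a g)"
proof -
  have "(\<lambda>x. drv a f x * g x) = (\<lambda>x. (euler (\<lambda>x. f x * g x) x + 2 * a * (f x * g x)) + (-1) * (f x * drv a g x))"
    by (simp add: drv_def[abs_def] euler_mult tf_smooth f g algebra_simps)
  then have "ip (drv a f) g = wI s (euler (\<lambda>x. f x * g x)) + 2 * a * wI s (\<lambda>x. f x * g x) + (-1) * wI s (\<lambda>x. f x * drv a g x)"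
    unfolding ip_def
    by (simp only: wI_add wI_cmult tf_add tf_cmult tf_prod tf_euler tf_drv f g)
  then show ?thesis
    using wI_euler[OF tf_prod[OF f g] s0 sN] dim_eq by (simp add: ip_def)
qed

lemma ip_rot:
  assumes f: "tf f" and g: "tf g" and bc: "b \<in> Basis" "c \<in> Basis"
  shows "ip (rot b c f) g = - ip f (rot b c g)"
proof -
  have "(\<lambda>x. rot b c f x * g x) = (\<lambda>x. rot b c (\<lambda>x. f x * g x) x + (-1) * (f x * rot b c g x))"
    by (simp add: rot_mult tf_smooth f g algebra_simps)
  then have "ip (rot b c f) g = wI s (rot b c (\<lambda>x. f x * g x)) + (-1) * wI s (\<lambda>x. f x * rot b c g x)"
    unfolding ip_def
    by (simp only: wI_add wI_cmult tf_add tf_cmult tf_prod tf_rot f g bc)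
  then show ?thesis
    using wI_rot[OF tf_prod[OF f g] s0 sN bc] by (simp add: ip_def)
qed

definition gip :: "('a \<Rightarrow> real) \<Rightarrow> ('a \<Rightarrow> real) \<Rightarrow> real" where
  "gip f g = (\<Sum>b\<in>Basis. \<Sum>c\<in>Basis. ip (rot b c f) (rot b c g)) / 2"

lemma gip_nonneg: "0 \<le> gip f f"
  unfolding gip_def by (intro divide_nonneg_nonneg sum_nonneg ip_nonneg) auto

lemma ip_sphlap:
  assumes f: "tf f" and g: "tf g"
  shows "ip (sphlap f) g = - gip f g"
proof -
  have "ip (sphlap f) g = wI s (\<lambda>x. (1/2) * (\<Sum>b\<in>Basis. \<Sum>c\<in>Basis. rot b c (rot b c f) x * g x))"
    unfolding ip_def sphlap_def by (simp add: sum_distrib_right)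
  also have "\<dots> = (1/2) * (\<Sum>b\<in>Basis. \<Sum>c\<in>Basis. ip (rot b c (rot b c f)) g)"
    unfolding wI_cmult ip_def
    by (simp add: wI_sum tf_sum tf_prod tf_rot f g)
  also have "(\<Sum>b\<in>Basis. \<Sum>c\<in>Basis. ip (rot b c (rot b c f)) g) =
      (\<Sum>b\<in>Basis. \<Sum>c\<in>Basis. - ip (rot b c f) (rot b c g))"
    by (intro sum.cong refl ip_rot tf_rot f g)
  finally show ?thesis by (simp add: gip_def sum_negf)
qed

lemma tf_sphgrad2: "tf f \<Longrightarrow> tf (sphgrad2 f)"
  unfolding sphgrad2_def[abs_def] divide_inverse power2_eq_square
  by (intro tf_mult tf_sum tf_prod tf_rot smooth_intros)

lemma gip_sphgrad2:
  assumes f: "tf f"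
  shows "gip f f = wI s (sphgrad2 f)"
proof -
  have "sphgrad2 f = (\<lambda>x. (1/2) * (\<Sum>b\<in>Basis. \<Sum>c\<in>Basis. rot b c f x * rot b c f x))"
    by (rule ext) (simp add: sphgrad2_def power2_eq_square)
  then have "wI s (sphgrad2 f) = (1/2) * (\<Sum>b\<in>Basis. \<Sum>c\<in>Basis. ip (rot b c f) (rot b c f))"
    by (simp only: wI_cmult) (simp add: ip_def wI_sum tf_sum tf_prod tf_rot f)
  then show ?thesis by (simp add: gip_def)
qed

lemma gip_drv:
  assumes f: "tf f" and g: "tf g"
  shows "gip (drv a f) g = - gip f (drv a g)"
proof -
  have "(\<Sum>b\<in>Basis. \<Sum>c\<in>Basis. ip (rot b c (drv a f)) (rot b c g)) =
        (\<Sum>b\<in>Basis. \<Sum>c\<in>Basis. - ip (rot b c f) (rot b c (drv a g)))"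
    by (intro sum.cong refl) (simp add: drv_rot tf_smooth f g ip_drv tf_rot)
  then show ?thesis by (simp add: gip_def sum_negf)
qed

text \<open>One \<open>sphlap\<close> is integrated by parts, the other is commuted with the
  rotation and integrated by parts in turn. The result contains second derivatives only and is the
  integral of the first term in the bracket of \<open>bochner_pointwise\<close>.\<close>

lemma ip_sphlap_sphlap:
  assumes f: "tf f"
  shows "ip (sphlap f) (sphlap f) = (\<Sum>k\<in>Basis. \<Sum>l\<in>Basis. wI s (sphgrad2 (rot k l f))) / 2"
proof -
  have "ip (sphlap f) (sphlap f) = - (\<Sum>k\<in>Basis. \<Sum>l\<in>Basis. ip (rot k l f) (rot k l (sphlap f))) / 2"
    by (simp add: ip_sphlap f tf_sphlap gip_def)
  also have "(\<Sum>k\<in>Basis. \<Sum>l\<in>Basis. ip (rot k l f) (rot k l (sphlap f))) =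
     (\<Sum>k\<in>Basis. \<Sum>l\<in>Basis. - wI s (sphgrad2 (rot k l f)))"
    by (intro sum.cong refl)
      (simp add: sphlap_rot[symmetric] tf_smooth f ip_commute[of "rot _ _ f"] ip_sphlap tf_rot gip_sphgrad2)
  finally show ?thesis by (simp add: sum_negf)
qed

text \<open>Integrating the Bochner inequality and inserting \<open>ip_sphlap_sphlap\<close> gives,
  with \<open>L = ip (sphlap f) (sphlap f)\<close>,
  \<open>L <= (N - 1) * L - (N - 1) * (N - 2) * gip f f\<close>. Dividing by the positive number
  \<open>N - 2\<close> leaves the first nonzero eigenvalue \<open>N - 1\<close> of the
  sphere.\<close>

lemma sphere_poincare:
  assumes f: "tf f" and N: "DIM('a) \<ge> 3"
  shows "(real DIM('a) - 1) * gip f f \<le> ip (sphlap f) (sphlap f)"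
proof -
  let ?N = "real DIM('a)"
  have "wI s (\<lambda>x. sphlap f x * sphlap f x) \<le> wI s (\<lambda>x. ((?N - 1) / 2) * (\<Sum>k\<in>Basis. \<Sum>l\<in>Basis. sphgrad2 (rot k l f) x)
      + (- (?N - 1) * (?N - 2)) * sphgrad2 f x)"
  proof (rule wI_mono)
    show "sphlap f x * sphlap f x \<le> ((?N - 1) / 2) * (\<Sum>k\<in>Basis. \<Sum>l\<in>Basis. sphgrad2 (rot k l f) x)
      + (- (?N - 1) * (?N - 2)) * sphgrad2 f x" for x
      using bochner_pointwise[OF tf_smooth[OF f], of x] N
      by (simp add: power2_eq_square algebra_simps)
  qed (intro tf_prod tf_sphlap tf_add tf_cmult tf_sum tf_sphgrad2 tf_rot f; assumption)+
  also have "\<dots> = ((?N - 1) / 2) * (\<Sum>k\<in>Basis. \<Sum>l\<in>Basis. wI s (sphgrad2 (rot k l f)))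
      + (- (?N - 1) * (?N - 2)) * wI s (sphgrad2 f)"
  proof -
    have "wI s (\<lambda>x. \<Sum>k\<in>Basis. \<Sum>l\<in>Basis. sphgrad2 (rot k l f) x) = (\<Sum>k\<in>Basis. \<Sum>l\<in>Basis. wI s (sphgrad2 (rot k l f)))"
      by (simp add: wI_sum tf_sum tf_sphgrad2 tf_rot f)
    then show ?thesis
      by (simp only: wI_add wI_cmult tf_sum tf_cmult tf_sphgrad2 tf_rot f)
  qed
  also have "(\<Sum>k\<in>Basis. \<Sum>l\<in>Basis. wI s (sphgrad2 (rot k l f))) = 2 * ip (sphlap f) (sphlap f)"
    by (simp add: ip_sphlap_sphlap f)
  finally have "ip (sphlap f) (sphlap f) \<le> ((?N - 1) / 2) * (2 * ip (sphlap f) (sphlap f))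
      + (- (?N - 1) * (?N - 2)) * gip f f"
    by (simp only: ip_def gip_sphgrad2[OF f])
  then have "0 \<le> (?N - 2) * (ip (sphlap f) (sphlap f) - (?N - 1) * gip f f)"
    by (simp add: field_simps)
  then show ?thesis using N by (simp add: zero_le_mult_iff)
qed

section \<open>Energy identities and their consequences\<close>

lemma norm2_laplacian:
  fixes f :: "'a \<Rightarrow> real"
  assumes f: "smooth f"
  shows "(norm x)\<^sup>2 * laplacian f x = drv a (drv a f) x + (s - 2) * drv a f x
     - a * (a + s - 2) * f x + sphlap f x"
proof -
  have "euler (drv a f) x = euler (euler f) x + a * euler f x"
    unfolding drv_def[abs_def] by (simp add: euler_add euler_cmult smooth_intros f)
  then have "drv a (drv a f) x = euler (euler f) x + 2 * a * euler f x + a * a * f x"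
    unfolding drv_def[of a "drv a f"] by (simp add: drv_def algebra_simps)
  then show ?thesis
    unfolding sphlap_laplacian[OF f] dim_eq by (simp add: drv_def algebra_simps)
qed

text \<open>Cross terms odd in \<open>D\<close> vanish by antisymmetry, since \<open>D\<close>
  commutes with \<open>sphlap\<close>; those of \<open>D^2\<close> with \<open>u\<close> and with
  \<open>sphlap u\<close> become squares. The coefficient of the first order term is
  \<open>(b - a)^2 + 2 a b = a^2 + b^2\<close>: this is the origin of the sharp constant.\<close>

lemma laplacian_identity:
  assumes u: "tf u"
  defines "b \<equiv> a + s - 2"
  shows "wI s (\<lambda>x. ((norm x)\<^sup>2 * laplacian u x)\<^sup>2) =
     ip (drv a (drv a u)) (drv a (drv a u)) + (a\<^sup>2 + b\<^sup>2) * ip (drv a u) (drv a u) + (a * b)\<^sup>2 * ip u u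
     + ip (sphlap u) (sphlap u) + 2 * gip (drv a u) (drv a u) + 2 * a * b * gip u u"
proof -
  let ?D = "drv a u" and ?D2 = "drv a (drv a u)" and ?L = "sphlap u"
  define c where "c = s - 2"
  have t: "tf ?D" "tf ?D2" "tf ?L" by (intro tf_drv tf_sphlap u)+
  have "(\<lambda>x. ((norm x)\<^sup>2 * laplacian u x)\<^sup>2) = (\<lambda>x. ?D2 x * ?D2 x + (c * c * (?D x * ?D x)
     + ((a * b) * (a * b) * (u x * u x) + (?L x * ?L x + (2 * c * (?D2 x * ?D x) + (- 2 * (a * b) * (?D2 x * u x)
     + (2 * (?D2 x * ?L x) + (- 2 * c * (a * b) * (?D x * u x) + (2 * c * (?D x * ?L x) + - 2 * (a * b) * (?L x * u x))))))))))"
    unfolding norm2_laplacian[OF tf_smooth[OF u]] c_def b_def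
    by (rule ext) (simp add: power2_eq_square algebra_simps)
  then have "wI s (\<lambda>x. ((norm x)\<^sup>2 * laplacian u x)\<^sup>2) = ip ?D2 ?D2 + (c * c * ip ?D ?D
     + ((a * b) * (a * b) * ip u u + (ip ?L ?L + (2 * c * ip ?D2 ?D + (- 2 * (a * b) * ip ?D2 u
     + (2 * ip ?D2 ?L + (- 2 * c * (a * b) * ip ?D u + (2 * c * ip ?D ?L + - 2 * (a * b) * ip ?L u))))))))"
    by (simp only: wI_add wI_cmult tf_add tf_cmult tf_prod t u ip_def)
  moreover have "ip ?D2 ?D = 0" using ip_drv[OF t(1) t(1)] ip_commute[of ?D2 ?D] by simp
  moreover have "ip ?D2 u = - ip ?D ?D" by (rule ip_drv[OF t(1) u])
  moreover have "ip ?D2 ?L = gip ?D ?D"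
    using ip_sphlap[OF u t(2)] gip_drv[OF u t(1)] ip_commute[of ?D2 ?L] by simp
  moreover have "ip ?D u = 0" using ip_drv[OF u u] ip_commute[of u ?D] by simp
  moreover have "gip u ?D = gip ?D u"
    unfolding gip_def by (simp add: ip_commute)
  then have "ip ?D ?L = 0"
    using ip_sphlap[OF u t(1)] gip_drv[OF u u] ip_commute[of ?D ?L] by simp
  moreover have "ip ?L u = - gip u u" by (rule ip_sphlap[OF u u])
  ultimately show ?thesis
    by (simp add: b_def c_def power2_eq_square algebra_simps)
qed

text \<open>The radial part of the gradient is \<open>D u - a u\<close>, and its cross term vanishes
  by antisymmetry.\<close>

lemma gradient_identity:
  assumes u: "tf u"
  shows "wI s (\<lambda>x. (norm x)\<^sup>2 * (norm (grad u x))\<^sup>2) = ip (drv a u) (drv a u) + a\<^sup>2 * ip u u + gip u u"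
proof -
  have t: "tf (drv a u)" by (intro tf_drv u)
  have "(\<lambda>x. (norm x)\<^sup>2 * (norm (grad u x))\<^sup>2) =
     (\<lambda>x. drv a u x * drv a u x + (a * a * (u x * u x) + (- 2 * a * (drv a u x * u x) + sphgrad2 u x)))"
    unfolding norm_grad_polar by (rule ext) (simp add: drv_def power2_eq_square algebra_simps)
  then have "wI s (\<lambda>x. (norm x)\<^sup>2 * (norm (grad u x))\<^sup>2) =
     ip (drv a u) (drv a u) + (a * a * ip u u + (- 2 * a * ip (drv a u) u + gip u u))"
    unfolding gip_sphgrad2[OF u] ip_def
    by (simp only: wI_add wI_cmult tf_add tf_cmult tf_prod tf_sphgrad2 t u)
  moreover have "ip (drv a u) u = 0" using ip_drv[OF u u] ip_commute[of u "drv a u"] by simp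
  ultimately show ?thesis by (simp add: power2_eq_square)
qed

text \<open>Subtracting \<open>a^2 + b^2\<close> times the gradient identity cancels the first order
  terms, and the zero order ones because \<open>(a b)^2 + a^4 = a^2 (a^2 + b^2)\<close>. On the
  angular part it leaves \<open>2 a b - (a^2 + b^2) = - (s - 2)^2\<close>, which the sphere
  inequality compensates.\<close>

lemma main_inequality:
  assumes u: "tf u" and N: "DIM('a) \<ge> 5" and s: "2 \<le> s" "s \<le> 4"
  defines "b \<equiv> a + s - 2"
  shows "(a\<^sup>2 + b\<^sup>2) * wI s (\<lambda>x. (norm x)\<^sup>2 * (norm (grad u x))\<^sup>2) + ip (drv a (drv a u)) (drv a (drv a u))
     \<le> wI s (\<lambda>x. ((norm x)\<^sup>2 * laplacian u x)\<^sup>2) + a ^ 4 * ip u u"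
proof -
  have "(s - 2)\<^sup>2 \<le> 2\<^sup>2" using s by (intro power_mono) auto
  also have "\<dots> \<le> real DIM('a) - 1" using N by simp
  finally have "(s - 2)\<^sup>2 * gip u u \<le> (real DIM('a) - 1) * gip u u"
    using gip_nonneg by (rule mult_right_mono)
  also have "\<dots> \<le> ip (sphlap u) (sphlap u)" using sphere_poincare[OF u] N by simp
  finally have 1: "(s - 2)\<^sup>2 * gip u u \<le> ip (sphlap u) (sphlap u)" .
  have "wI s (\<lambda>x. ((norm x)\<^sup>2 * laplacian u x)\<^sup>2) + a ^ 4 * ip u u
     - (a\<^sup>2 + b\<^sup>2) * wI s (\<lambda>x. (norm x)\<^sup>2 * (norm (grad u x))\<^sup>2) - ip (drv a (drv a u)) (drv a (drv a u))
     = ip (sphlap u) (sphlap u) - (s - 2)\<^sup>2 * gip u u + 2 * gip (drv a u) (drv a u)"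
    unfolding gradient_identity[OF u] laplacian_identity[OF u]
    unfolding b_def by (simp add: power2_eq_square power4_eq_xxxx algebra_simps)
  then show ?thesis using 1 gip_nonneg[of "drv a u"] by linarith
qed

text \<open>Since \<open>a\<close> and \<open>b\<close> are positive, all terms of
  \<open>laplacian_identity\<close> are nonnegative, and those of \<open>gradient_identity\<close>
  are dominated one by one. These bounds let the Cauchy property in the norm of the completion
  control gradients and functions as well.\<close>

lemma rellich_inequality:
  assumes u: "tf u" and s: "2 \<le> s"
  defines "b \<equiv> a + s - 2"
  shows "(a * b)\<^sup>2 * ip u u \<le> wI s (\<lambda>x. ((norm x)\<^sup>2 * laplacian u x)\<^sup>2)"
    and "a\<^sup>2 * wI s (\<lambda>x. (norm x)\<^sup>2 * (norm (grad u x))\<^sup>2) \<le> 2 * wI s (\<lambda>x. ((norm x)\<^sup>2 * laplacian u x)\<^sup>2)"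
proof -
  have a: "a > 0" using sN by (simp add: a_def)
  then have b: "b \<ge> a" using s by (simp add: b_def)
  note nn = ip_nonneg[of u] ip_nonneg[of "drv a u"] ip_nonneg[of "drv a (drv a u)"] ip_nonneg[of "sphlap u"]
    gip_nonneg[of u] gip_nonneg[of "drv a u"]
  let ?M = "wI s (\<lambda>x. ((norm x)\<^sup>2 * laplacian u x)\<^sup>2)"
  have M: "?M = ip (drv a (drv a u)) (drv a (drv a u)) + (a\<^sup>2 + b\<^sup>2) * ip (drv a u) (drv a u) + (a * b)\<^sup>2 * ip u u
     + ip (sphlap u) (sphlap u) + 2 * gip (drv a u) (drv a u) + 2 * a * b * gip u u"
    unfolding b_def by (rule laplacian_identity[OF u])
  have p: "0 \<le> (a\<^sup>2 + b\<^sup>2) * ip (drv a u) (drv a u)" "0 \<le> 2 * a * b * gip u u"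
    using a b nn by (auto intro!: mult_nonneg_nonneg)
  show 1: "(a * b)\<^sup>2 * ip u u \<le> ?M" unfolding M using nn p by linarith
  have "a\<^sup>2 \<le> b\<^sup>2" using a b by (intro power_mono) auto
  then have "a\<^sup>2 * a\<^sup>2 * ip u u \<le> (a * b)\<^sup>2 * ip u u"
    unfolding power_mult_distrib using nn by (intro mult_right_mono mult_left_mono) auto
  moreover have "a\<^sup>2 * ip (drv a u) (drv a u) \<le> (a\<^sup>2 + b\<^sup>2) * ip (drv a u) (drv a u)"
    using nn by (intro mult_right_mono) auto
  moreover have "a\<^sup>2 * gip u u \<le> 2 * a * b * gip u u"
    using a b nn mult_left_mono[OF b, of a] by (intro mult_right_mono) (auto simp: power2_eq_square)
  moreover have "0 \<le> (a * b)\<^sup>2 * ip u u" using nn by simp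
  ultimately show "a\<^sup>2 * wI s (\<lambda>x. (norm x)\<^sup>2 * (norm (grad u x))\<^sup>2) \<le> 2 * ?M"
    unfolding M gradient_identity[OF u] distrib_left using nn p by linarith
qed

text \<open>The radial derivative of the bounded function \<open>- 1 / (|x|^2 + 1)\<close>. It is
  positive off the origin, so integrals against it detect \<open>u\<close>, while its bounded
  primitive permits integration by parts.\<close>

definition log_weight :: "'a \<Rightarrow> real" where
  "log_weight x = 2 * (norm x)\<^sup>2 / ((norm x)\<^sup>2 + 1)\<^sup>2"

lemma log_weight_smooth: "smooth log_weight" and log_weight_euler: "euler (\<lambda>x. - wreg 2 1 x) = log_weight"
proof -
  have sw: "smooth (wreg 2 1 :: 'a \<Rightarrow> real)" by (rule smooth_wreg) simp
  show "euler (\<lambda>x. - wreg 2 1 x) = log_weight"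
  proof
    fix x :: 'a
    have "euler (\<lambda>x. - wreg 2 1 x) x = (\<Sum>b\<in>Basis. 2 * wreg 2 1 x / ((norm x)\<^sup>2 + 1) * ((x \<bullet> b) * (x \<bullet> b)))"
      unfolding euler_def by (intro sum.cong refl)
        (subst smooth_pd_minus[OF sw], simp add: pd_wreg)
    also have "\<dots> = 2 * wreg 2 1 x / ((norm x)\<^sup>2 + 1) * (norm x)\<^sup>2"
      by (simp only: sum_distrib_left[symmetric] norm2_Basis[symmetric])
    also have "\<dots> = log_weight x"
      using norm2_add_pos[of 1 x]
      by (simp add: log_weight_def wreg_def powr_minus power2_eq_square divide_simps)
    finally show "euler (\<lambda>x. - wreg 2 1 x) x = log_weight x" .
  qed
  then show "smooth log_weight" using smooth_euler[OF smooth_minus[OF sw]] by simp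
qed

text \<open>With \<open>H = - 1 / (|x|^2 + 1)\<close> the product rule is
  \<open>D (H u) = (euler H) u + H (D u)\<close>. Antisymmetry turns the integral against
  \<open>log_weight\<close> into \<open>- 2\<close> times the product of \<open>H u\<close> and
  \<open>D u\<close>; as \<open>H\<close> is bounded by 1, Cauchy-Schwarz finishes. The second bound
  interpolates \<open>D u\<close> between \<open>u\<close> and \<open>D^2 u\<close>. Together they
  make "\<open>D^2 u = 0\<close> implies \<open>u = 0\<close>" quantitative.\<close>

lemma log_weight_estimate:
  assumes u: "tf u"
  shows "(wI s (\<lambda>x. log_weight x * (u x)\<^sup>2))\<^sup>2 \<le> 4 * (ip u u * ip (drv a u) (drv a u))"
    and "(ip (drv a u) (drv a u))\<^sup>2 \<le> ip u u * ip (drv a (drv a u)) (drv a (drv a u))"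
proof -
  let ?H = "\<lambda>x. - wreg 2 1 x :: real"
  have sw: "smooth ?H" by (intro smooth_minus smooth_wreg) simp
  have t: "tf (drv a u)" "tf (drv a (drv a u))" by (intro tf_drv u)+
  have tH: "tf (\<lambda>x. ?H x * u x)" by (rule tf_mult'[OF u sw])
  have bd: "\<bar>?H x\<bar> \<le> 1" for x :: 'a
    unfolding wreg_def using powr_mono2'[of "-1" 1 "(norm x)\<^sup>2 + 1"] by simp
  have "ip (\<lambda>x. ?H x * u x) (drv a u) = - ip (drv a (\<lambda>x. ?H x * u x)) u"
    using ip_drv[OF tH u] by simp
  also have "drv a (\<lambda>x. ?H x * u x) = (\<lambda>x. log_weight x * u x + ?H x * drv a u x)"
    unfolding drv_def[abs_def] by (simp only: euler_mult[OF sw tf_smooth[OF u]] log_weight_euler) (simp add: algebra_simps)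
  also have "ip \<dots> u = wI s (\<lambda>x. log_weight x * (u x)\<^sup>2) + ip (\<lambda>x. ?H x * u x) (drv a u)"
  proof -
    have "(\<lambda>x. (log_weight x * u x + ?H x * drv a u x) * u x) = (\<lambda>x. log_weight x * (u x * u x) + (?H x * u x) * drv a u x)"
      by (simp add: algebra_simps)
    moreover have "tf (\<lambda>x. log_weight x * (u x * u x))" by (intro tf_mult' tf_prod u log_weight_smooth)
    ultimately show ?thesis unfolding ip_def
      by (simp only: wI_add tf_prod[OF tH t(1)]) (simp add: power2_eq_square)
  qed
  finally have "wI s (\<lambda>x. log_weight x * (u x)\<^sup>2) = - 2 * ip (\<lambda>x. ?H x * u x) (drv a u)" by simp
  then have "(wI s (\<lambda>x. log_weight x * (u x)\<^sup>2))\<^sup>2 = 4 * (ip (\<lambda>x. ?H x * u x) (drv a u))\<^sup>2"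
    by (simp only: power_mult_distrib) simp
  also have "\<dots> \<le> 4 * (ip (\<lambda>x. ?H x * u x) (\<lambda>x. ?H x * u x) * ip (drv a u) (drv a u))"
    using ip_cauchy_schwarz[OF tH t(1)] by simp
  also have "ip (\<lambda>x. ?H x * u x) (\<lambda>x. ?H x * u x) \<le> ip u u"
    unfolding ip_def
  proof (rule wI_mono)
    show "?H x * u x * (?H x * u x) \<le> u x * u x" for x
    proof -
      have "?H x * ?H x \<le> 1" using bd[of x] abs_square_le_1[of "?H x"] by (simp add: power2_eq_square)
      then have "(?H x * ?H x) * (u x * u x) \<le> 1 * (u x * u x)" by (rule mult_right_mono) simp
      then show ?thesis by (simp add: algebra_simps)
    qed
  qed (intro tf_prod tH u)+
  finally show "(wI s (\<lambda>x. log_weight x * (u x)\<^sup>2))\<^sup>2 \<le> 4 * (ip u u * ip (drv a u) (drv a u))"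
    using ip_nonneg by (simp add: mult_right_mono)
  have "ip (drv a u) (drv a u) = - ip u (drv a (drv a u))" by (rule ip_drv[OF u t(1)])
  then show "(ip (drv a u) (drv a u))\<^sup>2 \<le> ip u u * ip (drv a (drv a u)) (drv a (drv a u))"
    using ip_cauchy_schwarz[OF u t(2)] by simp
qed

text \<open>For radial \<open>u\<close> all angular terms discarded in
  \<open>main_inequality\<close> vanish, so equality holds there; this is the source of
  sharpness.\<close>

lemma radial_identity:
  assumes u: "tf u" and rad: "\<And>b c. b \<in> Basis \<Longrightarrow> c \<in> Basis \<Longrightarrow> rot b c u = (\<lambda>x. 0)"
  defines "b \<equiv> a + s - 2"
  shows "wI s (\<lambda>x. ((norm x)\<^sup>2 * laplacian u x)\<^sup>2) + a ^ 4 * ip u u =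
    (a\<^sup>2 + b\<^sup>2) * wI s (\<lambda>x. (norm x)\<^sup>2 * (norm (grad u x))\<^sup>2) + ip (drv a (drv a u)) (drv a (drv a u))"
proof -
  have "sphlap u = (\<lambda>x. 0)"
    by (rule ext) (simp add: sphlap_def rad rot_def)
  then have 0: "ip (sphlap u) (sphlap u) = 0" by (simp add: ip_def wI_def)
  have 1: "gip u u = 0" by (simp add: gip_def rad ip_def wI_def)
  have "gip (drv a u) (drv a u) = 0"
    by (simp add: gip_def drv_rot tf_smooth u rad ip_def wI_def) (simp add: drv_def euler_def)
  with 0 1 show ?thesis
    unfolding gradient_identity[OF u] laplacian_identity[OF u]
    unfolding b_def by (simp add: power2_eq_square power4_eq_xxxx algebra_simps)
qed

end

subsection \<open>Weak derivatives and weighted square integrals\<close>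

text \<open>The affine map sends 0 and 1 to the thresholds 1 and 4 of \<open>cut\<close>.\<close>

definition ramp :: "real \<Rightarrow> real" where
  "ramp t = 1 - cut (3 * t + 1)"

lemma ramp_props: "0 \<le> ramp t" "ramp t \<le> 1" "t \<le> 0 \<Longrightarrow> ramp t = 0" "t \<ge> 1 \<Longrightarrow> ramp t = 1"
  by (auto simp: ramp_def cut_le cut_nonneg cut_one cut_zero)

lemma smooth_ramp: "smooth ramp"
  unfolding ramp_def[abs_def] by (intro smooth_diff smooth_const smooth_shift smooth_cut)

text \<open>Smooth approximation of the indicator of the open box from below; \<open>n\<close>
  steepens the flanks.\<close>

definition boxbump :: "'a::euclidean_space \<Rightarrow> 'a \<Rightarrow> nat \<Rightarrow> 'a \<Rightarrow> real" where
  "boxbump a b n x = (\<Prod>i\<in>Basis. ramp (real n * (x \<bullet> i - a \<bullet> i)) * ramp (real n * (b \<bullet> i - x \<bullet> i)))"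

lemma boxbump_bounds: "0 \<le> boxbump a b n x" "boxbump a b n x \<le> indicator (box a b) x"
proof -
  show 0: "0 \<le> boxbump a b n x" unfolding boxbump_def
    by (intro prod_nonneg) (auto simp: ramp_props)
  show "boxbump a b n x \<le> indicator (box a b) x"
  proof (cases "x \<in> box a b")
    case True
    have "boxbump a b n x \<le> (\<Prod>i\<in>(Basis::'a set). 1)"
      unfolding boxbump_def by (intro prod_mono) (auto simp: ramp_props intro!: mult_le_one)
    then show ?thesis using True by simp
  next
    case False
    then obtain i where i: "i \<in> Basis" "x \<bullet> i \<le> a \<bullet> i \<or> b \<bullet> i \<le> x \<bullet> i"
      by (force simp: mem_box)
    then have "ramp (real n * (x \<bullet> i - a \<bullet> i)) * ramp (real n * (b \<bullet> i - x \<bullet> i)) = 0"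
      by (auto simp: ramp_props mult_nonneg_nonpos)
    then have "boxbump a b n x = 0" unfolding boxbump_def
      using i(1) by (intro prod_zero) auto
    then show ?thesis by simp
  qed
qed

lemma boxbump_lim: "(\<lambda>n. boxbump a b n x) \<longlonglongrightarrow> indicator (box a b) x"
proof (cases "x \<in> box a b")
  case True
  have "(\<lambda>n. boxbump a b n x) \<longlonglongrightarrow> (\<Prod>i\<in>(Basis::'a set). 1 * 1)"
    unfolding boxbump_def
  proof (intro tendsto_prod tendsto_mult)
    fix i :: 'a assume i: "i \<in> Basis"
    have r: "(\<lambda>n. ramp (real n * d)) \<longlonglongrightarrow> 1" if d: "d > 0" for d
    proof (rule tendsto_eventually)
      obtain M where M: "1 / d \<le> real M" using real_arch_simple by blast
      have "ramp (real n * d) = 1" if "n \<ge> M" for n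
      proof -
        have "1 / d \<le> real n" using M that by linarith
        then show ?thesis using d by (intro ramp_props) (simp add: divide_le_eq)
      qed
      then show "\<forall>\<^sub>F n in sequentially. ramp (real n * d) = 1"
        unfolding eventually_sequentially by blast
    qed
    show "(\<lambda>n. ramp (real n * (x \<bullet> i - a \<bullet> i))) \<longlonglongrightarrow> 1" "(\<lambda>n. ramp (real n * (b \<bullet> i - x \<bullet> i))) \<longlonglongrightarrow> 1"
      using True i by (auto intro!: r simp: mem_box)
  qed
  then show ?thesis using True by simp
next
  case False
  then have "boxbump a b n x = 0" for n
    using boxbump_bounds[of a b n x] by simp
  then show ?thesis using False by simp
qed

lemma tf_boxbump: "tf (boxbump a b n)"
proof -
  have s: "smooth (\<lambda>x. ramp (real n * (x \<bullet> i - a \<bullet> i)))" "smooth (\<lambda>x. ramp (real n * (b \<bullet> i - x \<bullet> i)))" for i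
    by (rule smooth_compose[OF smooth_ramp]; intro smooth_intros)+
  have "smooth (boxbump a b n)"
    unfolding boxbump_def[abs_def] by (intro smooth_prod smooth_mult s)
  moreover obtain R where R: "\<And>x. x \<in> box a b \<Longrightarrow> norm x \<le> R"
    using bounded_box[of a b] by (auto simp: bounded_iff)
  have "norm x \<le> R" if "boxbump a b n x \<noteq> 0" for x
  proof (rule ccontr)
    assume "\<not> norm x \<le> R"
    then have "x \<notin> box a b" using R by blast
    then show False using boxbump_bounds[of a b n x] that by simp
  qed
  ultimately show ?thesis unfolding tf_def by blast
qed

section \<open>Uniqueness of weak derivatives\<close>

lemma locally_integrable_measurable:
  fixes f :: "'a::euclidean_space \<Rightarrow> 'b::euclidean_space"
  assumes "locally_integrable f"
  shows "f \<in> borel_measurable borel"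
proof (rule borel_measurable_LIMSEQ_metric)
  show "(\<lambda>x. indicator (cball 0 (real n)) x *\<^sub>R f x) \<in> borel_measurable borel" for n
  proof -
    have "set_integrable lborel (cball 0 (real n)) f"
      using assms by (simp add: locally_integrable_def)
    then show ?thesis unfolding set_integrable_def
      by (simp add: borel_measurable_integrable[unfolded measurable_lborel1])
  qed
  show "(\<lambda>n. indicator (cball 0 (real n)) x *\<^sub>R f x) \<longlonglongrightarrow> f x" for x :: 'a
  proof (rule tendsto_eventually)
    obtain M where M: "norm x \<le> real M" using real_arch_simple by blast
    have "indicator (cball 0 (real n)) x *\<^sub>R f x = f x" if "n \<ge> M" for n
      using M that by (simp add: order_trans[of "norm x" "real M"])
    then show "\<forall>\<^sub>F n in sequentially. indicator (cball 0 (real n)) x *\<^sub>R f x = f x"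
      unfolding eventually_sequentially by blast
  qed
qed

lemma locally_integrable_mult_tf:
  fixes f :: "'a::euclidean_space \<Rightarrow> real"
  assumes f: "locally_integrable f" and g: "tf g"
  shows "integrable lborel (\<lambda>x. f x * g x)"
proof -
  obtain C R where C: "C \<ge> 0" "\<And>x. \<bar>g x\<bar> \<le> C * indicator (cball 0 R) x" using tf_bounded[OF g] by metis
  have 1: "integrable lborel (\<lambda>x. C * (indicator (cball 0 R) x *\<^sub>R f x))"
    using f by (intro integrable_mult_right) (simp add: locally_integrable_def set_integrable_def)
  show ?thesis
  proof (rule Bochner_Integration.integrable_bound[OF 1])
    show "(\<lambda>x. f x * g x) \<in> borel_measurable lborel"
      using locally_integrable_measurable[OF f] tf_measurable[OF g] by simp
    show "AE x in lborel. norm (f x * g x) \<le> norm (C * (indicator (cball 0 R) x *\<^sub>R f x))"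
    proof (rule AE_I2)
      fix x
      have "\<bar>f x\<bar> * \<bar>g x\<bar> \<le> \<bar>f x\<bar> * (C * indicator (cball 0 R) x)"
        by (rule mult_left_mono[OF C(2)]) simp
      then show "norm (f x * g x) \<le> norm (C * (indicator (cball 0 R) x *\<^sub>R f x))"
        using C(1) by (simp add: abs_mult algebra_simps)
    qed
  qed
qed

text \<open>Testing with \<open>boxbump\<close> shows that \<open>h\<close> has integral 0 over
  every box. Its positive and negative parts are then densities of two measures that agree on boxes,
  an intersection-stable generator of the Borel sets, so the densities agree almost
  everywhere.\<close>

lemma variational_lemma:
  fixes h :: "'a::euclidean_space \<Rightarrow> real"
  assumes h: "locally_integrable h" and z: "\<And>\<phi>. tf \<phi> \<Longrightarrow> (\<integral>x. h x * \<phi> x \<partial>lborel) = 0"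
  shows "AE x in lborel. h x = 0"
proof -
  have hm: "h \<in> borel_measurable borel" by (rule locally_integrable_measurable[OF h])
  have ib: "integrable lborel (\<lambda>x. h x * indicator (box a b) x)" for a b
  proof -
    have "set_integrable lborel (cbox a b) h" using h by (simp add: locally_integrable_def)
    then have "set_integrable lborel (box a b) h"
      by (rule set_integrable_subset) (auto simp: box_subset_cbox)
    then show ?thesis by (simp add: set_integrable_def mult.commute)
  qed
  have zb: "(\<integral>x. h x * indicator (box a b) x \<partial>lborel) = 0" for a b
  proof -
    have "(\<lambda>n. \<integral>x. h x * boxbump a b n x \<partial>lborel) \<longlonglongrightarrow> (\<integral>x. h x * indicator (box a b) x \<partial>lborel)"
    proof (rule integral_dominated_convergence[OF _ _ integrable_abs[OF ib[of a b]]])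
      show "(\<lambda>x. h x * indicator (box a b) x) \<in> borel_measurable lborel" using hm by simp
      show "(\<lambda>x. h x * boxbump a b n x) \<in> borel_measurable lborel" for n
        using hm tf_measurable[OF tf_boxbump[of a b n]] by simp
      show "AE x in lborel. (\<lambda>n. h x * boxbump a b n x) \<longlonglongrightarrow> h x * indicator (box a b) x"
        by (intro AE_I2 tendsto_mult tendsto_const boxbump_lim)
      show "AE x in lborel. norm (h x * boxbump a b n x) \<le> \<bar>h x * indicator (box a b) x\<bar>" for n
        using boxbump_bounds[of a b n] by (intro AE_I2) (auto simp: abs_mult intro!: mult_left_mono)
    qed
    then show ?thesis by (simp add: z[OF tf_boxbump] LIMSEQ_const_iff)
  qed
  define p where "p x = max (h x) 0" for x
  define q where "q x = max (- h x) 0" for x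
  have pm: "p \<in> borel_measurable borel" and qm: "q \<in> borel_measurable borel"
    unfolding p_def[abs_def] q_def[abs_def] using hm by auto
  have ir: "integrable lborel (\<lambda>x. r x * indicator (box a b) x)"
    if "r \<in> borel_measurable borel" "\<And>x. \<bar>r x\<bar> \<le> \<bar>h x\<bar>" for r :: "'a \<Rightarrow> real" and a b
  proof (rule Bochner_Integration.integrable_bound[OF ib[of a b]])
    show "(\<lambda>x. r x * indicator (box a b) x) \<in> borel_measurable lborel" using that(1) by simp
    show "AE x in lborel. norm (r x * indicator (box a b) x) \<le> norm (h x * indicator (box a b) x)"
      using that(2) by (auto simp: abs_mult intro!: AE_I2 mult_right_mono)
  qed
  have ip: "integrable lborel (\<lambda>x. p x * indicator (box a b) x)"
    and iq: "integrable lborel (\<lambda>x. q x * indicator (box a b) x)" for a b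
    by (intro ir pm qm; simp add: p_def q_def)+
  have eq: "(\<integral>x. p x * indicator (box a b) x \<partial>lborel) = (\<integral>x. q x * indicator (box a b) x \<partial>lborel)" for a b
  proof -
    have "(\<integral>x. p x * indicator (box a b) x - q x * indicator (box a b) x \<partial>lborel) = (\<integral>x. h x * indicator (box a b) x \<partial>lborel)"
      by (intro Bochner_Integration.integral_cong refl) (auto simp: p_def q_def indicator_def)
    then show ?thesis using zb[of a b] ip iq by simp
  qed
  have em: "emeasure (density lborel (\<lambda>x. ennreal (r x))) (box a b) = ennreal (\<integral>x. r x * indicator (box a b) x \<partial>lborel)"
    if rm: "r \<in> borel_measurable borel" and i: "integrable lborel (\<lambda>x. r x * indicator (box a b) x)" and nn: "\<And>x. 0 \<le> r x"
    for r :: "'a \<Rightarrow> real" and a b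
  proof -
    have "emeasure (density lborel (\<lambda>x. ennreal (r x))) (box a b) = (\<integral>\<^sup>+x. ennreal (r x) * indicator (box a b) x \<partial>lborel)"
      using rm by (intro emeasure_density) auto
    also have "\<dots> = (\<integral>\<^sup>+x. ennreal (r x * indicator (box a b) x) \<partial>lborel)"
      by (intro nn_integral_cong) (auto simp: indicator_def)
    also have "\<dots> = ennreal (\<integral>x. r x * indicator (box a b) x \<partial>lborel)"
      using i nn by (intro nn_integral_eq_integral) (auto simp: indicator_def)
    finally show ?thesis .
  qed
  have p0: "0 \<le> p x" and q0: "0 \<le> q x" for x by (auto simp: p_def q_def)
  have "density lborel (\<lambda>x. ennreal (p x)) = density lborel (\<lambda>x. ennreal (q x))"
  proof (rule measure_eqI_generator_eq)
    let ?E = "range (\<lambda>(a, b). box a b::'a set)"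
    show "Int_stable ?E" by (auto simp: Int_stable_def box_Int_box)
    show "?E \<subseteq> Pow UNIV" "sets (density lborel (\<lambda>x. ennreal (p x))) = sigma_sets UNIV ?E"
       "sets (density lborel (\<lambda>x. ennreal (q x))) = sigma_sets UNIV ?E"
      by (simp_all add: borel_eq_box)
    let ?A = "\<lambda>n::nat. box (- (real n *\<^sub>R One)) (real n *\<^sub>R One) :: 'a set"
    show "range ?A \<subseteq> ?E" "(\<Union>i. ?A i) = UNIV" unfolding UN_box_eq_UNIV by auto
    show "emeasure (density lborel (\<lambda>x. ennreal (p x))) (?A i) \<noteq> \<infinity>" for i
      by (simp add: em pm ip p0)
    show "emeasure (density lborel (\<lambda>x. ennreal (p x))) X = emeasure (density lborel (\<lambda>x. ennreal (q x))) X" if "X \<in> ?E" for X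
      using that by (auto simp: em pm ip p0 qm iq q0 eq)
  qed
  then have "AE x in lborel. ennreal (p x) = ennreal (q x)"
    using pm qm by (subst (asm) sigma_finite_measure.density_unique_iff[OF lborel.sigma_finite_measure_axioms]) auto
  then show ?thesis
    by eventually_elim (auto simp: p_def q_def max_def split: if_splits)
qed

lemma locally_integrable_diff:
  "locally_integrable f \<Longrightarrow> locally_integrable g \<Longrightarrow> locally_integrable (\<lambda>x. f x - g x)"
  unfolding locally_integrable_def by (auto intro: set_integral_diff)

lemma locally_integrable_inner:
  fixes f :: "'a::euclidean_space \<Rightarrow> 'b::euclidean_space"
  assumes "locally_integrable f"
  shows "locally_integrable (\<lambda>x. f x \<bullet> b)"
  unfolding locally_integrable_def set_integrable_def
proof (intro allI impI)
  fix K :: "'a set" assume "compact K"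
  then have "integrable lborel (\<lambda>x. (indicator K x *\<^sub>R f x) \<bullet> b)"
    using assms by (intro integrable_inner_left) (simp add: locally_integrable_def set_integrable_def)
  then show "integrable lborel (\<lambda>x. indicator K x *\<^sub>R (f x \<bullet> b))" by simp
qed

text \<open>Any weak Laplacian gives the choice operator a witness, and two weak Laplacians differ
  by a function orthogonal to all test functions.\<close>

lemma weak_laplacian_unique:
  assumes "has_weak_laplacian u h"
  shows "AE x in lborel. weak_laplacian u x = h x"
proof -
  let ?k = "weak_laplacian u"
  have k: "has_weak_laplacian u ?k" unfolding weak_laplacian_def by (rule someI[where P="has_weak_laplacian u", OF assms])
  have li: "locally_integrable h" "locally_integrable ?k"
    using assms k by (auto simp: has_weak_laplacian_def)
  have "AE x in lborel. ?k x - h x = 0"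
  proof (rule variational_lemma)
    show "locally_integrable (\<lambda>x. ?k x - h x)" by (intro locally_integrable_diff li)
    fix \<phi> :: "'a \<Rightarrow> real" assume \<phi>: "tf \<phi>"
    have "(\<integral>x. ?k x * \<phi> x \<partial>lborel) = (\<integral>x. h x * \<phi> x \<partial>lborel)"
      using assms k \<phi> by (simp add: has_weak_laplacian_def test_function_tf)
    then show "(\<integral>x. (?k x - h x) * \<phi> x \<partial>lborel) = 0"
      using locally_integrable_mult_tf[OF li(1) \<phi>] locally_integrable_mult_tf[OF li(2) \<phi>]
      by (simp add: left_diff_distrib)
  qed
  then show ?thesis by simp
qed

lemma weak_gradient_unique:
  fixes u :: "'a::euclidean_space \<Rightarrow> real"
  assumes "has_weak_gradient u g"
  shows "AE x in lborel. weak_gradient u x = g x"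
proof -
  let ?k = "weak_gradient u"
  have k: "has_weak_gradient u ?k" unfolding weak_gradient_def by (rule someI[where P="has_weak_gradient u", OF assms])
  have li: "locally_integrable (\<lambda>x. g x \<bullet> b)" "locally_integrable (\<lambda>x. ?k x \<bullet> b)" for b
    using assms k by (auto simp: has_weak_gradient_def intro: locally_integrable_inner)
  have "AE x in lborel. ?k x \<bullet> b - g x \<bullet> b = 0" if b: "b \<in> Basis" for b
  proof (rule variational_lemma)
    show "locally_integrable (\<lambda>x. ?k x \<bullet> b - g x \<bullet> b)" by (intro locally_integrable_diff li)
    fix \<phi> :: "'a \<Rightarrow> real" assume \<phi>: "tf \<phi>"
    have "- (\<integral>x. (?k x \<bullet> b) * \<phi> x \<partial>lborel) = - (\<integral>x. (g x \<bullet> b) * \<phi> x \<partial>lborel)"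
      using assms k \<phi> b unfolding has_weak_gradient_def test_function_tf by metis
    then show "(\<integral>x. (?k x \<bullet> b - g x \<bullet> b) * \<phi> x \<partial>lborel) = 0"
      using locally_integrable_mult_tf[OF li(1) \<phi>] locally_integrable_mult_tf[OF li(2) \<phi>]
      by (simp add: left_diff_distrib)
  qed
  then have "AE x in lborel. \<forall>b\<in>Basis. ?k x \<bullet> b - g x \<bullet> b = 0"
    by (intro AE_finite_allI) auto
  then show ?thesis
    by eventually_elim (auto intro: euclidean_eqI)
qed

section \<open>Convergence and completeness for weighted square integrals\<close>

lemma weighted_int_cong_AE:
  assumes "AE x in lborel. f x = g x"
  shows "weighted_int s f = weighted_int s g"
  unfolding weighted_int_def
  by (rule nn_integral_cong_AE) (use assms in eventually_elim, auto)

lemma weighted_int_mono: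
  assumes "\<And>x. norm (f x) \<le> norm (g x)"
  shows "weighted_int s f \<le> weighted_int s g"
  unfolding weighted_int_def
  by (intro nn_integral_mono ennreal_leI divide_right_mono power_mono assms) auto

lemma weighted_measurable:
  fixes f :: "'a::euclidean_space \<Rightarrow> 'b::euclidean_space"
  assumes "f \<in> borel_measurable borel"
  shows "(\<lambda>x. ennreal ((norm (f x))\<^sup>2 / norm x powr s)) \<in> borel_measurable lborel"
  using assms by measurable

text \<open>Young's inequality with a parameter in place of Minkowski's: it works on squares with
  values in \<open>[0, \<infinity>]\<close> and needs no square roots there.\<close>

lemma weighted_int_triangle:
  fixes f g :: "'a::euclidean_space \<Rightarrow> 'b::euclidean_space"
  assumes fm: "f \<in> borel_measurable borel" and gm: "g \<in> borel_measurable borel" and t: "t > 0"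
  shows "weighted_int s f \<le> ennreal (1 + t) * weighted_int s g + ennreal (1 + 1 / t) * weighted_int s (\<lambda>x. f x - g x)"
proof -
  have d: "(\<lambda>x. f x - g x) \<in> borel_measurable borel" using fm gm by measurable
  have "weighted_int s f \<le> (\<integral>\<^sup>+x. ennreal (1 + t) * ennreal ((norm (g x))\<^sup>2 / norm x powr s)
      + ennreal (1 + 1 / t) * ennreal ((norm (f x - g x))\<^sup>2 / norm x powr s) \<partial>lborel)"
    unfolding weighted_int_def
  proof (rule nn_integral_mono)
    fix x :: 'a
    let ?w = "norm x powr s"
    have "norm (f x) \<le> norm (g x) + norm (f x - g x)" using norm_triangle_sub[of "f x" "g x"] by simp
    then have "(norm (f x))\<^sup>2 \<le> (norm (g x) + norm (f x - g x))\<^sup>2" by (intro power_mono) auto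
    also have "\<dots> \<le> (1 + t) * (norm (g x))\<^sup>2 + (1 + 1 / t) * (norm (f x - g x))\<^sup>2"
    proof -
      have "0 \<le> (t * norm (g x) - norm (f x - g x))\<^sup>2 / t" using t by simp
      also have "\<dots> = t * (norm (g x))\<^sup>2 - 2 * norm (g x) * norm (f x - g x) + (norm (f x - g x))\<^sup>2 / t"
        using t by (simp add: power2_eq_square field_simps)
      finally show ?thesis by (simp add: power2_sum algebra_simps)
    qed
    finally have "(norm (f x))\<^sup>2 / ?w \<le> ((1 + t) * (norm (g x))\<^sup>2 + (1 + 1 / t) * (norm (f x - g x))\<^sup>2) / ?w"
      by (rule divide_right_mono) simp
    then have "(norm (f x))\<^sup>2 / ?w \<le> (1 + t) * ((norm (g x))\<^sup>2 / ?w) + (1 + 1 / t) * ((norm (f x - g x))\<^sup>2 / ?w)"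
      by (simp add: add_divide_distrib)
    then show "ennreal ((norm (f x))\<^sup>2 / ?w) \<le> ennreal (1 + t) * ennreal ((norm (g x))\<^sup>2 / ?w)
      + ennreal (1 + 1 / t) * ennreal ((norm (f x - g x))\<^sup>2 / ?w)"
      using t by (simp add: ennreal_mult[symmetric] ennreal_plus[symmetric] del: ennreal_plus)
  qed
  also have "\<dots> = ennreal (1 + t) * weighted_int s g + ennreal (1 + 1 / t) * weighted_int s (\<lambda>x. f x - g x)"
    unfolding weighted_int_def
    using weighted_measurable[OF gm] weighted_measurable[OF d]
    by (subst nn_integral_add) (auto simp: nn_integral_cmult)
  finally show ?thesis .
qed

lemma weighted_int_diff_commute:
  "weighted_int s (\<lambda>x. f x - g x) = weighted_int s (\<lambda>x. g x - f x)"
  by (simp add: weighted_int_def norm_minus_commute)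

lemma weighted_int_tendsto:
  fixes f :: "nat \<Rightarrow> 'a::euclidean_space \<Rightarrow> 'b::euclidean_space"
  assumes fm: "\<And>n. f n \<in> borel_measurable borel" and gm: "g \<in> borel_measurable borel"
    and fin: "\<And>n. weighted_int s (f n) < \<infinity>"
    and lim: "(\<lambda>n. weighted_int s (\<lambda>x. f n x - g x)) \<longlonglongrightarrow> 0"
  shows "weighted_int s g < \<infinity>"
    and "(\<lambda>n. enn2real (weighted_int s (f n))) \<longlonglongrightarrow> enn2real (weighted_int s g)"
proof -
  have "\<forall>\<^sub>F n in sequentially. weighted_int s (\<lambda>x. f n x - g x) < 1"
    using lim by (rule order_tendstoD) simp
  then obtain n0 where n0: "weighted_int s (\<lambda>x. f n0 x - g x) < 1"
    by (auto simp: eventually_sequentially)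
  have "weighted_int s g \<le> ennreal (1 + 1) * weighted_int s (f n0) + ennreal (1 + 1 / 1) * weighted_int s (\<lambda>x. g x - f n0 x)"
    by (rule weighted_int_triangle[OF gm fm]) simp
  also have "\<dots> < \<infinity>"
    using fin[of n0] less_trans[OF n0 ennreal_one_less_top]
    by (auto simp: weighted_int_diff_commute[of s g] ennreal_mult_less_top)
  finally show gfin: "weighted_int s g < \<infinity>" .
  define a where "a n = enn2real (weighted_int s (f n))" for n
  define A where "A = enn2real (weighted_int s g)"
  define e where "e n = enn2real (weighted_int s (\<lambda>x. f n x - g x))" for n
  have an: "weighted_int s (f n) = ennreal (a n)" "0 \<le> a n" for n using fin[of n] by (auto simp: a_def)
  have An: "weighted_int s g = ennreal A" "0 \<le> A" using gfin by (auto simp: A_def)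
  have efin: "weighted_int s (\<lambda>x. f n x - g x) < \<infinity>" for n
  proof -
    have "weighted_int s (\<lambda>x. f n x - g x) \<le> ennreal (1 + 1) * weighted_int s (f n)
       + ennreal (1 + 1 / 1) * weighted_int s (\<lambda>x. (f n x - g x) - f n x)"
      by (rule weighted_int_triangle) (use fm[of n] gm in auto)
    also have "weighted_int s (\<lambda>x. (f n x - g x) - f n x) = weighted_int s g"
      by (simp add: weighted_int_def)
    finally show ?thesis using fin[of n] gfin by (auto simp: ennreal_mult_less_top elim!: le_less_trans)
  qed
  have en: "weighted_int s (\<lambda>x. f n x - g x) = ennreal (e n)" "0 \<le> e n" for n using efin[of n] by (auto simp: e_def)
  have e0: "e \<longlonglongrightarrow> 0"
    using tendsto_enn2real[of _ 0] lim by (simp add: e_def[abs_def])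
  \<comment> \<open>A parameter of order \<open>sqrt (e n)\<close> makes both \<open>t n\<close> and
    \<open>e n / t n\<close> tend to 0; the summand \<open>1 / real (Suc n)\<close> keeps it
    positive when \<open>e n\<close> is 0.\<close>
  define t where "t n = sqrt (e n) + 1 / real (Suc n)" for n
  have t: "t n > 0" "(1 + 1 / t n) * e n \<le> e n + sqrt (e n)" for n
  proof -
    show tp: "t n > 0" using en(2)[of n] by (auto simp: t_def intro!: add_nonneg_pos)
    have "e n = sqrt (e n) * sqrt (e n)" using en(2)[of n] by simp
    also have "\<dots> \<le> t n * sqrt (e n)" using en(2)[of n] by (intro mult_right_mono) (auto simp: t_def)
    finally have "e n / t n \<le> sqrt (e n)" using tp by (simp add: field_simps)
    then show "(1 + 1 / t n) * e n \<le> e n + sqrt (e n)" by (simp add: algebra_simps)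
  qed
  have "(\<lambda>n::nat. 1 / real (Suc n)) \<longlonglongrightarrow> 0" by (rule LIMSEQ_Suc[OF lim_inverse_n'[unfolded inverse_eq_divide]])
  then have t0: "t \<longlonglongrightarrow> sqrt 0 + 0" unfolding t_def[abs_def] by (intro tendsto_intros e0)
  have up: "a n \<le> (1 + t n) * A + (e n + sqrt (e n))" for n
  proof -
    have "ennreal (a n) \<le> ennreal (1 + t n) * ennreal A + ennreal (1 + 1 / t n) * ennreal (e n)"
      using weighted_int_triangle[OF fm[of n] gm t(1)[of n], of s] by (simp only: an An en)
    then have "a n \<le> (1 + t n) * A + (1 + 1 / t n) * e n"
      using t(1)[of n] an(2)[of n] An(2) en(2)[of n]
      by (simp add: ennreal_mult[symmetric] ennreal_plus[symmetric] del: ennreal_plus)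
    then show ?thesis using t(2)[of n] by linarith
  qed
  have lo: "(A - (e n + sqrt (e n))) / (1 + t n) \<le> a n" for n
  proof -
    have "ennreal A \<le> ennreal (1 + t n) * ennreal (a n) + ennreal (1 + 1 / t n) * ennreal (e n)"
      using weighted_int_triangle[OF gm fm[of n] t(1)[of n], of s] unfolding weighted_int_diff_commute[of s g]
      by (simp only: an An en)
    then have "A \<le> (1 + t n) * a n + (1 + 1 / t n) * e n"
      using t(1)[of n] an(2)[of n] An(2) en(2)[of n]
      by (simp add: ennreal_mult[symmetric] ennreal_plus[symmetric] del: ennreal_plus)
    then have "A - (e n + sqrt (e n)) \<le> a n * (1 + t n)" using t(2)[of n] by (simp add: algebra_simps)
    then show ?thesis using t(1)[of n] by (simp add: pos_divide_le_eq)
  qed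
  have "(\<lambda>n. (1 + t n) * A + (e n + sqrt (e n))) \<longlonglongrightarrow> (1 + (sqrt 0 + 0)) * A + (0 + sqrt 0)"
    by (intro tendsto_intros t0 e0)
  moreover have "(\<lambda>n. (A - (e n + sqrt (e n))) / (1 + t n)) \<longlonglongrightarrow> (A - (0 + sqrt 0)) / (1 + (sqrt 0 + 0))"
    by (intro tendsto_intros t0 e0) simp
  ultimately have "a \<longlonglongrightarrow> A"
    by (intro tendsto_sandwich[of "\<lambda>n. (A - (e n + sqrt (e n))) / (1 + t n)" a sequentially "\<lambda>n. (1 + t n) * A + (e n + sqrt (e n))"])
       (auto intro!: always_eventually lo up)
  then show "(\<lambda>n. enn2real (weighted_int s (f n))) \<longlonglongrightarrow> enn2real (weighted_int s g)"
    by (simp add: a_def[abs_def] A_def)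
qed

text \<open>The Riesz-Fischer argument: a rapidly Cauchy subsequence converges almost everywhere,
  and Fatou's lemma upgrades this to convergence of the whole sequence in the weighted norm.\<close>

lemma weighted_complete:
  fixes f :: "nat \<Rightarrow> 'a::euclidean_space \<Rightarrow> 'b::euclidean_space"
  assumes fm: "\<And>n. f n \<in> borel_measurable borel"
    and cauchy: "\<And>e. e > 0 \<Longrightarrow> \<exists>M. \<forall>m\<ge>M. \<forall>n\<ge>M. weighted_int s (\<lambda>x. f m x - f n x) < ennreal e"
  obtains g where "g \<in> borel_measurable borel" "(\<lambda>n. weighted_int s (\<lambda>x. f n x - g x)) \<longlonglongrightarrow> 0"
proof -
  have "\<forall>k. \<exists>M. \<forall>m\<ge>M. \<forall>n\<ge>M. weighted_int s (\<lambda>x. f m x - f n x) < ennreal ((1 / 16) ^ k)"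
    using cauchy by simp
  then obtain N where N: "\<And>k m n. m \<ge> N k \<Longrightarrow> n \<ge> N k \<Longrightarrow> weighted_int s (\<lambda>x. f m x - f n x) < ennreal ((1 / 16) ^ k)"
    by metis
  \<comment> \<open>The sum makes both \<open>r k\<close> and \<open>r (Suc k)\<close> at least
    \<open>N k\<close>, and the summand \<open>k\<close> makes the indices tend to infinity.\<close>
  define r where "r k = (\<Sum>j\<le>k. N j) + k" for k
  have rN: "r k \<ge> N k" for k unfolding r_def by (intro trans_le_add1 member_le_sum) auto
  have rS: "r (Suc k) \<ge> N k" for k
  proof -
    have "N k \<le> (\<Sum>j\<le>Suc k. N j)" by (intro member_le_sum) auto
    then show ?thesis unfolding r_def by linarith
  qed
  define d where "d k x = f (r (Suc k)) x - f (r k) x" for k x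
  have dm: "d k \<in> borel_measurable borel" for k unfolding d_def[abs_def] using fm by measurable
  \<comment> \<open>Against the bound \<open>(1 / 16) ^ k\<close> the factor \<open>4 ^ k\<close>
    leaves a convergent series. Where the sum of all \<open>F k x\<close> is finite,
    \<open>norm (d k x)\<close> is at most a constant times \<open>(1 / 2) ^ k\<close>, so the
    increments are summable.\<close>
  define F where "F k x = ennreal (4 ^ k) * ennreal ((norm (d k x))\<^sup>2 / norm x powr s)" for k x
  have Fm: "F k \<in> borel_measurable lborel" for k
    unfolding F_def[abs_def] using weighted_measurable[OF dm] by simp
  have "(\<integral>\<^sup>+x. (\<Sum>k. F k x) \<partial>lborel) = (\<Sum>k. \<integral>\<^sup>+x. F k x \<partial>lborel)"
    by (rule nn_integral_suminf) (rule Fm)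
  also have "\<dots> \<le> (\<Sum>k. ennreal ((1 / 4) ^ k))"
  proof (rule suminf_le)
    fix k
    have "(\<integral>\<^sup>+x. F k x \<partial>lborel) = ennreal (4 ^ k) * weighted_int s (d k)"
      unfolding F_def weighted_int_def using weighted_measurable[OF dm] by (simp add: nn_integral_cmult)
    also have "\<dots> \<le> ennreal (4 ^ k) * ennreal ((1 / 16) ^ k)"
      unfolding d_def[abs_def] using N[OF rS rN, of k] by (intro mult_left_mono) (auto simp: less_imp_le)
    also have "\<dots> = ennreal ((1 / 4) ^ k)"
      by (simp add: ennreal_mult[symmetric] power_mult_distrib[symmetric])
    finally show "(\<integral>\<^sup>+x. F k x \<partial>lborel) \<le> ennreal ((1 / 4) ^ k)" .
  qed auto
  also have "\<dots> < \<infinity>"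
    by (subst suminf_ennreal2) (auto intro!: summable_geometric)
  finally have "AE x in lborel. (\<Sum>k. F k x) \<noteq> \<infinity>"
    using Fm by (intro nn_integral_PInf_AE) (auto simp: less_top)
  moreover have "AE x::'a in lborel. x \<noteq> 0" by (rule AE_lborel_singleton)
  ultimately have conv: "AE x in lborel. convergent (\<lambda>k. f (r k) x)"
  proof eventually_elim
    case (elim x)
    define C where "C = enn2real (\<Sum>k. F k x)"
    have C: "(\<Sum>k. F k x) = ennreal C" "C \<ge> 0" using elim(1) by (auto simp: C_def less_top)
    have w: "norm x powr s > 0" using elim(2) by simp
    have bd: "norm (d k x) \<le> sqrt (C * norm x powr s) * (1 / 2) ^ k" for k
    proof -
      have "F k x \<le> (\<Sum>k. F k x)"
        using sum_le_suminf[of "\<lambda>k. F k x" "{k}"] by simp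
      moreover have "F k x = ennreal (4 ^ k * ((norm (d k x))\<^sup>2 / norm x powr s))"
        unfolding F_def by (rule ennreal_mult[symmetric]) auto
      ultimately have "ennreal (4 ^ k * ((norm (d k x))\<^sup>2 / norm x powr s)) \<le> ennreal C"
        unfolding C by simp
      then have "4 ^ k * ((norm (d k x))\<^sup>2 / norm x powr s) \<le> C" using C(2) by (simp add: ennreal_le_iff)
      then have "4 ^ k * (norm (d k x))\<^sup>2 \<le> C * norm x powr s" using w by (simp add: field_simps)
      moreover have "4 ^ k * (norm (d k x))\<^sup>2 = (2 ^ k * norm (d k x))\<^sup>2"
        by (simp add: power_mult_distrib power_mult[symmetric] mult.commute[of k] power_mult)
      ultimately have "2 ^ k * norm (d k x) \<le> sqrt (C * norm x powr s)"
        by (metis real_le_rsqrt)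
      then show ?thesis by (simp add: field_simps power_one_over)
    qed
    have "summable (\<lambda>k. sqrt (C * norm x powr s) * (1 / 2) ^ k)"
      by (intro summable_mult summable_geometric) simp
    then have "summable (\<lambda>k. d k x)"
      by (rule summable_comparison_test'[where N=0]) (rule bd)
    then have "(\<lambda>n. (\<Sum>k<n. d k x)) \<longlonglongrightarrow> (\<Sum>k. d k x)" by (rule summable_LIMSEQ)
    then have "(\<lambda>n. f (r n) x - f (r 0) x) \<longlonglongrightarrow> (\<Sum>k. d k x)"
      unfolding d_def using sum_lessThan_telescope[of "\<lambda>k. f (r k) x"] by simp
    then have "(\<lambda>n. (f (r n) x - f (r 0) x) + f (r 0) x) \<longlonglongrightarrow> (\<Sum>k. d k x) + f (r 0) x"
      by (intro tendsto_add tendsto_const)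
    then show ?case by (auto simp: convergent_def)
  qed
  define g where "g x = lim (\<lambda>k. f (r k) x)" for x
  have gm: "g \<in> borel_measurable borel" unfolding g_def[abs_def] using fm by measurable
  have "(\<lambda>n. weighted_int s (\<lambda>x. f n x - g x)) \<longlonglongrightarrow> 0"
  proof (rule order_tendstoI)
    fix e :: ennreal assume "0 < e"
    then obtain e' :: real where e': "0 < e'" "ennreal e' < e"
    proof (cases e)
      case (real e'')
      with \<open>0 < e\<close> show ?thesis by (intro that[of "e'' / 2"]) (auto simp: ennreal_less_iff)
    next
      case top then show ?thesis by (intro that[of 1]) auto
    qed
    obtain M where M: "\<And>m n. m \<ge> M \<Longrightarrow> n \<ge> M \<Longrightarrow> weighted_int s (\<lambda>x. f m x - f n x) < ennreal e'"
      using cauchy[OF e'(1)] by blast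
    \<comment> \<open>Fatou along the subsequence: the Cauchy bound between \<open>f n\<close> and
      \<open>f (r k)\<close> survives the limit in \<open>k\<close>.\<close>
    have "weighted_int s (\<lambda>x. f n x - g x) < e" if n: "n \<ge> M" for n
    proof -
      let ?h = "\<lambda>k x. ennreal ((norm (f n x - f (r k) x))\<^sup>2 / norm x powr s)"
      have "weighted_int s (\<lambda>x. f n x - g x) \<le> (\<integral>\<^sup>+x. liminf (\<lambda>k. ?h k x) \<partial>lborel)"
        unfolding weighted_int_def
      proof (rule nn_integral_mono_AE)
        show "AE x in lborel. ennreal ((norm (f n x - g x))\<^sup>2 / norm x powr s) \<le> liminf (\<lambda>k. ?h k x)"
          using conv AE_lborel_singleton[of 0]
        proof eventually_elim
          case (elim x)
          have "(\<lambda>k. f (r k) x) \<longlonglongrightarrow> g x" using elim(1) by (simp add: g_def convergent_LIMSEQ_iff)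
          then have "(\<lambda>k. ?h k x) \<longlonglongrightarrow> ennreal ((norm (f n x - g x))\<^sup>2 / norm x powr s)"
            using elim(2) by (intro tendsto_intros) auto
          then show ?case using lim_imp_Liminf[OF sequentially_bot] by fastforce
        qed
      qed
      also have "\<dots> \<le> liminf (\<lambda>k. \<integral>\<^sup>+x. ?h k x \<partial>lborel)"
      proof (rule nn_integral_liminf)
        fix k
        have "(\<lambda>x. f n x - f (r k) x) \<in> borel_measurable borel" using fm by measurable
        then show "?h k \<in> borel_measurable lborel" by (rule weighted_measurable)
      qed
      also have "\<dots> \<le> limsup (\<lambda>k. \<integral>\<^sup>+x. ?h k x \<partial>lborel)" by (rule Liminf_le_Limsup) simp
      also have "\<dots> \<le> ennreal e'"
      proof (rule Limsup_bounded)
        have "(\<integral>\<^sup>+x. ?h k x \<partial>lborel) \<le> ennreal e'" if "k \<ge> M" for k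
        proof -
          have "r k \<ge> M" using that by (simp add: r_def)
          from M[OF n this] show ?thesis unfolding weighted_int_def by simp
        qed
        then show "\<forall>\<^sub>F k in sequentially. (\<integral>\<^sup>+x. ?h k x \<partial>lborel) \<le> ennreal e'"
          unfolding eventually_sequentially by blast
      qed
      finally show ?thesis using e'(2) by (rule le_less_trans)
    qed
    then show "\<forall>\<^sub>F n in sequentially. weighted_int s (\<lambda>x. f n x - g x) < e"
      unfolding eventually_sequentially by blast
  qed simp
  with gm show ?thesis by (rule that)
qed

lemma weighted_cauchy_schwarz:
  fixes f g :: "'a::euclidean_space \<Rightarrow> real"
  assumes fm: "f \<in> borel_measurable borel" and gm: "g \<in> borel_measurable borel"
  shows "(\<integral>\<^sup>+x. ennreal \<bar>f x * g x\<bar> \<partial>lborel)\<^sup>2 \<le> weighted_int s f * (\<integral>\<^sup>+x. ennreal (norm x powr s * (g x)\<^sup>2) \<partial>lborel)"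
proof -
  define w where "w x = norm x powr (s / 2)" for x :: 'a
  have wm: "w \<in> borel_measurable borel" unfolding w_def[abs_def] by measurable
  have w0: "0 \<le> w x" for x by (simp add: w_def)
  have w2: "(w x)\<^sup>2 = norm x powr s" for x unfolding w_def power2_eq_square by (simp add: powr_add[symmetric])
  have "(\<integral>\<^sup>+x. ennreal \<bar>f x * g x\<bar> \<partial>lborel) = (\<integral>\<^sup>+x. ennreal (\<bar>f x\<bar> / w x) * ennreal (w x * \<bar>g x\<bar>) \<partial>lborel)"
  proof (rule nn_integral_cong_AE)
    show "AE x in lborel. ennreal \<bar>f x * g x\<bar> = ennreal (\<bar>f x\<bar> / w x) * ennreal (w x * \<bar>g x\<bar>)"
      using AE_lborel_singleton[of 0]
      by eventually_elim (auto simp: w_def ennreal_mult[symmetric] abs_mult)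
  qed
  also have "\<dots>\<^sup>2 \<le> (\<integral>\<^sup>+x. (ennreal (\<bar>f x\<bar> / w x))\<^sup>2 \<partial>lborel) * (\<integral>\<^sup>+x. (ennreal (w x * \<bar>g x\<bar>))\<^sup>2 \<partial>lborel)"
    by (rule Cauchy_Schwarz_nn_integral) (use fm gm wm in auto)
  also have "(\<integral>\<^sup>+x. (ennreal (\<bar>f x\<bar> / w x))\<^sup>2 \<partial>lborel) = weighted_int s f"
    unfolding weighted_int_def
    by (intro nn_integral_cong) (simp add: ennreal_power power_divide w2 w0)
  also have "(\<integral>\<^sup>+x. (ennreal (w x * \<bar>g x\<bar>))\<^sup>2 \<partial>lborel) = (\<integral>\<^sup>+x. ennreal (norm x powr s * (g x)\<^sup>2) \<partial>lborel)"
    by (intro nn_integral_cong) (simp add: w0 ennreal_power power_mult_distrib w2)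
  finally show ?thesis .
qed

text \<open>\<open>|x|^s\<close> is the weight dual to \<open>|x|^-s\<close> in Cauchy-Schwarz. It
  is singular for negative \<open>s\<close>, as happens for \<open>s = \<gamma>\<close>, and the
  hypothesis is its local integrability.\<close>

lemma tf_weight_finite:
  fixes g :: "'a::euclidean_space \<Rightarrow> real"
  assumes "tf g" "- s < real DIM('a)"
  shows "(\<integral>\<^sup>+x. ennreal (norm x powr s * (g x)\<^sup>2) \<partial>lborel) < \<infinity>"
proof -
  have "integrable lborel (\<lambda>x. norm x powr (- (- s)) * (g x * g x))"
    by (rule tf_integrable_powr[OF tf_prod[OF assms(1) assms(1)] assms(2)])
  then show ?thesis
    by (subst nn_integral_eq_integral) (auto simp: power2_eq_square)
qed

lemma weighted_int_integrable_tf: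
  fixes f g :: "'a::euclidean_space \<Rightarrow> real"
  assumes fm: "f \<in> borel_measurable borel" and fin: "weighted_int s f < \<infinity>"
    and g: "tf g" and s: "- s < real DIM('a)"
  shows "integrable lborel (\<lambda>x. f x * g x)"
proof (rule integrableI_bounded)
  have gm: "g \<in> borel_measurable borel" by (rule tf_measurable[OF g])
  show "(\<lambda>x. f x * g x) \<in> borel_measurable lborel" using fm gm by simp
  have "(\<integral>\<^sup>+x. ennreal \<bar>f x * g x\<bar> \<partial>lborel)\<^sup>2 < \<infinity>"
    using weighted_cauchy_schwarz[OF fm gm, of s] ennreal_mult_less_top fin tf_weight_finite[OF g s]
    by (auto elim!: le_less_trans)
  then show "(\<integral>\<^sup>+x. ennreal (norm (f x * g x)) \<partial>lborel) < \<infinity>"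
    by (cases "(\<integral>\<^sup>+x. ennreal \<bar>f x * g x\<bar> \<partial>lborel) = top") (auto simp: less_top power2_eq_square ennreal_mult_eq_top_iff)
qed

lemma weighted_int_locally_integrable_real:
  fixes f :: "'a::euclidean_space \<Rightarrow> real"
  assumes fm: "f \<in> borel_measurable borel" and fin: "weighted_int s f < \<infinity>"
    and s: "- s < real DIM('a)"
  shows "locally_integrable f"
  unfolding locally_integrable_def
proof (intro allI impI)
  fix K :: "'a set" assume K: "compact K"
  then obtain R where R: "R > 0" "\<And>x. x \<in> K \<Longrightarrow> norm x \<le> R"
    using compact_imp_bounded bounded_pos by metis
  define a where "a = 1 / R\<^sup>2"
  have a: "a > 0" using R(1) by (simp add: a_def)
  have 1: "cut (a * (norm x)\<^sup>2) = 1" if "x \<in> K" for x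
    using power_mono[OF R(2)[OF that], of 2] R(1) by (intro cut_one) (simp add: a_def divide_le_eq)
  have i: "integrable lborel (\<lambda>x. f x * cut (a * (norm x)\<^sup>2))"
    by (rule weighted_int_integrable_tf[OF fm fin tf_cut[OF a] s])
  show "set_integrable lborel K f" unfolding set_integrable_def
  proof (rule Bochner_Integration.integrable_bound[OF i])
    show "(\<lambda>x. indicator K x *\<^sub>R f x) \<in> borel_measurable lborel"
      using fm K by (intro borel_measurable_scaleR borel_measurable_indicator) (auto simp: compact_imp_closed)
    show "AE x in lborel. norm (indicator K x *\<^sub>R f x) \<le> norm (f x * cut (a * (norm x)\<^sup>2))"
      using 1 by (intro AE_I2) (auto simp: indicator_def)
  qed
qed

lemma weighted_int_locally_integrable:
  fixes f :: "'a::euclidean_space \<Rightarrow> 'b::euclidean_space"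
  assumes fm: "f \<in> borel_measurable borel" and fin: "weighted_int s f < \<infinity>"
    and s: "- s < real DIM('a)"
  shows "locally_integrable f"
proof -
  have "weighted_int s (\<lambda>x. norm (f x)) < \<infinity>" using fin by (simp add: weighted_int_def)
  then have 1: "locally_integrable (\<lambda>x. norm (f x))"
    by (intro weighted_int_locally_integrable_real[OF _ _ s]) (use fm in auto)
  show ?thesis unfolding locally_integrable_def
  proof (intro allI impI)
    fix K :: "'a set" assume K: "compact K"
    then have i: "integrable lborel (\<lambda>x. indicator K x *\<^sub>R norm (f x))"
      using 1 by (simp add: locally_integrable_def set_integrable_def)
    show "set_integrable lborel K f" unfolding set_integrable_def
    proof (rule Bochner_Integration.integrable_bound[OF i])
      show "(\<lambda>x. indicator K x *\<^sub>R f x) \<in> borel_measurable lborel"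
        using fm K by (intro borel_measurable_scaleR borel_measurable_indicator) (auto simp: compact_imp_closed)
    qed auto
  qed
qed

text \<open>Weighted convergence implies convergence of the pairings with test functions, so the
  identities defining weak derivatives pass to the limit.\<close>

lemma weighted_int_test_tendsto:
  fixes f :: "nat \<Rightarrow> 'a::euclidean_space \<Rightarrow> real"
  assumes fm: "\<And>n. f n \<in> borel_measurable borel" and hm: "h \<in> borel_measurable borel"
    and fin: "\<And>n. weighted_int s (f n) < \<infinity>" "weighted_int s h < \<infinity>"
    and lim: "(\<lambda>n. weighted_int s (\<lambda>x. f n x - h x)) \<longlonglongrightarrow> 0"
    and g: "tf g" and s: "- s < real DIM('a)"
  shows "(\<lambda>n. \<integral>x. f n x * g x \<partial>lborel) \<longlonglongrightarrow> (\<integral>x. h x * g x \<partial>lborel)"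
proof -
  have gm: "g \<in> borel_measurable borel" by (rule tf_measurable[OF g])
  define K where "K = (\<integral>\<^sup>+x. ennreal (norm x powr s * (g x)\<^sup>2) \<partial>lborel)"
  have K: "K < \<infinity>" unfolding K_def by (rule tf_weight_finite[OF g s])
  have i: "integrable lborel (\<lambda>x. f n x * g x)" for n by (rule weighted_int_integrable_tf[OF fm fin(1) g s])
  have j: "integrable lborel (\<lambda>x. h x * g x)" by (rule weighted_int_integrable_tf[OF hm fin(2) g s])
  have "(\<lambda>n. weighted_int s (\<lambda>x. f n x - h x) * K) \<longlonglongrightarrow> 0 * K"
    using K by (intro tendsto_mult_ennreal lim tendsto_const) auto
  then have "(\<lambda>n. enn2real (weighted_int s (\<lambda>x. f n x - h x) * K)) \<longlonglongrightarrow> 0"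
    using tendsto_enn2real[of _ 0] by simp
  then have z: "(\<lambda>n. sqrt (enn2real (weighted_int s (\<lambda>x. f n x - h x) * K))) \<longlonglongrightarrow> 0"
    using tendsto_real_sqrt by fastforce
  have fK: "\<forall>\<^sub>F n in sequentially. weighted_int s (\<lambda>x. f n x - h x) < 1"
    using lim by (rule order_tendstoD) simp
  have "\<forall>\<^sub>F n in sequentially. norm ((\<integral>x. f n x * g x \<partial>lborel) - (\<integral>x. h x * g x \<partial>lborel))
     \<le> sqrt (enn2real (weighted_int s (\<lambda>x. f n x - h x) * K))"
    using fK
  proof eventually_elim
    case (elim n)
    have dm: "(\<lambda>x. f n x - h x) \<in> borel_measurable borel" using fm hm by measurable
    have ij: "integrable lborel (\<lambda>x. (f n x - h x) * g x)" using i j by (simp add: left_diff_distrib)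
    define y where "y = (\<integral>x. \<bar>(f n x - h x) * g x\<bar> \<partial>lborel)"
    have y0: "y \<ge> 0" by (simp add: y_def)
    have "ennreal y = (\<integral>\<^sup>+x. ennreal \<bar>(f n x - h x) * g x\<bar> \<partial>lborel)"
      unfolding y_def using ij by (intro nn_integral_eq_integral[symmetric]) auto
    then have "ennreal (y\<^sup>2) \<le> weighted_int s (\<lambda>x. f n x - h x) * K"
      using weighted_cauchy_schwarz[OF dm gm, of s] ennreal_power[OF y0, of 2] unfolding K_def by simp
    moreover have "weighted_int s (\<lambda>x. f n x - h x) * K < top"
      using K elim by (auto simp: ennreal_mult_less_top intro: less_trans)
    ultimately have "y\<^sup>2 \<le> enn2real (weighted_int s (\<lambda>x. f n x - h x) * K)"
      using y0 by (metis enn2real_ennreal enn2real_mono zero_le_power2)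
    then have "y \<le> sqrt (enn2real (weighted_int s (\<lambda>x. f n x - h x) * K))" by (rule real_le_rsqrt)
    moreover have "(\<integral>x. f n x * g x \<partial>lborel) - (\<integral>x. h x * g x \<partial>lborel) = (\<integral>x. (f n x - h x) * g x \<partial>lborel)"
      using i j by (simp add: left_diff_distrib)
    moreover have "norm (\<integral>x. (f n x - h x) * g x \<partial>lborel) \<le> y"
      unfolding y_def using integral_norm_bound[of lborel "\<lambda>x. (f n x - h x) * g x"] by simp
    ultimately show ?case by simp
  qed
  then have "(\<lambda>n. (\<integral>x. f n x * g x \<partial>lborel) - (\<integral>x. h x * g x \<partial>lborel)) \<longlonglongrightarrow> 0"
    by (rule Lim_null_comparison) (rule z)
  then show ?thesis by (rule LIM_zero_cancel)
qed

section \<open>Test functions and their weak derivatives\<close>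

lemma laplacian_diff: "smooth f \<Longrightarrow> smooth g \<Longrightarrow> laplacian (\<lambda>x. f x - g x) = (\<lambda>x. laplacian f x - laplacian g x)"
  by (rule ext) (simp add: laplacian_def smooth_pd_diff smooth_intros sum_subtractf)

lemma grad_diff: "smooth f \<Longrightarrow> smooth g \<Longrightarrow> grad (\<lambda>x. f x - g x) = (\<lambda>x. grad f x - grad g x)"
  by (rule ext) (simp add: grad_def smooth_pd_diff scaleR_left_diff_distrib sum_subtractf)

lemma grad_inner: "b \<in> Basis \<Longrightarrow> grad f x \<bullet> b = pd b f x"
  by (simp add: grad_def inner_sum_left sum_inner_Basis)

lemma grad_measurable: "tf f \<Longrightarrow> grad f \<in> borel_measurable borel"
  unfolding grad_def[abs_def]
  by (intro borel_measurable_sum borel_measurable_scaleR tf_measurable tf_pd) auto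

lemma integral_by_parts:
  assumes f: "tf f" and g: "smooth g" and b: "b \<in> Basis"
  shows "(\<integral>x. f x * pd b g x \<partial>lborel) = - (\<integral>x. pd b f x * g x \<partial>lborel)"
proof -
  have "0 = (\<integral>x. pd b (\<lambda>x. f x * g x) x \<partial>lborel)"
    by (rule integral_pd[OF tf_mult[OF f g] b, symmetric])
  also have "pd b (\<lambda>x. f x * g x) = (\<lambda>x. f x * pd b g x + pd b f x * g x)"
    by (rule smooth_pd_mult[OF tf_smooth[OF f] g])
  also have "(\<integral>x. f x * pd b g x + pd b f x * g x \<partial>lborel) =
      (\<integral>x. f x * pd b g x \<partial>lborel) + (\<integral>x. pd b f x * g x \<partial>lborel)"
    by (intro Bochner_Integration.integral_add tf_integrable tf_mult tf_pd f g b smooth_pd)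
  finally show ?thesis by simp
qed

lemma integral_laplacian_parts:
  assumes f: "tf f" and g: "tf g"
  shows "(\<integral>x. f x * laplacian g x \<partial>lborel) = (\<integral>x. laplacian f x * g x \<partial>lborel)"
proof -
  have sg: "smooth g" by (rule tf_smooth[OF g])
  have "(\<integral>x. f x * laplacian g x \<partial>lborel) = (\<Sum>b\<in>Basis. \<integral>x. f x * pd b (pd b g) x \<partial>lborel)"
    unfolding laplacian_def sum_distrib_left
    by (intro Bochner_Integration.integral_sum tf_integrable tf_mult f smooth_pd sg)
  also have "\<dots> = (\<Sum>b\<in>Basis. \<integral>x. pd b (pd b f) x * g x \<partial>lborel)"
    by (intro sum.cong refl) (simp add: integral_by_parts f sg smooth_pd tf_pd)
  also have "\<dots> = (\<integral>x. laplacian f x * g x \<partial>lborel)"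
    unfolding laplacian_def sum_distrib_right
    by (intro Bochner_Integration.integral_sum[symmetric] tf_integrable tf_mult f tf_pd sg)
  finally show ?thesis .
qed

lemma tf_locally_integrable:
  fixes f :: "'a::euclidean_space \<Rightarrow> real"
  assumes "tf f" shows "locally_integrable f"
  unfolding locally_integrable_def set_integrable_def
proof (intro allI impI)
  fix K :: "'a set" assume "compact K"
  then show "integrable lborel (\<lambda>x. indicator K x *\<^sub>R f x)"
    by (intro integrable_mult_indicator tf_integrable assms) (auto simp: compact_imp_closed)
qed

lemma tf_has_weak_laplacian: "tf f \<Longrightarrow> has_weak_laplacian f (laplacian f)"
  unfolding has_weak_laplacian_def test_function_tf
  by (intro conjI allI impI tf_locally_integrable tf_laplacian integral_laplacian_parts)

lemma tf_has_weak_gradient: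
  fixes f :: "'a::euclidean_space \<Rightarrow> real"
  assumes f: "tf f" shows "has_weak_gradient f (grad f)"
  unfolding has_weak_gradient_def test_function_tf
proof (intro conjI allI impI ballI)
  show "locally_integrable f" by (rule tf_locally_integrable[OF f])
  show "locally_integrable (grad f)"
    unfolding locally_integrable_def set_integrable_def
  proof (intro allI impI)
    fix K :: "'a set" assume K: "compact K"
    have "integrable lborel (grad f)"
      unfolding grad_def[abs_def] by (intro Bochner_Integration.integrable_sum integrable_scaleR_left tf_integrable tf_pd f)
    then show "integrable lborel (\<lambda>x. indicator K x *\<^sub>R grad f x)"
      using K by (intro integrable_mult_indicator) (auto simp: compact_imp_closed)
  qed
  fix \<phi> :: "'a \<Rightarrow> real" and b :: 'a assume "tf \<phi>" "b \<in> Basis"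
  then show "(\<integral>x. f x * pd b \<phi> x \<partial>lborel) = - (\<integral>x. (grad f x \<bullet> b) * \<phi> x \<partial>lborel)"
    by (simp add: integral_by_parts f tf_smooth grad_inner)
qed

lemma tf_D22:
  assumes f: "tf f" shows "f \<in> D22 \<gamma>"
proof -
  have "D22_norm \<gamma> (\<lambda>x. f x - f x) = 0"
    by (simp add: D22_norm_def laplacian_def)
  then show ?thesis unfolding D22_def using f
    by (auto simp: tf_locally_integrable test_function_tf intro!: exI[of _ "\<lambda>_. f"])
qed

lemma local_L1_test_tendsto:
  fixes f :: "nat \<Rightarrow> 'a::euclidean_space \<Rightarrow> real"
  assumes f: "\<And>n. tf (f n)" and u: "locally_integrable u" and g: "tf g"
    and lim: "\<And>K. compact K \<Longrightarrow> (\<lambda>n. LINT x:K|lborel. \<bar>f n x - u x\<bar>) \<longlonglongrightarrow> 0"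
  shows "(\<lambda>n. \<integral>x. f n x * g x \<partial>lborel) \<longlonglongrightarrow> (\<integral>x. u x * g x \<partial>lborel)"
proof -
  obtain C R where C: "C \<ge> 0" "\<And>x. \<bar>g x\<bar> \<le> C * indicator (cball 0 R) x" using tf_bounded[OF g] by metis
  let ?K = "cball 0 R :: 'a set"
  have li: "locally_integrable (\<lambda>x. f n x - u x)" for n
    by (intro locally_integrable_diff tf_locally_integrable f u)
  have "(\<lambda>n. C * (LINT x:?K|lborel. \<bar>f n x - u x\<bar>)) \<longlonglongrightarrow> C * 0"
    by (intro tendsto_intros lim) simp
  then have z: "(\<lambda>n. C * (LINT x:?K|lborel. \<bar>f n x - u x\<bar>)) \<longlonglongrightarrow> 0" by simp
  have "norm ((\<integral>x. f n x * g x \<partial>lborel) - (\<integral>x. u x * g x \<partial>lborel)) \<le> C * (LINT x:?K|lborel. \<bar>f n x - u x\<bar>)" for n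
  proof -
    have i: "integrable lborel (\<lambda>x. (f n x - u x) * g x)" by (rule locally_integrable_mult_tf[OF li g])
    have "set_integrable lborel ?K (\<lambda>x. f n x - u x)"
      using li[of n] by (simp add: locally_integrable_def)
    then have j: "integrable lborel (\<lambda>x. C * (indicator ?K x *\<^sub>R \<bar>f n x - u x\<bar>))"
      by (intro integrable_mult_right) (use set_integrable_abs in \<open>auto simp: set_integrable_def\<close>)
    have "(\<integral>x. f n x * g x \<partial>lborel) - (\<integral>x. u x * g x \<partial>lborel) = (\<integral>x. (f n x - u x) * g x \<partial>lborel)"
      using locally_integrable_mult_tf[OF u g] locally_integrable_mult_tf[OF tf_locally_integrable[OF f] g, of n]
      by (simp add: left_diff_distrib)
    also have "norm \<dots> \<le> (\<integral>x. norm ((f n x - u x) * g x) \<partial>lborel)" by (rule integral_norm_bound)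
    also have "\<dots> \<le> (\<integral>x. C * (indicator ?K x *\<^sub>R \<bar>f n x - u x\<bar>) \<partial>lborel)"
    proof (rule integral_mono[OF integrable_norm[OF i] j])
      fix x
      have "\<bar>f n x - u x\<bar> * \<bar>g x\<bar> \<le> \<bar>f n x - u x\<bar> * (C * indicator ?K x)"
        by (rule mult_left_mono[OF C(2)]) simp
      then show "norm ((f n x - u x) * g x) \<le> C * (indicator ?K x *\<^sub>R \<bar>f n x - u x\<bar>)"
        by (simp add: abs_mult ac_simps)
    qed
    finally show ?thesis by (simp add: set_lebesgue_integral_def)
  qed
  then have "(\<lambda>n. (\<integral>x. f n x * g x \<partial>lborel) - (\<integral>x. u x * g x \<partial>lborel)) \<longlonglongrightarrow> 0"
    by (intro Lim_null_comparison[OF always_eventually z]) simp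
  then show ?thesis by (rule LIM_zero_cancel)
qed

text \<open>The bridge from integrals with values in \<open>[0, \<infinity>]\<close> to the real
  integral \<open>wI\<close>. The integrands are compared off the origin only: that point is null,
  and there \<open>powr\<close> and division take default values.\<close>

lemma weighted_int_wI:
  fixes f :: "'a::euclidean_space \<Rightarrow> 'b::euclidean_space"
  assumes F: "tf F" "\<And>x. 0 \<le> F x" and s: "s < real DIM('a)"
    and eq: "\<And>x. x \<noteq> 0 \<Longrightarrow> (norm (f x))\<^sup>2 / norm x powr \<sigma> = norm x powr (- s) * F x"
  shows "weighted_int \<sigma> f = ennreal (wI s F)"
proof -
  have "weighted_int \<sigma> f = (\<integral>\<^sup>+x. ennreal (norm x powr (- s) * F x) \<partial>lborel)"
    unfolding weighted_int_def
  proof (rule nn_integral_cong_AE)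
    show "AE x in lborel. ennreal ((norm (f x))\<^sup>2 / norm x powr \<sigma>) = ennreal (norm x powr (- s) * F x)"
      using AE_lborel_singleton[of 0] by eventually_elim (subst eq, assumption, rule refl)
  qed
  also have "\<dots> = ennreal (wI s F)"
    unfolding wI_def using F by (intro nn_integral_eq_integral tf_integrable_powr s) auto
  finally show ?thesis .
qed

subsection \<open>Radial test functions\<close>

text \<open>The Euler derivative of \<open>F (c * |x|^2)\<close> in the variable
  \<open>t = c * |x|^2\<close>. The scale \<open>c\<close> drops out, so plateaus of any width have
  derivatives of the same size.\<close>

definition tderiv :: "(real \<Rightarrow> real) \<Rightarrow> real \<Rightarrow> real" where
  "tderiv F t = 2 * t * pd 1 F t"

lemma smooth_ident: "smooth (\<lambda>t::real. t)"
  using smooth_inner[of "1::real"] by simp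

lemma smooth_tderiv: "smooth F \<Longrightarrow> smooth (tderiv F)"
  unfolding tderiv_def[abs_def] by (intro smooth_mult smooth_const smooth_ident smooth_pd) auto

lemma smooth_radial: "smooth F \<Longrightarrow> smooth (\<lambda>x. F (c * (norm x)\<^sup>2))"
  by (erule smooth_compose) (intro smooth_intros)

lemma pd_radial:
  assumes "smooth F" "b \<in> Basis"
  shows "pd b (\<lambda>x. F (c * (norm x)\<^sup>2)) = (\<lambda>x. pd 1 F (c * (norm x)\<^sup>2) * (c * (2 * (x \<bullet> b))))"
proof -
  have s: "smooth (\<lambda>x::'a. c * (norm x)\<^sup>2)" by (intro smooth_intros)
  have "pd b (\<lambda>x. c * (norm x)\<^sup>2) = (\<lambda>x. c * (2 * (x \<bullet> b)))"
    by (simp add: smooth_pd_cmult[OF smooth_norm2] pd_norm2 assms)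
  then show ?thesis by (simp add: smooth_pd_compose[OF assms(1) s])
qed

lemma euler_radial:
  assumes "smooth F"
  shows "euler (\<lambda>x. F (c * (norm x)\<^sup>2)) = (\<lambda>x. tderiv F (c * (norm x)\<^sup>2))"
proof
  fix x :: 'a
  let ?k = "2 * c * pd 1 F (c * (norm x)\<^sup>2)"
  have "euler (\<lambda>x. F (c * (norm x)\<^sup>2)) x = (\<Sum>b\<in>Basis. ?k * ((x \<bullet> b) * (x \<bullet> b)))"
    unfolding euler_def by (intro sum.cong refl) (simp add: pd_radial[OF assms])
  also have "\<dots> = ?k * (norm x)\<^sup>2"
    by (simp only: sum_distrib_left[symmetric] norm2_Basis[symmetric])
  finally show "euler (\<lambda>x. F (c * (norm x)\<^sup>2)) x = tderiv F (c * (norm x)\<^sup>2)"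
    by (simp add: tderiv_def)
qed

lemma rot_radial: "smooth F \<Longrightarrow> b \<in> Basis \<Longrightarrow> c' \<in> Basis \<Longrightarrow> rot b c' (\<lambda>x. F (c * (norm x)\<^sup>2)) = (\<lambda>x. 0)"
  by (rule ext) (simp add: rot_def pd_radial)

lemma euler_eq_open:
  assumes "open U" "x \<in> U" "\<And>y. y \<in> U \<Longrightarrow> f y = g y" "smooth f"
  shows "euler f x = euler g x"
  unfolding euler_def by (intro sum.cong refl) (simp add: pd_eq_open[OF assms])

lemma euler_vanish:
  assumes "smooth w" "\<And>x. norm x < 1 \<Longrightarrow> w x = 0" "norm x < 1"
  shows "euler w x = 0"
proof -
  have "euler w x = euler (\<lambda>x. 0) x"
    by (rule euler_eq_open[of "ball 0 1"]) (use assms in auto)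
  then show ?thesis by (simp add: euler_def)
qed

text \<open>A smooth positive function which agrees with the squared norm outside the ball of radius
  one half, so that its powers are smooth substitutes for powers of the norm.\<close>

definition norm2_reg :: "'a::euclidean_space \<Rightarrow> real" where
  "norm2_reg x = (norm x)\<^sup>2 + cut (16 * (norm x)\<^sup>2)"

lemma norm2_reg_pos: "norm2_reg x > 0"
proof (cases "x = 0")
  case True then show ?thesis by (simp add: norm2_reg_def cut_one)
next
  case False then show ?thesis unfolding norm2_reg_def by (intro add_pos_nonneg cut_nonneg) simp
qed

lemma smooth_norm2_reg: "smooth norm2_reg"
  unfolding norm2_reg_def[abs_def] by (intro smooth_add smooth_norm2 smooth_radial smooth_cut)

lemma norm2_reg_eq: "norm x \<ge> 1/2 \<Longrightarrow> norm2_reg x = (norm x)\<^sup>2"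
  using power_mono[of "1/2" "norm x" 2] by (simp add: norm2_reg_def cut_zero power2_eq_square)

lemma rot_norm2_reg: "b \<in> Basis \<Longrightarrow> c \<in> Basis \<Longrightarrow> rot b c norm2_reg = (\<lambda>x. 0)"
proof -
  assume bc: "b \<in> Basis" "c \<in> Basis"
  have 1: "rot b c (\<lambda>x. (norm x)\<^sup>2) = (\<lambda>x. 0)" by (rule ext) (simp add: rot_def pd_norm2 bc)
  show ?thesis unfolding norm2_reg_def[abs_def]
    by (simp add: rot_add smooth_norm2 smooth_radial smooth_cut 1 rot_radial bc)
qed

text \<open>The ground state substitution: off the ball of radius one half this is
  \<open>|x|^-a\<close> times \<open>w\<close>, and \<open>|x|^-a\<close> is annihilated by
  \<open>D\<close>.\<close>

definition ground :: "real \<Rightarrow> ('a::euclidean_space \<Rightarrow> real) \<Rightarrow> 'a \<Rightarrow> real" where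
  "ground a w x = norm2_reg x powr (- (a / 2)) * w x"

lemma smooth_norm2_reg_powr: "smooth (\<lambda>x. norm2_reg x powr p)"
  by (rule smooth_powr[OF norm2_reg_pos smooth_norm2_reg])

lemma tf_ground: "tf w \<Longrightarrow> tf (ground a w)"
  unfolding ground_def[abs_def] by (rule tf_mult'[OF _ smooth_norm2_reg_powr])

lemma rot_ground:
  assumes w: "smooth w" "rot b c w = (\<lambda>x. 0)" and bc: "b \<in> Basis" "c \<in> Basis"
  shows "rot b c (ground a w) = (\<lambda>x. 0)"
proof -
  have "rot b c (\<lambda>x. norm2_reg x powr (- (a / 2))) = (\<lambda>x. - (a / 2) * norm2_reg x powr (- (a / 2) - 1) * rot b c norm2_reg x)"
    by (rule ext) (simp add: rot_def smooth_pd_powr[OF norm2_reg_pos smooth_norm2_reg] bc field_simps)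
  then have "rot b c (\<lambda>x. norm2_reg x powr (- (a / 2))) = (\<lambda>x. 0)" by (simp add: rot_norm2_reg bc)
  then show ?thesis unfolding ground_def[abs_def] by (simp add: rot_mult smooth_norm2_reg_powr w)
qed

lemma drv_ground:
  assumes w: "smooth w" "\<And>x. norm x < 1 \<Longrightarrow> w x = 0"
  shows "drv a (ground a w) = ground a (euler w)"
proof
  fix x :: 'a
  let ?p = "\<lambda>x::'a. norm2_reg x powr (- (a / 2))"
  have e: "euler (ground a w) x = ?p x * euler w x + euler ?p x * w x"
    unfolding ground_def[abs_def] by (simp add: euler_mult smooth_norm2_reg_powr w)
  show "drv a (ground a w) x = ground a (euler w) x"
  proof (cases "norm x < 1")
    case True
    then show ?thesis using w euler_vanish[OF w, of x] by (simp add: drv_def e ground_def)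
  next
    case False
    have "euler norm2_reg x = euler (\<lambda>x. (norm x)\<^sup>2) x"
    \<comment> \<open>Derivatives at points with \<open>norm x = 1\<close> need an open
      neighbourhood on which \<open>norm2_reg\<close> is the squared norm; the margin between the
      radii 1/2 and 1 provides it.\<close>
    proof (rule euler_eq_open[of "{x. norm x > 1/2}"])
      show "open {x::'a. norm x > 1/2}" by (intro open_Collect_less continuous_intros)
    qed (use False in \<open>auto simp: norm2_reg_eq smooth_norm2_reg\<close>)
    also have "\<dots> = 2 * (norm x)\<^sup>2"
    proof -
      have "euler (\<lambda>x. (norm x)\<^sup>2) x = (\<Sum>b\<in>Basis. 2 * ((x \<bullet> b) * (x \<bullet> b)))"
        unfolding euler_def by (intro sum.cong refl) (simp add: pd_norm2)
      then show ?thesis by (simp only: sum_distrib_left[symmetric] norm2_Basis[symmetric])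
    qed
    also have "\<dots> = 2 * norm2_reg x" using False by (simp add: norm2_reg_eq)
    finally have eb: "euler norm2_reg x = 2 * norm2_reg x" .
    have "euler ?p x = - (a / 2) * norm2_reg x powr (- (a / 2) - 1) * euler norm2_reg x"
      unfolding euler_def sum_distrib_left
      by (intro sum.cong refl) (simp add: smooth_pd_powr[OF norm2_reg_pos smooth_norm2_reg])
    also have "\<dots> = - a * ?p x"
      using norm2_reg_pos[of x] by (simp add: eb powr_diff)
    finally show ?thesis by (simp add: drv_def e ground_def algebra_simps)
  qed
qed

section \<open>The dilation invariant measure and dyadic shells\<close>

text \<open>The measure \<open>|x|^-N dx\<close> is invariant under dilations. Hence transition
  layers at different scales cost the same, and dyadic shells have equal mass.\<close>

lemma nn_integral_scale:
  fixes f :: "'a::euclidean_space \<Rightarrow> ennreal"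
  assumes f: "f \<in> borel_measurable borel" and c: "c > 0"
  shows "(\<integral>\<^sup>+x. ennreal (norm x powr (- real DIM('a))) * f (c *\<^sub>R x) \<partial>lborel)
    = (\<integral>\<^sup>+x. ennreal (norm x powr (- real DIM('a))) * f x \<partial>lborel)"
proof -
  let ?N = "real DIM('a)"
  let ?g = "\<lambda>x. ennreal (norm x powr (- ?N)) * f x"
  have gm: "?g \<in> borel_measurable borel" using f by simp
  have "(\<integral>\<^sup>+x. ?g x \<partial>lborel) = (\<integral>\<^sup>+x. ?g x \<partial>density (distr lborel borel (\<lambda>x. 0 + c *\<^sub>R x)) (\<lambda>_. ennreal (\<bar>c\<bar> ^ DIM('a))))"
    using lborel_affine[of c "0::'a"] c by simp
  also have "\<dots> = (\<integral>\<^sup>+x. ennreal (c ^ DIM('a)) * ?g (c *\<^sub>R x) \<partial>lborel)"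
    using gm c by (simp add: nn_integral_density nn_integral_distr)
  also have "\<dots> = (\<integral>\<^sup>+x. ennreal (norm x powr (- ?N)) * f (c *\<^sub>R x) \<partial>lborel)"
  proof (intro nn_integral_cong)
    fix x :: 'a
    have "c ^ DIM('a) * norm (c *\<^sub>R x) powr (- ?N) = norm x powr (- ?N)"
      using c by (simp add: powr_mult powr_minus powr_realpow)
    then have "ennreal (c ^ DIM('a)) * ennreal (norm (c *\<^sub>R x) powr (- ?N)) = ennreal (norm x powr (- ?N))"
      using c by (simp add: ennreal_mult[symmetric])
    then show "ennreal (c ^ DIM('a)) * ?g (c *\<^sub>R x) = ennreal (norm x powr (- ?N)) * f (c *\<^sub>R x)"
      by (metis mult.assoc)
  qed
  finally show ?thesis by simp
qed

definition shells :: "nat \<Rightarrow> 'a::euclidean_space itself \<Rightarrow> ennreal" where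
  "shells K _ = (\<integral>\<^sup>+(x::'a). ennreal (norm x powr (- real DIM('a))) * indicator {x. 2 \<le> norm x \<and> norm x < 2 ^ Suc K} x \<partial>lborel)"

lemma shell_measurable: "{x::'a::euclidean_space. p \<le> norm x \<and> norm x < q} \<in> sets borel"
  by measurable

text \<open>The region between the radii 2 and \<open>2 ^ Suc K\<close> consists of exactly
  \<open>K\<close> dyadic shells, each a dilate of the first.\<close>

lemma shells_eq: "shells K TYPE('a::euclidean_space) = of_nat K * shells 1 TYPE('a)"
proof (induction K)
  case 0
  have "{x::'a. 2 \<le> norm x \<and> norm x < 2} = {}" by auto
  then show ?case by (simp add: shells_def)
next
  case (Suc K)
  let ?w = "\<lambda>x::'a. ennreal (norm x powr (- real DIM('a)))"
  let ?S = "\<lambda>p q. {x::'a. p \<le> norm x \<and> norm x < q}"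
  have "shells (Suc K) TYPE('a) = (\<integral>\<^sup>+x. ?w x * indicator (?S 2 (2 ^ Suc K)) x + ?w x * indicator (?S (2 ^ Suc K) (2 ^ Suc (Suc K))) x \<partial>lborel)"
  proof -
    have i: "indicator (?S p r) x = (indicator (?S p q) x + indicator (?S q r) x :: ennreal)"
      if "p \<le> q" "q \<le> r" for p q r x using that by (auto simp: indicator_def)
    have "indicator (?S 2 (2 ^ Suc (Suc K))) x = (indicator (?S 2 (2 ^ Suc K)) x + indicator (?S (2 ^ Suc K) (2 ^ Suc (Suc K))) x :: ennreal)" for x
      by (rule i) simp_all
    then show ?thesis unfolding shells_def by (simp only: distrib_left)
  qed
  also have "\<dots> = shells K TYPE('a) + (\<integral>\<^sup>+x. ?w x * indicator (?S (2 ^ Suc K) (2 ^ Suc (Suc K))) x \<partial>lborel)"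
    unfolding shells_def
    by (rule nn_integral_add) (intro borel_measurable_times_ennreal borel_measurable_indicator; simp add: shell_measurable)+
  also have "(\<integral>\<^sup>+x. ?w x * indicator (?S (2 ^ Suc K) (2 ^ Suc (Suc K))) x \<partial>lborel) = shells 1 TYPE('a)"
  proof -
    have "indicator (?S (2 ^ Suc K) (2 ^ Suc (Suc K))) x = (indicator (?S 2 4) ((1 / 2 ^ K) *\<^sub>R x) :: ennreal)" for x
      by (auto simp: indicator_def field_simps)
    moreover have "indicator (?S 2 4) \<in> borel_measurable borel"
      by (intro borel_measurable_indicator shell_measurable)
    then have "(\<integral>\<^sup>+x. ?w x * indicator (?S 2 4) ((1 / 2 ^ K) *\<^sub>R x) \<partial>lborel) = (\<integral>\<^sup>+x. ?w x * indicator (?S 2 4) x \<partial>lborel)"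
      by (intro nn_integral_scale) auto
    ultimately show ?thesis by (simp add: shells_def)
  qed
  finally show ?case using Suc by (simp add: algebra_simps)
qed

lemma shells_pos: "shells 1 TYPE('a::euclidean_space) > 0"
proof (rule ccontr)
  let ?U = "{x::'a. 2 < norm x \<and> norm x < 4}"
  assume "\<not> shells 1 TYPE('a) > 0"
  then have "(\<integral>\<^sup>+(x::'a). ennreal (norm x powr (- real DIM('a))) * indicator {x. 2 \<le> norm x \<and> norm x < 4} x \<partial>lborel) = 0"
    by (simp add: shells_def)
  then have "AE x::'a in lborel. ennreal (norm x powr (- real DIM('a))) * indicator {x. 2 \<le> norm x \<and> norm x < 4} x = 0"
    by (subst (asm) nn_integral_0_iff_AE)
      (intro borel_measurable_times_ennreal borel_measurable_indicator; simp add: shell_measurable)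
  then have ae: "AE x::'a in lborel. x \<notin> ?U"
  proof eventually_elim
    case (elim x)
    show ?case
    proof
      assume "x \<in> ?U"
      then have "ennreal (norm x powr (- real DIM('a))) = 0" using elim by (simp add: indicator_def)
      moreover have "norm x powr (- real DIM('a)) > 0" using \<open>x \<in> ?U\<close> by auto
      ultimately show False by (simp add: ennreal_eq_0_iff)
    qed
  qed
  have op: "open ?U" by (intro open_Collect_conj open_Collect_less continuous_intros)
  have "?U \<in> null_sets lborel"
    using ae op by (subst AE_iff_null_sets) auto
  then have "negligible ?U" using negligible_iff_null_sets null_sets_completionI by blast
  moreover obtain i :: 'a where "i \<in> Basis" using nonempty_Basis by blast
  then have "3 *\<^sub>R i \<in> ?U" by simp
  ultimately show False using open_not_negligible[OF op] by blast
qed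

subsection \<open>The completion\<close>

context
  fixes \<gamma> s a b :: real
  assumes N5: "DIM('a::euclidean_space) \<ge> 5" and g1: "-2 < \<gamma>" and g2: "\<gamma> \<le> 0"
    and s_def: "s = \<gamma> + 4" and a_def: "a = (real DIM('a) - s) / 2" and b_def: "b = a + s - 2"
begin

lemma params: "0 \<le> s" "s < real DIM('a)" "2 \<le> s" "s \<le> 4" "a > 0" "b > 0" "real DIM('a) \<ge> 5"
proof -
  show N: "real DIM('a) \<ge> 5" using N5 by simp
  show s: "0 \<le> s" "s < real DIM('a)" "2 \<le> s" "s \<le> 4" using N g1 g2 by (simp_all add: s_def)
  then show a: "a > 0" by (simp add: a_def)
  with s show "b > 0" by (simp add: b_def)
qed

lemmas weight_params = params(1) params(2) a_def

text \<open>The factors \<open>|x|^4\<close> and \<open>|x|^2\<close> bring the three integrals of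
  the theorem to the common weight \<open>|x|^-s\<close>. \<open>defect\<close> is the term
  \<open>D^2 u\<close> that the inequality for test functions leaves over.\<close>

definition lap_energy :: "('a \<Rightarrow> real) \<Rightarrow> real" where "lap_energy f = wI s (\<lambda>x. ((norm x)\<^sup>2 * laplacian f x)\<^sup>2)"
definition grad_energy :: "('a \<Rightarrow> real) \<Rightarrow> real" where "grad_energy f = wI s (\<lambda>x. (norm x)\<^sup>2 * (norm (grad f x))\<^sup>2)"
definition mass :: "('a \<Rightarrow> real) \<Rightarrow> real" where "mass f = ip s f f"
definition defect :: "('a \<Rightarrow> real) \<Rightarrow> real" where "defect f = ip s (drv a (drv a f)) (drv a (drv a f))"

lemma norm_powr_shift: "x \<noteq> 0 \<Longrightarrow> norm (x::'a) powr (- (c + real n)) * (norm x) ^ n = 1 / norm x powr c"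
proof -
  assume x: "x \<noteq> 0"
  have "norm x powr (- (c + real n)) * norm x powr real n = norm x powr (- c)"
    by (simp add: powr_add[symmetric])
  then show ?thesis using x by (simp add: powr_realpow powr_minus_divide)
qed

lemma weighted_int_laplacian:
  fixes f :: "'a \<Rightarrow> real"
  assumes f: "tf f" shows "weighted_int \<gamma> (laplacian f) = ennreal (lap_energy f)"
  unfolding lap_energy_def
proof (rule weighted_int_wI)
  show "tf (\<lambda>x. ((norm x)\<^sup>2 * laplacian f x)\<^sup>2)"
    unfolding power2_eq_square[of "_ * laplacian f _"] by (intro tf_prod tf_mult' tf_laplacian f smooth_intros)
  show "s < real DIM('a)" by (rule params)
  fix x :: 'a assume x: "x \<noteq> 0"
  have "norm x powr (- s) * ((norm x)\<^sup>2 * laplacian f x)\<^sup>2 = (norm x powr (- (\<gamma> + real 4)) * (norm x) ^ 4) * (laplacian f x)\<^sup>2"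
    by (simp add: s_def power_mult_distrib)
  then show "(norm (laplacian f x))\<^sup>2 / norm x powr \<gamma> = norm x powr (- s) * ((norm x)\<^sup>2 * laplacian f x)\<^sup>2"
    by (simp only: norm_powr_shift[OF x]) simp
qed simp

lemma tf_gradsq: "tf f \<Longrightarrow> tf (\<lambda>x. (norm x)\<^sup>2 * (norm (grad f x))\<^sup>2)"
  unfolding norm_grad power2_eq_square[of "pd _ f _"]
  by (intro tf_mult' tf_sum tf_prod tf_pd smooth_intros)

lemma weighted_int_grad:
  fixes f :: "'a \<Rightarrow> real"
  assumes f: "tf f" shows "weighted_int (\<gamma> + 2) (grad f) = ennreal (grad_energy f)"
  unfolding grad_energy_def
proof (rule weighted_int_wI)
  show "tf (\<lambda>x. (norm x)\<^sup>2 * (norm (grad f x))\<^sup>2)" by (rule tf_gradsq[OF f])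
  show "s < real DIM('a)" by (rule params)
  fix x :: 'a assume x: "x \<noteq> 0"
  have "norm x powr (- s) * ((norm x)\<^sup>2 * (norm (grad f x))\<^sup>2) = (norm x powr (- ((\<gamma> + 2) + real 2)) * (norm x)\<^sup>2) * (norm (grad f x))\<^sup>2"
    by (simp add: s_def algebra_simps)
  then show "(norm (grad f x))\<^sup>2 / norm x powr (\<gamma> + 2) = norm x powr (- s) * ((norm x)\<^sup>2 * (norm (grad f x))\<^sup>2)"
    by (simp only: norm_powr_shift[OF x]) simp
qed simp

lemma weighted_int_mass:
  fixes f :: "'a \<Rightarrow> real"
  assumes f: "tf f" shows "weighted_int (\<gamma> + 4) f = ennreal (mass f)"
  unfolding mass_def ip_def[OF weight_params]
proof (rule weighted_int_wI)
  show "tf (\<lambda>x. f x * f x)" by (intro tf_prod f)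
  show "s < real DIM('a)" by (rule params)
  fix x :: 'a assume x: "x \<noteq> 0"
  show "(norm (f x))\<^sup>2 / norm x powr (\<gamma> + 4) = norm x powr (- s) * (f x * f x)"
    by (simp add: s_def[symmetric] powr_minus_divide power2_eq_square)
qed simp

lemma D22_norm_lap_energy:
  fixes f :: "'a \<Rightarrow> real"
  assumes f: "tf f" shows "(D22_norm \<gamma> f)\<^sup>2 = lap_energy f"
proof -
  have "(D22_norm \<gamma> f)\<^sup>2 = (\<integral>x. norm x powr (- \<gamma>) * \<bar>laplacian f x\<bar>\<^sup>2 \<partial>lborel)"
    by (simp add: D22_norm_def)
  also have "\<dots> = lap_energy f" unfolding lap_energy_def wI_def
  proof (rule integral_cong_AE)
    have "laplacian f \<in> borel_measurable borel" by (intro tf_measurable tf_laplacian f)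
    then show "(\<lambda>x. norm x powr (- \<gamma>) * \<bar>laplacian f x\<bar>\<^sup>2) \<in> borel_measurable lborel"
      "(\<lambda>x. norm x powr (- s) * ((norm x)\<^sup>2 * laplacian f x)\<^sup>2) \<in> borel_measurable lborel" by simp_all
    show "AE x in lborel. norm x powr (- \<gamma>) * \<bar>laplacian f x\<bar>\<^sup>2 = norm x powr (- s) * ((norm x)\<^sup>2 * laplacian f x)\<^sup>2"
      using AE_lborel_singleton[of 0]
    proof eventually_elim
      case (elim x)
      have "norm x powr (- s) * ((norm x)\<^sup>2 * laplacian f x)\<^sup>2 = (norm x powr (- (\<gamma> + real 4)) * (norm x) ^ 4) * (laplacian f x)\<^sup>2"
        by (simp add: s_def power_mult_distrib)
      then show ?case by (simp only: norm_powr_shift[OF elim]) (simp add: powr_minus_divide)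
    qed
  qed
  finally show ?thesis .
qed

lemma lap_energy_nonneg: "0 \<le> lap_energy f" unfolding lap_energy_def by (rule wI_nonneg[OF weight_params]) simp
lemma grad_energy_nonneg: "0 \<le> grad_energy f" unfolding grad_energy_def by (rule wI_nonneg[OF weight_params]) simp
lemma mass_nonneg: "0 \<le> mass f" unfolding mass_def by (rule ip_nonneg[OF weight_params])
lemma defect_nonneg: "0 \<le> defect f" unfolding defect_def by (rule ip_nonneg[OF weight_params])

text \<open>By the Rellich bounds, a sequence that is Cauchy in the norm of the completion is also
  Cauchy in the other two weighted norms. Completeness yields limits of the Laplacians, gradients
  and functions; pairing with test functions identifies them as the weak derivatives of
  \<open>u\<close> and \<open>u\<close> itself. All three energies then converge along this one
  sequence.\<close>

lemma D22_limits:
  fixes u :: "'a \<Rightarrow> real"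
  assumes u: "u \<in> D22 \<gamma>"
  obtains \<phi> where "\<forall>n. tf (\<phi> n)" "u \<in> borel_measurable borel"
    "(\<lambda>n. weighted_int (\<gamma> + 4) (\<lambda>x. \<phi> n x - u x)) \<longlonglongrightarrow> 0"
    "weighted_int \<gamma> (weak_laplacian u) < \<infinity>" "(\<lambda>n. lap_energy (\<phi> n)) \<longlonglongrightarrow> enn2real (weighted_int \<gamma> (weak_laplacian u))"
    "weighted_int (\<gamma> + 2) (weak_gradient u) < \<infinity>" "(\<lambda>n. grad_energy (\<phi> n)) \<longlonglongrightarrow> enn2real (weighted_int (\<gamma> + 2) (weak_gradient u))"
    "weighted_int (\<gamma> + 4) u < \<infinity>" "(\<lambda>n. mass (\<phi> n)) \<longlonglongrightarrow> enn2real (weighted_int (\<gamma> + 4) u)"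
proof -
  from u obtain \<phi> where li: "locally_integrable u" and t: "\<And>n. tf (\<phi> n)"
    and c: "\<And>e. e > 0 \<Longrightarrow> \<exists>M. \<forall>m\<ge>M. \<forall>n\<ge>M. D22_norm \<gamma> (\<lambda>x. \<phi> m x - \<phi> n x) < e"
    and l1: "\<And>K. compact K \<Longrightarrow> (\<lambda>n. LINT x:K|lborel. \<bar>\<phi> n x - u x\<bar>) \<longlonglongrightarrow> 0"
    by (auto simp: D22_def test_function_tf)
  have sm: "smooth (\<phi> n)" for n by (rule tf_smooth[OF t])
  have td: "tf (\<lambda>x. \<phi> m x - \<phi> n x)" for m n by (intro tf_diff t)
  have um: "u \<in> borel_measurable borel" by (rule locally_integrable_measurable[OF li])
  have pm: "\<phi> n \<in> borel_measurable borel" for n by (rule tf_measurable[OF t])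
  have lm: "laplacian (\<phi> n) \<in> borel_measurable borel" for n by (rule tf_measurable[OF tf_laplacian[OF t]])
  have gm: "grad (\<phi> n) \<in> borel_measurable borel" for n by (rule grad_measurable[OF t])
  have cX: "\<exists>M. \<forall>m\<ge>M. \<forall>n\<ge>M. lap_energy (\<lambda>x. \<phi> m x - \<phi> n x) < e" if e: "e > 0" for e
  proof -
    obtain M where M: "\<And>m n. m \<ge> M \<Longrightarrow> n \<ge> M \<Longrightarrow> D22_norm \<gamma> (\<lambda>x. \<phi> m x - \<phi> n x) < sqrt e"
      using c[of "sqrt e"] e by auto
    have "lap_energy (\<lambda>x. \<phi> m x - \<phi> n x) < e" if "m \<ge> M" "n \<ge> M" for m n
    proof -
      have "(D22_norm \<gamma> (\<lambda>x. \<phi> m x - \<phi> n x))\<^sup>2 < (sqrt e)\<^sup>2"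
        by (rule power_strict_mono[OF M[OF that]]) (auto simp: D22_norm_def intro!: integral_nonneg_AE AE_I2)
      then show ?thesis using e by (simp add: D22_norm_lap_energy[OF td])
    qed
    then show ?thesis by blast
  qed
  \<comment> \<open>Any quantity dominated by the Laplacian energy inherits the Cauchy property; it
    is used for the mass and the gradient energy with the Rellich constants as
    \<open>k\<close>.\<close>
  have scale: "\<exists>M. \<forall>m\<ge>M. \<forall>n\<ge>M. q (\<lambda>x. \<phi> m x - \<phi> n x) < e"
    if e: "e > 0" and q: "k > 0" "\<And>f. tf f \<Longrightarrow> k * q f \<le> 2 * lap_energy f" for e k and q :: "('a \<Rightarrow> real) \<Rightarrow> real"
  proof -
    obtain M where M: "\<And>m n. m \<ge> M \<Longrightarrow> n \<ge> M \<Longrightarrow> lap_energy (\<lambda>x. \<phi> m x - \<phi> n x) < k * e / 2"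
      using cX[of "k * e / 2"] e q(1) by auto
    have "q (\<lambda>x. \<phi> m x - \<phi> n x) < e" if "m \<ge> M" "n \<ge> M" for m n
    proof -
      have "k * q (\<lambda>x. \<phi> m x - \<phi> n x) < k * e" using M[OF that] q(2)[OF td[of m n]] by simp
      then show ?thesis using q(1) by simp
    qed
    then show ?thesis by blast
  qed
  have rz: "(a * b)\<^sup>2 * mass f \<le> 2 * lap_energy f" if "tf f" for f
    using rellich_inequality(1)[OF weight_params that params(3)] lap_energy_nonneg[of f] unfolding lap_energy_def mass_def b_def by linarith
  have ry: "a\<^sup>2 * grad_energy f \<le> 2 * lap_energy f" if "tf f" for f
    using rellich_inequality(2)[OF weight_params that params(3)] unfolding lap_energy_def grad_energy_def by simp
  have k: "(a * b)\<^sup>2 > 0" "a\<^sup>2 > 0" using params(5,6) by auto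
  obtain h where h: "h \<in> borel_measurable borel" "(\<lambda>n. weighted_int \<gamma> (\<lambda>x. laplacian (\<phi> n) x - h x)) \<longlonglongrightarrow> 0"
  proof (rule weighted_complete[of "\<lambda>n. laplacian (\<phi> n)" \<gamma>])
    show "\<exists>M. \<forall>m\<ge>M. \<forall>n\<ge>M. weighted_int \<gamma> (\<lambda>x. laplacian (\<phi> m) x - laplacian (\<phi> n) x) < ennreal e" if "e > 0" for e
      using cX[OF that] unfolding laplacian_diff[OF sm sm, symmetric] weighted_int_laplacian[OF td]
      using lap_energy_nonneg by (simp add: ennreal_less_iff)
  qed (use lm in auto)
  obtain g where g: "g \<in> borel_measurable borel" "(\<lambda>n. weighted_int (\<gamma> + 2) (\<lambda>x. grad (\<phi> n) x - g x)) \<longlonglongrightarrow> 0"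
  proof (rule weighted_complete[of "\<lambda>n. grad (\<phi> n)" "\<gamma> + 2"])
    show "\<exists>M. \<forall>m\<ge>M. \<forall>n\<ge>M. weighted_int (\<gamma> + 2) (\<lambda>x. grad (\<phi> m) x - grad (\<phi> n) x) < ennreal e" if "e > 0" for e
      using scale[OF that k(2) ry] unfolding grad_diff[OF sm sm, symmetric] weighted_int_grad[OF td]
      using grad_energy_nonneg by (simp add: ennreal_less_iff)
  qed (use gm in auto)
  obtain u' where u': "u' \<in> borel_measurable borel" "(\<lambda>n. weighted_int (\<gamma> + 4) (\<lambda>x. \<phi> n x - u' x)) \<longlonglongrightarrow> 0"
  proof (rule weighted_complete[of \<phi> "\<gamma> + 4"])
    show "\<exists>M. \<forall>m\<ge>M. \<forall>n\<ge>M. weighted_int (\<gamma> + 4) (\<lambda>x. \<phi> m x - \<phi> n x) < ennreal e" if "e > 0" for e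
      using scale[OF that k(1) rz] unfolding weighted_int_mass[OF td]
      using mass_nonneg by (simp add: ennreal_less_iff)
  qed (use pm in auto)
  have fX: "weighted_int \<gamma> (laplacian (\<phi> n)) < \<infinity>" and fY: "weighted_int (\<gamma> + 2) (grad (\<phi> n)) < \<infinity>"
    and fZ: "weighted_int (\<gamma> + 4) (\<phi> n) < \<infinity>" for n
    by (simp_all add: weighted_int_laplacian weighted_int_grad weighted_int_mass t)
  note hX = weighted_int_tendsto[OF lm h(1) fX h(2)]
  note gY = weighted_int_tendsto[OF gm g(1) fY g(2)]
  note uZ = weighted_int_tendsto[OF pm u'(1) fZ u'(2)]
  have sg: "- \<gamma> < real DIM('a)" "- (\<gamma> + 2) < real DIM('a)" "- (\<gamma> + 4) < real DIM('a)"
    using params(7) g1 by linarith+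
  \<comment> \<open>The weighted limit \<open>u'\<close> and the local \<open>L^1\<close> limit
    \<open>u\<close> have the same pairings with all test functions.\<close>
  have "AE x in lborel. u' x - u x = 0"
  proof (rule variational_lemma)
    have lu': "locally_integrable u'" by (rule weighted_int_locally_integrable[OF u'(1) uZ(1) sg(3)])
    then show "locally_integrable (\<lambda>x. u' x - u x)" by (rule locally_integrable_diff[OF _ li])
    fix \<psi> :: "'a \<Rightarrow> real" assume p: "tf \<psi>"
    have "(\<integral>x. u' x * \<psi> x \<partial>lborel) = (\<integral>x. u x * \<psi> x \<partial>lborel)"
      using weighted_int_test_tendsto[OF pm u'(1) fZ uZ(1) u'(2) p sg(3)] local_L1_test_tendsto[OF t li p l1]
      by (rule LIMSEQ_unique)
    then show "(\<integral>x. (u' x - u x) * \<psi> x \<partial>lborel) = 0"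
      using locally_integrable_mult_tf[OF lu' p] locally_integrable_mult_tf[OF li p] by (simp add: left_diff_distrib)
  qed
  then have uu: "AE x in lborel. u' x = u x" by simp
  have wu: "weighted_int (\<gamma> + 4) u' = weighted_int (\<gamma> + 4) u" by (rule weighted_int_cong_AE[OF uu])
  have ud: "weighted_int (\<gamma> + 4) (\<lambda>x. \<phi> n x - u' x) = weighted_int (\<gamma> + 4) (\<lambda>x. \<phi> n x - u x)" for n
    by (rule weighted_int_cong_AE) (use uu in eventually_elim, simp)
  have "has_weak_laplacian u h"
    unfolding has_weak_laplacian_def test_function_tf
  proof (intro conjI allI impI li)
    show "locally_integrable h" by (rule weighted_int_locally_integrable[OF h(1) hX(1) sg(1)])
    fix \<psi> :: "'a \<Rightarrow> real" assume p: "tf \<psi>"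
    have "(\<lambda>n. \<integral>x. \<phi> n x * laplacian \<psi> x \<partial>lborel) \<longlonglongrightarrow> (\<integral>x. u x * laplacian \<psi> x \<partial>lborel)"
      by (rule local_L1_test_tendsto[OF t li tf_laplacian[OF p] l1])
    then have "(\<lambda>n. \<integral>x. laplacian (\<phi> n) x * \<psi> x \<partial>lborel) \<longlonglongrightarrow> (\<integral>x. u x * laplacian \<psi> x \<partial>lborel)"
      by (simp add: integral_laplacian_parts t p)
    then show "(\<integral>x. u x * laplacian \<psi> x \<partial>lborel) = (\<integral>x. h x * \<psi> x \<partial>lborel)"
      using weighted_int_test_tendsto[OF lm h(1) fX hX(1) h(2) p sg(1)] by (rule LIMSEQ_unique)
  qed
  then have wl: "weighted_int \<gamma> (weak_laplacian u) = weighted_int \<gamma> h"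
    by (intro weighted_int_cong_AE weak_laplacian_unique)
  have "has_weak_gradient u g"
    unfolding has_weak_gradient_def test_function_tf
  proof (intro conjI allI impI ballI li)
    show "locally_integrable g" by (rule weighted_int_locally_integrable[OF g(1) gY(1) sg(2)])
    fix \<psi> :: "'a \<Rightarrow> real" and i :: 'a assume p: "tf \<psi>" and i: "i \<in> Basis"
    have le: "norm (v \<bullet> i) \<le> norm v" for v :: 'a using i by (simp add: Basis_le_norm)
    have "(\<lambda>n. \<integral>x. pd i (\<phi> n) x * \<psi> x \<partial>lborel) \<longlonglongrightarrow> (\<integral>x. (g x \<bullet> i) * \<psi> x \<partial>lborel)"
    proof (rule weighted_int_test_tendsto[OF _ _ _ _ _ p sg(2)])
      show "pd i (\<phi> n) \<in> borel_measurable borel" for n by (intro tf_measurable tf_pd t i)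
      show "(\<lambda>x. g x \<bullet> i) \<in> borel_measurable borel" using g(1) by simp
      have e: "pd i (\<phi> n) x = grad (\<phi> n) x \<bullet> i" for n x by (simp add: grad_inner i)
      show "weighted_int (\<gamma> + 2) (pd i (\<phi> n)) < \<infinity>" for n
        using weighted_int_mono[of "pd i (\<phi> n)" "grad (\<phi> n)" "\<gamma> + 2"] fY[of n] le by (simp add: e le_less_trans)
      show "weighted_int (\<gamma> + 2) (\<lambda>x. g x \<bullet> i) < \<infinity>"
        using weighted_int_mono[of "\<lambda>x. g x \<bullet> i" g "\<gamma> + 2"] gY(1) le by (simp add: le_less_trans)
      have "weighted_int (\<gamma> + 2) (\<lambda>x. pd i (\<phi> n) x - g x \<bullet> i) \<le> weighted_int (\<gamma> + 2) (\<lambda>x. grad (\<phi> n) x - g x)" for n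
        by (rule weighted_int_mono) (use le in \<open>simp add: e inner_diff_left[symmetric] del: inner_diff_left\<close>)
      then show "(\<lambda>n. weighted_int (\<gamma> + 2) (\<lambda>x. pd i (\<phi> n) x - g x \<bullet> i)) \<longlonglongrightarrow> 0"
        by (intro tendsto_sandwich[OF _ _ tendsto_const g(2)] always_eventually) auto
    qed
    then have "(\<lambda>n. - (\<integral>x. pd i (\<phi> n) x * \<psi> x \<partial>lborel)) \<longlonglongrightarrow> - (\<integral>x. (g x \<bullet> i) * \<psi> x \<partial>lborel)"
      by (rule tendsto_minus)
    then have "(\<lambda>n. \<integral>x. \<phi> n x * pd i \<psi> x \<partial>lborel) \<longlonglongrightarrow> - (\<integral>x. (g x \<bullet> i) * \<psi> x \<partial>lborel)"
      by (simp add: integral_by_parts t tf_smooth p i)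
    moreover have "(\<lambda>n. \<integral>x. \<phi> n x * pd i \<psi> x \<partial>lborel) \<longlonglongrightarrow> (\<integral>x. u x * pd i \<psi> x \<partial>lborel)"
      by (rule local_L1_test_tendsto[OF t li tf_pd[OF p i] l1])
    ultimately show "(\<integral>x. u x * pd i \<psi> x \<partial>lborel) = - (\<integral>x. (g x \<bullet> i) * \<psi> x \<partial>lborel)"
      using LIMSEQ_unique by blast
  qed
  then have wg: "weighted_int (\<gamma> + 2) (weak_gradient u) = weighted_int (\<gamma> + 2) g"
    by (intro weighted_int_cong_AE weak_gradient_unique)
  show ?thesis
  proof (rule that)
    show "(\<lambda>n. weighted_int (\<gamma> + 4) (\<lambda>x. \<phi> n x - u x)) \<longlonglongrightarrow> 0" using u'(2) by (simp add: ud)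
  qed (use t um hX gY uZ in \<open>simp_all add: wl wg wu weighted_int_laplacian weighted_int_grad weighted_int_mass lap_energy_nonneg grad_energy_nonneg mass_nonneg\<close>)
qed

lemma test_inequality: "tf f \<Longrightarrow> (a\<^sup>2 + b\<^sup>2) * grad_energy f + defect f \<le> lap_energy f + a ^ 4 * mass f"
  using main_inequality[OF weight_params _ N5 params(3,4)] unfolding lap_energy_def grad_energy_def mass_def defect_def b_def by blast

text \<open>The inequality passes to the limit along the sequence of \<open>D22_limits\<close>. All
  three integrals are finite, so the strict version can be decided in the reals: equality would
  force the weighted norm of \<open>sqrt (log_weight x) * u x\<close> to vanish.\<close>

lemma D22_inequality:
  fixes u :: "'a \<Rightarrow> real"
  assumes u: "u \<in> D22 \<gamma>"
  shows "ennreal (a\<^sup>2 + b\<^sup>2) * weighted_int (\<gamma> + 2) (weak_gradient u)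
     \<le> weighted_int \<gamma> (weak_laplacian u) + ennreal (a ^ 4) * weighted_int (\<gamma> + 4) u"
    and "\<not> (AE x in lborel. u x = 0) \<Longrightarrow> ennreal (a\<^sup>2 + b\<^sup>2) * weighted_int (\<gamma> + 2) (weak_gradient u)
     < weighted_int \<gamma> (weak_laplacian u) + ennreal (a ^ 4) * weighted_int (\<gamma> + 4) u"
proof -
  obtain \<phi> where t': "\<forall>n. tf (\<phi> n)" and um: "u \<in> borel_measurable borel"
    and lim: "(\<lambda>n. weighted_int (\<gamma> + 4) (\<lambda>x. \<phi> n x - u x)) \<longlonglongrightarrow> 0"
    and X: "weighted_int \<gamma> (weak_laplacian u) < \<infinity>" "(\<lambda>n. lap_energy (\<phi> n)) \<longlonglongrightarrow> enn2real (weighted_int \<gamma> (weak_laplacian u))"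
    and Y: "weighted_int (\<gamma> + 2) (weak_gradient u) < \<infinity>" "(\<lambda>n. grad_energy (\<phi> n)) \<longlonglongrightarrow> enn2real (weighted_int (\<gamma> + 2) (weak_gradient u))"
    and Z: "weighted_int (\<gamma> + 4) u < \<infinity>" "(\<lambda>n. mass (\<phi> n)) \<longlonglongrightarrow> enn2real (weighted_int (\<gamma> + 4) u)"
    by (rule D22_limits[OF u], rule that)
  have t: "tf (\<phi> n)" for n using t' by blast
  define x where "x = enn2real (weighted_int \<gamma> (weak_laplacian u))"
  define y where "y = enn2real (weighted_int (\<gamma> + 2) (weak_gradient u))"
  define z where "z = enn2real (weighted_int (\<gamma> + 4) u)"
  have e: "weighted_int \<gamma> (weak_laplacian u) = ennreal x" "weighted_int (\<gamma> + 2) (weak_gradient u) = ennreal y"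
    "weighted_int (\<gamma> + 4) u = ennreal z" using X(1) Y(1) Z(1) by (auto simp: x_def y_def z_def)
  have nn: "0 \<le> x" "0 \<le> y" "0 \<le> z" by (auto simp: x_def y_def z_def)
  have rl: "ennreal (a\<^sup>2 + b\<^sup>2) * ennreal y = ennreal ((a\<^sup>2 + b\<^sup>2) * y)"
      "ennreal x + ennreal (a ^ 4) * ennreal z = ennreal (x + a ^ 4 * z)"
    using nn by (simp_all add: ennreal_mult ennreal_plus)
  have li: "(\<lambda>n. lap_energy (\<phi> n) + a ^ 4 * mass (\<phi> n) - (a\<^sup>2 + b\<^sup>2) * grad_energy (\<phi> n)) \<longlonglongrightarrow> x + a ^ 4 * z - (a\<^sup>2 + b\<^sup>2) * y"
    unfolding x_def y_def z_def by (intro tendsto_intros X Y Z)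
  have Qle: "defect (\<phi> n) \<le> lap_energy (\<phi> n) + a ^ 4 * mass (\<phi> n) - (a\<^sup>2 + b\<^sup>2) * grad_energy (\<phi> n)" for n
    using test_inequality[OF t[of n]] by linarith
  have "0 \<le> x + a ^ 4 * z - (a\<^sup>2 + b\<^sup>2) * y"
    by (rule LIMSEQ_le_const[OF li]) (use order_trans[OF defect_nonneg Qle] in auto)
  then have le: "(a\<^sup>2 + b\<^sup>2) * y \<le> x + a ^ 4 * z" by simp
  then show "ennreal (a\<^sup>2 + b\<^sup>2) * weighted_int (\<gamma> + 2) (weak_gradient u)
     \<le> weighted_int \<gamma> (weak_laplacian u) + ennreal (a ^ 4) * weighted_int (\<gamma> + 4) u"
    unfolding e rl by (rule ennreal_leI)
  assume nz: "\<not> (AE x in lborel. u x = 0)"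
  have "(a\<^sup>2 + b\<^sup>2) * y \<noteq> x + a ^ 4 * z"
  proof
    assume eq: "(a\<^sup>2 + b\<^sup>2) * y = x + a ^ 4 * z"
    \<comment> \<open>In the case of equality the gap between the two sides tends to 0 along the
      approximants, and it dominates \<open>defect (\<phi> n)\<close>. The masses converge, so the
      two interpolation bounds then send \<open>d\<close> and \<open>J\<close> to 0.\<close>
    have Q0: "(\<lambda>n. defect (\<phi> n)) \<longlonglongrightarrow> 0"
    proof (rule tendsto_sandwich[OF _ _ tendsto_const])
      show "(\<lambda>n. lap_energy (\<phi> n) + a ^ 4 * mass (\<phi> n) - (a\<^sup>2 + b\<^sup>2) * grad_energy (\<phi> n)) \<longlonglongrightarrow> 0" using li eq by simp
    qed (use Qle defect_nonneg in \<open>auto intro!: always_eventually\<close>)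
    have Zl: "(\<lambda>n. mass (\<phi> n)) \<longlonglongrightarrow> z" using Z(2) by (simp add: z_def)
    define d where "d n = ip s (drv a (\<phi> n)) (drv a (\<phi> n))" for n
    have d0: "d \<longlonglongrightarrow> 0"
    proof -
      have "(\<lambda>n. sqrt (mass (\<phi> n) * defect (\<phi> n))) \<longlonglongrightarrow> sqrt (z * 0)"
        by (intro tendsto_intros Zl Q0)
      then have "(\<lambda>n. sqrt (mass (\<phi> n) * defect (\<phi> n))) \<longlonglongrightarrow> 0" by simp
      then show ?thesis
        using log_weight_estimate(2)[OF weight_params t] ip_nonneg[OF weight_params]
        by (intro tendsto_sandwich[of "\<lambda>_. 0" d sequentially "\<lambda>n. sqrt (mass (\<phi> n) * defect (\<phi> n))"])
           (auto simp: d_def mass_def defect_def intro!: always_eventually real_le_rsqrt)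
    qed
    define J where "J n = wI s (\<lambda>x. log_weight x * (\<phi> n x)\<^sup>2)" for n
    have kap0: "0 \<le> log_weight x" and kap1: "log_weight x \<le> 1" for x :: 'a
    proof -
      show "0 \<le> log_weight x" by (simp add: log_weight_def[OF weight_params])
      have "2 * (norm x)\<^sup>2 \<le> ((norm x)\<^sup>2 + 1)\<^sup>2" by (simp add: power2_sum)
      then show "log_weight x \<le> 1" using norm2_add_pos[of 1 x] by (simp add: log_weight_def[OF weight_params] divide_le_eq)
    qed
    have J0: "J \<longlonglongrightarrow> 0"
    proof -
      have "(\<lambda>n. sqrt (4 * (mass (\<phi> n) * d n))) \<longlonglongrightarrow> sqrt (4 * (z * 0))"
        by (intro tendsto_intros Zl d0)
      then have "(\<lambda>n. sqrt (4 * (mass (\<phi> n) * d n))) \<longlonglongrightarrow> 0" by simp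
      moreover have "J n \<le> sqrt (4 * (mass (\<phi> n) * d n))" for n
        using log_weight_estimate(1)[OF weight_params t[of n]] unfolding J_def mass_def d_def by (rule real_le_rsqrt)
      moreover have "0 \<le> J n" for n unfolding J_def by (intro wI_nonneg[OF weight_params] mult_nonneg_nonneg kap0) simp
      ultimately show ?thesis
        by (intro tendsto_sandwich[of "\<lambda>_. 0" J sequentially "\<lambda>n. sqrt (4 * (mass (\<phi> n) * d n))"])
           (auto intro!: always_eventually)
    qed
    have km: "(\<lambda>x::'a. sqrt (log_weight x)) \<in> borel_measurable borel"
      using smooth_measurable[OF log_weight_smooth[OF weight_params]] by measurable
    have JW: "weighted_int (\<gamma> + 4) (\<lambda>x. sqrt (log_weight x) * \<phi> n x) = ennreal (J n)" for n
      unfolding J_def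
    proof (rule weighted_int_wI)
      show "tf (\<lambda>x. log_weight x * (\<phi> n x)\<^sup>2)"
        unfolding power2_eq_square by (intro tf_mult' tf_prod t log_weight_smooth[OF weight_params])
      show "s < real DIM('a)" by (rule params)
      show "0 \<le> log_weight x * (\<phi> n x)\<^sup>2" for x by (simp add: kap0)
      show "(norm (sqrt (log_weight x) * \<phi> n x))\<^sup>2 / norm x powr (\<gamma> + 4) = norm x powr (- s) * (log_weight x * (\<phi> n x)\<^sup>2)" for x
        using kap0[of x] by (simp add: s_def[symmetric] powr_minus_divide power_mult_distrib)
    qed
    \<comment> \<open>Multiplication by \<open>sqrt (log_weight x)\<close>, which is at most 1,
      preserves the weighted convergence. So \<open>J n\<close> also converges to the weighted norm
      of \<open>sqrt (log_weight x) * u x\<close>, which must be 0.\<close>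
    have dl: "(\<lambda>n. weighted_int (\<gamma> + 4) (\<lambda>x. sqrt (log_weight x) * \<phi> n x - sqrt (log_weight x) * u x)) \<longlonglongrightarrow> 0"
    proof (rule tendsto_sandwich[OF _ _ tendsto_const lim])
      have "weighted_int (\<gamma> + 4) (\<lambda>x. sqrt (log_weight x) * \<phi> n x - sqrt (log_weight x) * u x) \<le> weighted_int (\<gamma> + 4) (\<lambda>x. \<phi> n x - u x)" for n
      proof (rule weighted_int_mono)
        fix x
        have "sqrt (log_weight x) * \<bar>\<phi> n x - u x\<bar> \<le> 1 * \<bar>\<phi> n x - u x\<bar>"
          using kap1[of x] by (intro mult_right_mono) auto
        then show "norm (sqrt (log_weight x) * \<phi> n x - sqrt (log_weight x) * u x) \<le> norm (\<phi> n x - u x)"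
          using kap0[of x] by (simp add: right_diff_distrib[symmetric] abs_mult)
      qed
      then show "\<forall>\<^sub>F n in sequentially. weighted_int (\<gamma> + 4) (\<lambda>x. sqrt (log_weight x) * \<phi> n x - sqrt (log_weight x) * u x)
           \<le> weighted_int (\<gamma> + 4) (\<lambda>x. \<phi> n x - u x)" by simp
    qed auto
    note W = weighted_int_tendsto[of "\<lambda>n x. sqrt (log_weight x) * \<phi> n x" "\<lambda>x. sqrt (log_weight x) * u x" "\<gamma> + 4", OF _ _ _ dl]
    have m1: "(\<lambda>x. sqrt (log_weight x) * \<phi> n x) \<in> borel_measurable borel" for n
      using km tf_measurable[OF t[of n]] by simp
    have m2: "(\<lambda>x. sqrt (log_weight x) * u x) \<in> borel_measurable borel" using km um by simp
    have Jn: "0 \<le> J n" for n unfolding J_def by (intro wI_nonneg[OF weight_params] mult_nonneg_nonneg kap0) simp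
    have "(\<lambda>n. enn2real (weighted_int (\<gamma> + 4) (\<lambda>x. sqrt (log_weight x) * \<phi> n x))) \<longlonglongrightarrow> enn2real (weighted_int (\<gamma> + 4) (\<lambda>x. sqrt (log_weight x) * u x))"
      by (rule W(2)) (use m1 m2 in \<open>auto simp: JW\<close>)
    then have "J \<longlonglongrightarrow> enn2real (weighted_int (\<gamma> + 4) (\<lambda>x. sqrt (log_weight x) * u x))"
      by (simp add: JW Jn)
    then have "enn2real (weighted_int (\<gamma> + 4) (\<lambda>x. sqrt (log_weight x) * u x)) = 0" using J0 LIMSEQ_unique by blast
    moreover have "weighted_int (\<gamma> + 4) (\<lambda>x. sqrt (log_weight x) * u x) < \<infinity>"
      by (rule W(1)) (use m1 m2 in \<open>auto simp: JW\<close>)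
    ultimately have "weighted_int (\<gamma> + 4) (\<lambda>x. sqrt (log_weight x) * u x) = 0"
      by (auto simp: enn2real_eq_0_iff)
    then have "AE x in lborel. ennreal ((norm (sqrt (log_weight x) * u x))\<^sup>2 / norm x powr (\<gamma> + 4)) = 0"
      unfolding weighted_int_def using weighted_measurable[OF m2] by (subst (asm) nn_integral_0_iff_AE) auto
    then have "AE x in lborel. u x = 0"
      using AE_lborel_singleton[of 0]
    proof eventually_elim
      case (elim x)
      have "(norm (sqrt (log_weight x) * u x))\<^sup>2 / norm x powr (\<gamma> + 4) \<le> 0"
        using elim(1) by (simp add: ennreal_eq_0_iff)
      then have "(norm (sqrt (log_weight x) * u x))\<^sup>2 \<le> 0" using elim(2) by (simp add: divide_le_0_iff)
      then have "log_weight x = 0 \<or> u x = 0" by simp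
      moreover have "log_weight x \<noteq> 0" using elim(2) norm2_add_pos[of 1 x] by (simp add: log_weight_def[OF weight_params])
      ultimately show ?case by simp
    qed
    then show False using nz by simp
  qed
  then show "ennreal (a\<^sup>2 + b\<^sup>2) * weighted_int (\<gamma> + 2) (weak_gradient u)
     < weighted_int \<gamma> (weak_laplacian u) + ennreal (a ^ 4) * weighted_int (\<gamma> + 4) u"
    unfolding e rl using le nn by (subst ennreal_less_iff) (auto intro!: mult_nonneg_nonneg)
qed

section \<open>Sharpness of the constant\<close>

text \<open>The weight \<open>|x|^-s\<close> and the square of \<open>|x|^-a\<close> combine to
  \<open>|x|^-N\<close>, because \<open>s + 2 a = N\<close>.\<close>

lemma ip_ground:
  fixes w :: "'a \<Rightarrow> real"
  assumes w: "tf w" "\<And>x. norm x < 1 \<Longrightarrow> w x = 0"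
  shows "ennreal (ip s (ground a w) (ground a w)) = (\<integral>\<^sup>+x. ennreal (norm x powr (- real DIM('a))) * ennreal ((w x)\<^sup>2) \<partial>lborel)"
proof -
  have "ennreal (ip s (ground a w) (ground a w)) = (\<integral>\<^sup>+x. ennreal (norm x powr (- s) * (ground a w x * ground a w x)) \<partial>lborel)"
    unfolding ip_def[OF weight_params] wI_def
    by (intro nn_integral_eq_integral[symmetric] tf_integrable_powr tf_prod tf_ground w params) auto
  also have "\<dots> = (\<integral>\<^sup>+x. ennreal (norm x powr (- real DIM('a))) * ennreal ((w x)\<^sup>2) \<partial>lborel)"
  proof (intro nn_integral_cong)
    fix x :: 'a
    show "ennreal (norm x powr (- s) * (ground a w x * ground a w x)) = ennreal (norm x powr (- real DIM('a))) * ennreal ((w x)\<^sup>2)"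
    proof (cases "norm x < 1")
      case True then show ?thesis by (simp add: ground_def w)
    next
      case False
      then have x: "x \<noteq> 0" by auto
      have c: "ground a w x = norm x powr (- a) * w x"
        using False by (simp add: ground_def norm2_reg_eq norm2_powr[OF x])
      have "- real DIM('a) = - s + (- a + - a)" using dim_eq[OF weight_params] by simp
      then have "norm x powr (- real DIM('a)) = norm x powr (- s) * (norm x powr (- a) * norm x powr (- a))"
        by (simp only: powr_add)
      then show ?thesis by (simp add: c ennreal_mult[symmetric] power2_eq_square algebra_simps)
    qed
  qed
  finally show ?thesis .
qed

text \<open>A radial plateau with transition layers at radii 1 to 2 and \<open>2 ^ Suc K\<close> to
  \<open>2 ^ (K + 2)\<close>. The literal factor 1 keeps both terms in the form
  \<open>F (c * |x|^2)\<close> of the radial lemmas.\<close>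

definition slow :: "nat \<Rightarrow> 'a \<Rightarrow> real" where
  "slow K x = cut (1 / 4 ^ Suc K * (norm x)\<^sup>2) - cut (1 * (norm x)\<^sup>2)"

lemma tf_slow: "tf (slow K)"
  unfolding slow_def[abs_def] by (intro tf_diff tf_cut) auto

lemma slow_zero: "norm x < 1 \<Longrightarrow> slow K x = 0"
proof -
  assume "norm x < 1"
  then have 1: "(norm x)\<^sup>2 \<le> 1" by (simp add: abs_square_le_1)
  have "1 / 4 ^ Suc K \<le> (1 :: real)" using one_le_power[of "4 :: real" "Suc K"] by (simp add: divide_le_eq)
  then have "1 / 4 ^ Suc K * (norm x)\<^sup>2 \<le> 1 * 1" using 1 by (intro mult_mono) auto
  then show ?thesis using 1 by (simp add: slow_def cut_one)
qed

lemma slow_one: "2 \<le> norm x \<Longrightarrow> norm x < 2 ^ Suc K \<Longrightarrow> slow K x = 1"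
proof -
  assume n: "2 \<le> norm x" "norm x < 2 ^ Suc K"
  have "(norm x)\<^sup>2 \<le> (2 ^ Suc K)\<^sup>2" using n by (intro power_mono) auto
  also have "(2 ^ Suc K)\<^sup>2 = (4::real) ^ Suc K" by (simp only: power_mult[symmetric] mult.commute[of _ 2]) (simp add: power_mult)
  finally have "1 / 4 ^ Suc K * (norm x)\<^sup>2 \<le> 1" by (simp add: divide_le_eq)
  moreover have "(norm x)\<^sup>2 \<ge> 4" using power_mono[OF n(1), of 2] by simp
  ultimately show ?thesis by (simp only: slow_def) (simp add: cut_one cut_zero)
qed

lemma euler_slow: "euler (slow K) = (\<lambda>x. tderiv cut (1 / 4 ^ Suc K * (norm x)\<^sup>2) - tderiv cut (1 * (norm x)\<^sup>2))"
  unfolding slow_def[abs_def]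
  by (subst euler_diff[OF smooth_radial[OF smooth_cut] smooth_radial[OF smooth_cut]]) (simp only: euler_radial[OF smooth_cut])

lemma euler_euler_slow: "euler (euler (slow K)) =
   (\<lambda>x. tderiv (tderiv cut) (1 / 4 ^ Suc K * (norm x)\<^sup>2) - tderiv (tderiv cut) (1 * (norm x)\<^sup>2))"
  unfolding euler_slow
  by (subst euler_diff[OF smooth_radial[OF smooth_tderiv[OF smooth_cut]] smooth_radial[OF smooth_tderiv[OF smooth_cut]]])
     (simp only: euler_radial[OF smooth_tderiv[OF smooth_cut]])

text \<open>The ground state substitution turns \<open>D^2\<close> into two Euler derivatives of the
  plateau, supported in the two transition layers. The outer layer is a dilate of the inner one and
  contributes the same integral \<open>p\<close>; the square of the difference of both contributions
  costs a factor 2 each, hence \<open>4 * p\<close>.\<close>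

lemma slow_bounded:
  obtains M where "\<And>K. defect (ground a (slow K)) \<le> M"
proof -
  let ?N = "real DIM('a)"
  let ?w = "\<lambda>x::'a. ennreal (norm x powr (- ?N))"
  define G where "G = tderiv (tderiv cut)"
  define f where "f x = ennreal ((G (1 * (norm x)\<^sup>2))\<^sup>2)" for x :: 'a
  have sG: "smooth G" unfolding G_def by (intro smooth_tderiv smooth_cut)
  have Gm: "(\<lambda>x::'a. G (c * (norm x)\<^sup>2)) \<in> borel_measurable borel" for c
    by (rule smooth_measurable[OF smooth_radial[OF sG]])
  have fm: "f \<in> borel_measurable borel" unfolding f_def[abs_def] using Gm[of 1] by measurable
  have EE: "euler (euler (\<lambda>x::'a. cut (1 * (norm x)\<^sup>2))) = (\<lambda>x. G (1 * (norm x)\<^sup>2))"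
    unfolding G_def by (simp only: euler_radial[OF smooth_cut] euler_radial[OF smooth_tderiv[OF smooth_cut]])
  have tc: "tf (\<lambda>x::'a. cut (1 * (norm x)\<^sup>2))" by (rule tf_cut) simp
  have tG: "tf (\<lambda>x::'a. G (1 * (norm x)\<^sup>2))" unfolding EE[symmetric] by (intro tf_euler tc)
  have G0: "G (1 * (norm x)\<^sup>2) = 0" if "norm x < 1" for x :: 'a
  proof -
    have "euler (\<lambda>x::'a. cut (1 * (norm x)\<^sup>2)) y = 0" if "norm y < 1" for y
    proof -
      have "euler (\<lambda>x::'a. cut (1 * (norm x)\<^sup>2)) y = euler (\<lambda>x. 1) y"
        by (rule euler_eq_open[of "ball 0 1"]) (use that tf_smooth[OF tc] in \<open>auto simp: abs_square_le_1 intro!: cut_one\<close>)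
      then show ?thesis by (simp add: euler_def)
    qed
    then have "euler (euler (\<lambda>x::'a. cut (1 * (norm x)\<^sup>2))) x = 0"
      by (rule euler_vanish[OF smooth_euler[OF tf_smooth[OF tc]]]) (use that in auto)
    then show ?thesis unfolding EE .
  qed
  define p where "p = (\<integral>\<^sup>+x. ?w x * f x \<partial>lborel)"
  have "p \<le> (\<integral>\<^sup>+x. ennreal (G (1 * (norm x)\<^sup>2) * G (1 * (norm x)\<^sup>2)) \<partial>(lborel :: 'a measure))"
    unfolding p_def
  proof (intro nn_integral_mono)
    fix x :: 'a
    show "?w x * f x \<le> ennreal (G (1 * (norm x)\<^sup>2) * G (1 * (norm x)\<^sup>2))"
    proof (cases "norm x < 1")
      case True then show ?thesis using G0[OF True] by (simp add: f_def)
    next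
      case False
      then have "norm x powr (- ?N) \<le> 1 powr (- ?N)" by (intro powr_mono2') auto
      then have "norm x powr (- ?N) * (G (1 * (norm x)\<^sup>2))\<^sup>2 \<le> 1 * (G (1 * (norm x)\<^sup>2))\<^sup>2"
        by (intro mult_right_mono) auto
      then show ?thesis by (simp add: f_def ennreal_mult[symmetric] power2_eq_square)
    qed
  qed
  also have "\<dots> < \<infinity>"
    by (subst nn_integral_eq_integral[OF tf_integrable[OF tf_prod[OF tG tG]]]) auto
  finally have pf: "p < \<infinity>" .
  have "ennreal (defect (ground a (slow K))) \<le> 4 * p" for K
  proof -
    let ?c = "1 / 4 ^ Suc K :: real"
    have sl: "smooth (slow K)" by (rule tf_smooth[OF tf_slow])
    have z: "\<And>x. norm x < 1 \<Longrightarrow> euler (slow K) x = 0" by (rule euler_vanish[OF sl slow_zero])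
    have "drv a (drv a (ground a (slow K))) = ground a (euler (euler (slow K)))"
      by (simp add: drv_ground[OF sl slow_zero] drv_ground[OF smooth_euler[OF sl] z])
    then have "ennreal (defect (ground a (slow K))) = (\<integral>\<^sup>+x. ?w x * ennreal ((euler (euler (slow K)) x)\<^sup>2) \<partial>lborel)"
      unfolding defect_def
      using ip_ground[of "euler (euler (slow K))"] tf_euler[OF tf_euler[OF tf_slow]] euler_vanish[OF smooth_euler[OF sl] z] by simp
    also have "\<dots> \<le> (\<integral>\<^sup>+x. 2 * (?w x * f (sqrt ?c *\<^sub>R x)) + 2 * (?w x * f x) \<partial>lborel)"
    proof (intro nn_integral_mono)
      fix x :: 'a
      have e: "1 * (norm (sqrt ?c *\<^sub>R x))\<^sup>2 = ?c * (norm x)\<^sup>2" by (simp add: power_mult_distrib power_divide)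
      have "(G (?c * (norm x)\<^sup>2) - G (1 * (norm x)\<^sup>2))\<^sup>2 \<le> 2 * (G (?c * (norm x)\<^sup>2))\<^sup>2 + 2 * (G (1 * (norm x)\<^sup>2))\<^sup>2"
        using zero_le_power2[of "G (?c * (norm x)\<^sup>2) + G (1 * (norm x)\<^sup>2)"]
        unfolding power2_sum power2_diff by linarith
      then have "ennreal ((euler (euler (slow K)) x)\<^sup>2) \<le> 2 * f (sqrt ?c *\<^sub>R x) + 2 * f x"
        unfolding euler_euler_slow f_def e G_def[symmetric]
        by (simp add: ennreal_mult'[symmetric] ennreal_plus[symmetric] del: ennreal_plus flip: ennreal_numeral)
      then have "?w x * ennreal ((euler (euler (slow K)) x)\<^sup>2) \<le> ?w x * (2 * f (sqrt ?c *\<^sub>R x) + 2 * f x)"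
        by (rule mult_left_mono) simp
      then show "?w x * ennreal ((euler (euler (slow K)) x)\<^sup>2) \<le> 2 * (?w x * f (sqrt ?c *\<^sub>R x)) + 2 * (?w x * f x)"
        by (simp add: distrib_left mult.left_commute)
    qed
    also have "\<dots> = 2 * (\<integral>\<^sup>+x. ?w x * f (sqrt ?c *\<^sub>R x) \<partial>lborel) + 2 * p"
    proof -
      have m1: "(\<lambda>x. ?w x * f x) \<in> borel_measurable lborel" using fm by simp
      have m2: "(\<lambda>x. ?w x * f (sqrt ?c *\<^sub>R x)) \<in> borel_measurable lborel" using fm by measurable
      show ?thesis unfolding p_def using m1 m2 by (subst nn_integral_add) (auto simp: nn_integral_cmult)
    qed
    also have "(\<integral>\<^sup>+x. ?w x * f (sqrt ?c *\<^sub>R x) \<partial>lborel) = p"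
      unfolding p_def by (rule nn_integral_scale[OF fm]) simp
    also have "2 * p + 2 * p = 4 * p" by (simp flip: distrib_right)
    finally show ?thesis .
  qed
  moreover have "4 * p < top" using pf by (simp add: ennreal_mult_less_top)
  ultimately have "defect (ground a (slow K)) \<le> enn2real (4 * p)" for K
    using defect_nonneg by (metis enn2real_ennreal enn2real_mono)
  then show ?thesis by (rule that)
qed

text \<open>The plateau equals 1 on \<open>K\<close> dyadic shells of equal positive mass.\<close>

lemma slow_unbounded:
  obtains m where "m > 0" "\<And>K. real K * m \<le> mass (ground a (slow K))"
proof -
  let ?S = "shells 1 TYPE('a)"
  \<comment> \<open>A positive real lower bound is all that is needed, so an infinite value of
    \<open>?S\<close> is simply replaced by 1.\<close>
  have "\<exists>m>0. ennreal m \<le> ?S"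
  proof (cases ?S)
    case (real r)
    then show ?thesis using shells_pos[where 'a='a] by (intro exI[of _ r]) auto
  next
    case top then show ?thesis by (intro exI[of _ 1]) auto
  qed
  then obtain m where m: "m > 0" "ennreal m \<le> ?S" by blast
  have "real K * m \<le> mass (ground a (slow K))" for K
  proof -
    have "ennreal (real K * m) = of_nat K * ennreal m"
      using m(1) by (simp add: ennreal_mult ennreal_of_nat_eq_real_of_nat)
    also have "\<dots> \<le> of_nat K * ?S" by (rule mult_left_mono[OF m(2)]) simp
    also have "\<dots> = shells K TYPE('a)" by (rule shells_eq[symmetric])
    also have "\<dots> \<le> (\<integral>\<^sup>+x. ennreal (norm x powr (- real DIM('a))) * ennreal ((slow K x)\<^sup>2) \<partial>lborel)"
      unfolding shells_def
    proof (intro nn_integral_mono mult_left_mono)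
      fix x :: 'a
      show "indicator {x. 2 \<le> norm x \<and> norm x < 2 ^ Suc K} x \<le> ennreal ((slow K x)\<^sup>2)"
        using slow_one[of x K] by (simp only: indicator_def) auto
    qed simp
    also have "\<dots> = ennreal (mass (ground a (slow K)))"
      unfolding mass_def by (rule ip_ground[OF tf_slow slow_zero, symmetric])
    finally show ?thesis using mass_nonneg by (simp add: ennreal_le_iff)
  qed
  with m(1) show ?thesis by (rule that)
qed

text \<open>On the radial functions \<open>ground a (slow K)\<close> the inequality is an equality
  up to \<open>defect\<close>. A constant \<open>C\<close> above \<open>a^2 + b^2\<close> would
  bound \<open>(C - (a^2 + b^2))\<close> times the gradient energy by the fixed \<open>M\<close>,
  while that energy is at least \<open>a^2\<close> times the mass and so grows linearly in
  \<open>K\<close>.\<close>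

lemma rellich_sharp:
  assumes C: "\<And>u. u \<in> D22 \<gamma> \<Longrightarrow> ennreal C * weighted_int (\<gamma> + 2) (weak_gradient (u :: 'a \<Rightarrow> real))
     \<le> weighted_int \<gamma> (weak_laplacian u) + ennreal (a ^ 4) * weighted_int (\<gamma> + 4) u"
  shows "C \<le> a\<^sup>2 + b\<^sup>2"
proof (rule ccontr)
  assume "\<not> C \<le> a\<^sup>2 + b\<^sup>2"
  then have CB: "C > a\<^sup>2 + b\<^sup>2" by simp
  \<comment> \<open>\<open>ennreal\<close> sends negative numbers to 0, so the assumed inequality
    can be read in the reals only once \<open>C\<close> is known to be nonnegative.\<close>
  then have C0: "C \<ge> 0" by (smt (verit) zero_le_power2)
  obtain M where M: "\<And>K. defect (ground a (slow K)) \<le> M" using slow_bounded by blast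
  obtain m where m: "m > 0" "\<And>K. real K * m \<le> mass (ground a (slow K))" using slow_unbounded by blast
  have "(C - (a\<^sup>2 + b\<^sup>2)) * (a\<^sup>2 * (real K * m)) \<le> M" for K
  proof -
    let ?u = "ground a (slow K)"
    have t: "tf ?u" by (rule tf_ground[OF tf_slow])
    have rs: "rot i j (slow K) = (\<lambda>x. 0)" if "i \<in> Basis" "j \<in> Basis" for i j
    proof -
      have "rot i j (slow K) x = rot i j (\<lambda>x. cut (1 / 4 ^ Suc K * (norm x)\<^sup>2)) x - rot i j (\<lambda>x. cut (1 * (norm x)\<^sup>2)) x" for x
        unfolding slow_def[abs_def] rot_def
        by (simp only: smooth_pd_diff[OF smooth_radial[OF smooth_cut] smooth_radial[OF smooth_cut]]) (simp add: algebra_simps)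
      then show ?thesis by (simp only: rot_radial[OF smooth_cut that] diff_self fun_eq_iff simp_thms)
    qed
    have rad: "rot i j ?u = (\<lambda>x. 0)" if "i \<in> Basis" "j \<in> Basis" for i j
      by (rule rot_ground[OF tf_smooth[OF tf_slow] rs[OF that] that])
    have "weighted_int \<gamma> (weak_laplacian ?u) = ennreal (lap_energy ?u)"
      using weighted_int_cong_AE[OF weak_laplacian_unique[OF tf_has_weak_laplacian[OF t]]] weighted_int_laplacian[OF t] by simp
    moreover have "weighted_int (\<gamma> + 2) (weak_gradient ?u) = ennreal (grad_energy ?u)"
      using weighted_int_cong_AE[OF weak_gradient_unique[OF tf_has_weak_gradient[OF t]]] weighted_int_grad[OF t] by simp
    moreover have "weighted_int (\<gamma> + 4) ?u = ennreal (mass ?u)" by (rule weighted_int_mass[OF t])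
    ultimately have "ennreal C * ennreal (grad_energy ?u) \<le> ennreal (lap_energy ?u) + ennreal (a ^ 4) * ennreal (mass ?u)"
      using C[OF tf_D22[OF t]] by simp
    then have "C * grad_energy ?u \<le> lap_energy ?u + a ^ 4 * mass ?u"
      using C0 lap_energy_nonneg[of ?u] grad_energy_nonneg[of ?u] mass_nonneg[of ?u]
      by (simp add: ennreal_mult[symmetric] ennreal_plus[symmetric] del: ennreal_plus)
    also have "\<dots> = (a\<^sup>2 + b\<^sup>2) * grad_energy ?u + defect ?u"
      using radial_identity[OF weight_params t rad] unfolding lap_energy_def grad_energy_def mass_def defect_def b_def by simp
    finally have 1: "(C - (a\<^sup>2 + b\<^sup>2)) * grad_energy ?u \<le> defect ?u" by (simp add: algebra_simps)
    have "a\<^sup>2 * mass ?u \<le> grad_energy ?u"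
      using gradient_identity[OF weight_params t] ip_nonneg[OF weight_params, of "drv a ?u"] gip_nonneg[OF weight_params, of ?u]
      unfolding grad_energy_def mass_def by simp
    moreover have "a\<^sup>2 * (real K * m) \<le> a\<^sup>2 * mass ?u" using m(2)[of K] by (rule mult_left_mono) simp
    ultimately have "a\<^sup>2 * (real K * m) \<le> grad_energy ?u" by linarith
    then have "(C - (a\<^sup>2 + b\<^sup>2)) * (a\<^sup>2 * (real K * m)) \<le> (C - (a\<^sup>2 + b\<^sup>2)) * grad_energy ?u"
      using CB by (intro mult_left_mono) auto
    then show ?thesis using 1 M[of K] by linarith
  qed
  moreover have "(C - (a\<^sup>2 + b\<^sup>2)) * (a\<^sup>2 * m) > 0" using CB params(5) m(1) by simp
  then obtain K where "M < real K * ((C - (a\<^sup>2 + b\<^sup>2)) * (a\<^sup>2 * m))" using reals_Archimedean3 by blast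
  ultimately show False by (metis mult.left_commute not_less)
qed

end

theorem corollary3p5:
  fixes \<gamma> N A B :: real and D :: "((real ^ 'n) \<Rightarrow> real) set"
  defines "N \<equiv> real CARD('n)"
    and "A \<equiv> ((N - 4 - \<gamma>) / 2) ^ 4"
    and "B \<equiv> (N\<^sup>2 - 4 * N + 8 + \<gamma>\<^sup>2 + 4 * \<gamma>) / 2"
    and "D \<equiv> D22 \<gamma>"
  assumes "CARD('n) \<ge> 5" and "-2 < \<gamma>" and "\<gamma> \<le> 0"
  shows "(\<forall>u\<in>D. weighted_int \<gamma> (weak_laplacian u) + ennreal A * weighted_int (\<gamma> + 4) u
            \<ge> ennreal B * weighted_int (\<gamma> + 2) (weak_gradient u))
       \<and> (\<forall>C. (\<forall>u\<in>D. weighted_int \<gamma> (weak_laplacian u) + ennreal A * weighted_int (\<gamma> + 4) u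
            \<ge> ennreal C * weighted_int (\<gamma> + 2) (weak_gradient u)) \<longrightarrow> C \<le> B)
       \<and> (\<forall>u\<in>D. \<not> (AE x in lborel. u x = 0) \<longrightarrow>
            weighted_int \<gamma> (weak_laplacian u) + ennreal A * weighted_int (\<gamma> + 4) u
            > ennreal B * weighted_int (\<gamma> + 2) (weak_gradient u))"
proof -
  define s where "s = \<gamma> + 4"
  define a where "a = (real DIM(real ^ 'n) - s) / 2"
  define b where "b = a + s - 2"
  have dim: "DIM(real ^ 'n) \<ge> 5" using assms(5) by simp
  note asm = dim assms(6) assms(7) s_def a_def b_def
  have aN: "a = (N - 4 - \<gamma>) / 2" by (simp add: a_def s_def N_def)
  have bN: "b = (N + \<gamma>) / 2" by (simp add: b_def aN s_def field_simps)
  have A: "A = a ^ 4" by (simp add: A_def aN)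
  \<comment> \<open>The mixed terms in \<open>N * \<gamma>\<close> of the two squares
    cancel.\<close>
  have B: "B = a\<^sup>2 + b\<^sup>2" by (simp add: B_def aN bN power2_eq_square field_simps)
  show ?thesis
    unfolding A B D_def
    using D22_inequality[OF asm] rellich_sharp[OF asm] by blast
qed

end
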